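(* Let $\ell$ be an odd prime, $F$ a complete discrete valuation field of characteristic zero and residue characteristic $\ell$ which is an unramified extension of $\mathbf{Q}_\ell$, and $N$ a finite group of order not divisible by $\ell$. Let $K=F(\zeta_\ell+\zeta_\ell^{-1})$, let $\mathfrak{m}$ be the maximal ideal of $\mathcal{O}_K$, and $k=\mathcal{O}_K/\mathfrak{m}$. Let $W$ be a nonzero $K$-vector space which is an absolutely simple faithful symplectic $K[N]$-module, given by $\rho_1:N\hookrightarrow\mathrm{Aut}_K(W,f_1)$ with $f_1$ nondegenerate alternating, and write $\dim_K W=2t$. Let $V=W\otimes_K K(\zeta_\ell)$ and $G=N\times\mu_\ell$. Let $\rho_2:\mu_\ell\hookrightarrow\mathrm{Aut}_K(V_2,f_2)$ be the action by multiplication on $V_2=K(\zeta_\ell)$ viewed as a $2$-dimensional $K$-vector space, with $f_2(x,y)=\mathrm{tr}_{K(\zeta_\ell)/K}(x\bar y)$ where $\bar{\ }$ is the nontrivial automorphism of $K(\zeta_\ell)/K$; let $f=f_1\otimes f_2$ and $\rho(a,b)=\rho_1(a)\otimes\rho_2(b)$. Then $f$ is a nondegenerate alternating $K$-bilinear form on $V$ and $\rho:G\hookrightarrow\mathrm{Aut}_K(V,f)$ is a faithful irreducible representation. Moreover, if $L$ is a field containing $k$ and $f_0:L^{4t}\times L^{4t}\to L$ is a nondegenerate $L$-bilinear alternating form, then there is no faithful representation $\bar\rho:G\hookrightarrow\mathrm{Aut}_L(L^{4t},f_0)$ such that $\mathrm{tr}(\bar\rho(g))\equiv\mathrm{tr}(\rho(g))\pmod{\mathfrak{m}}$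 for every $g\in G$.
   Context: $\zeta_\ell$ is a primitive $\ell$-th root of unity and $\mu_\ell$ the group it generates. A $K[N]$-module is symplectic if it carries a nondegenerate $N$-invariant alternating $K$-bilinear form. $\mathcal{O}_K$ denotes the valuation ring of $K$. *)

theory Defs
  imports
    "HOL-Analysis.Analysis"
    "HOL-Algebra.Algebraic_Closure_Type"
    "HOL-Library.Poly_Mapping"
    "HOL-Computational_Algebra.Primes"
begin

section \<open>Field extensions\<close>

text \<open>An extension of fields is given by a pair of types and an embedding between them.\<close>

definition field_embedding :: "('a::field \<Rightarrow> 'b::field) \<Rightarrow> bool" where
  "field_embedding h \<longleftrightarrow>
     h 1 = 1 \<and> (\<forall>x y. h (x + y) = h x + h y) \<and> (\<forall>x y. h (x * y) = h x * h y)"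

definition is_subfield :: "'a::field set \<Rightarrow> bool" where
  "is_subfield S \<longleftrightarrow>
     0 \<in> S \<and> 1 \<in> S \<and> (\<forall>x\<in>S. \<forall>y\<in>S. x - y \<in> S \<and> x * y \<in> S) \<and> (\<forall>x\<in>S. inverse x \<in> S)"

definition adjoin :: "'a::field set \<Rightarrow> 'a set \<Rightarrow> 'a set" where
  "adjoin S A = \<Inter>{M. is_subfield M \<and> S \<union> A \<subseteq> M}"

definition primitive_root_of_unity :: "nat \<Rightarrow> 'a::field \<Rightarrow> bool" where
  "primitive_root_of_unity n z \<longleftrightarrow> z ^ n = 1 \<and> (\<forall>k. 0 < k \<and> k < n \<longrightarrow> z ^ k \<noteq> 1)"

definition root_of_unity_group :: "'a::field \<Rightarrow> 'a monoid" where
  "root_of_unity_group z = \<lparr>carrier = range (\<lambda>i::nat. z ^ i), mult = (*), one = 1\<rparr>"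

definition ext_scale :: "('a::field \<Rightarrow> 'b::field) \<Rightarrow> 'a \<Rightarrow> 'b \<Rightarrow> 'b" where
  "ext_scale h c x = h c * x"

text \<open>Only meaningful for an extension with exactly one nontrivial automorphism, such as a
  separable quadratic extension.\<close>

definition nontrivial_automorphism :: "('a::field \<Rightarrow> 'b::field) \<Rightarrow> 'b \<Rightarrow> 'b" where
  "nontrivial_automorphism h =
     (THE \<sigma>. field_embedding \<sigma> \<and> bij \<sigma> \<and> (\<forall>c. \<sigma> (h c) = h c) \<and> \<sigma> \<noteq> id)"


section \<open>Discrete valuations\<close>

text \<open>Valuations are normalized and written additively; the value at \<open>0\<close>, which should be
  infinite, is left unspecified and never used.\<close>

definition discrete_valuation :: "('a::field \<Rightarrow> int) \<Rightarrow> bool" where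
  "discrete_valuation v \<longleftrightarrow>
     (\<forall>x y. x \<noteq> 0 \<longrightarrow> y \<noteq> 0 \<longrightarrow> v (x * y) = v x + v y) \<and>
     (\<forall>x y. x \<noteq> 0 \<longrightarrow> y \<noteq> 0 \<longrightarrow> x + y \<noteq> 0 \<longrightarrow> min (v x) (v y) \<le> v (x + y)) \<and>
     v ` (- {0}) = UNIV"

definition close_at :: "('a::field \<Rightarrow> int) \<Rightarrow> int \<Rightarrow> 'a \<Rightarrow> 'a \<Rightarrow> bool" where
  "close_at v n x y \<longleftrightarrow> x = y \<or> n \<le> v (x - y)"

definition valuation_complete :: "('a::field \<Rightarrow> int) \<Rightarrow> bool" where
  "valuation_complete v \<longleftrightarrow>
     (\<forall>u :: nat \<Rightarrow> 'a. (\<forall>n. \<exists>M. \<forall>i\<ge>M. \<forall>j\<ge>M. close_at v n (u i) (u j)) \<longrightarrow>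
        (\<exists>a. \<forall>n. \<exists>M. \<forall>i\<ge>M. close_at v n (u i) a))"

definition valuation_extends ::
    "('a::field \<Rightarrow> 'b::field) \<Rightarrow> ('a \<Rightarrow> int) \<Rightarrow> ('b \<Rightarrow> int) \<Rightarrow> bool" where
  "valuation_extends h v w \<longleftrightarrow> (\<exists>e>0. \<forall>x. x \<noteq> 0 \<longrightarrow> w (h x) = e * v x)"

definition valuation_ring :: "('a::field \<Rightarrow> int) \<Rightarrow> 'a set" where
  "valuation_ring v = {x. x = 0 \<or> 0 \<le> v x}"

definition maximal_ideal :: "('a::field \<Rightarrow> int) \<Rightarrow> 'a set" where
  "maximal_ideal v = {x. x = 0 \<or> 0 < v x}"

definition residue_class :: "('a::field \<Rightarrow> int) \<Rightarrow> 'a \<Rightarrow> 'a set" where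
  "residue_class v x = {y. y - x \<in> maximal_ideal v}"

text \<open>The residue field is the set \<^term>\<open>residue_class v ` valuation_ring v\<close> with the operations
  induced by representatives; a field containing it is one into which it embeds.\<close>

definition residue_field_embedding ::
    "('a::field \<Rightarrow> int) \<Rightarrow> ('a set \<Rightarrow> 'l::field) \<Rightarrow> bool" where
  "residue_field_embedding v \<phi> \<longleftrightarrow>
     inj_on \<phi> (residue_class v ` valuation_ring v) \<and>
     \<phi> (residue_class v 1) = 1 \<and>
     (\<forall>x\<in>valuation_ring v. \<forall>y\<in>valuation_ring v.
        \<phi> (residue_class v (x + y)) = \<phi> (residue_class v x) + \<phi> (residue_class v y) \<and>
        \<phi> (residue_class v (x * y)) = \<phi> (residue_class v x) * \<phi> (residue_class v y))"


section \<open>Linear algebra\<close>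

text \<open>The choice of the basis is immaterial; the value is junk in infinite dimension.\<close>

definition lin_trace :: "('k::field \<Rightarrow> 'v::ab_group_add \<Rightarrow> 'v) \<Rightarrow> ('v \<Rightarrow> 'v) \<Rightarrow> 'k" where
  "lin_trace s T =
     (let B = (SOME B. \<not> Modules.module.dependent s B \<and> Modules.module.span s B = UNIV)
      in \<Sum>b\<in>B. Modules.module.representation s B (T b) b)"

definition field_trace :: "('a::field \<Rightarrow> 'b::field) \<Rightarrow> 'b \<Rightarrow> 'a" where
  "field_trace h x = lin_trace (ext_scale h) (\<lambda>y. x * y)"

definition finite_dimensional :: "('k::field \<Rightarrow> 'v::ab_group_add \<Rightarrow> 'v) \<Rightarrow> bool" where
  "finite_dimensional s \<longleftrightarrow> (\<exists>B. finite_dimensional_vector_space s B)"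

definition bilinear_form ::
    "('k::field \<Rightarrow> 'v::ab_group_add \<Rightarrow> 'v) \<Rightarrow> ('v \<Rightarrow> 'v \<Rightarrow> 'k) \<Rightarrow> bool" where
  "bilinear_form s f \<longleftrightarrow>
     (\<forall>x. Vector_Spaces.linear s (*) (\<lambda>y. f x y)) \<and>
     (\<forall>y. Vector_Spaces.linear s (*) (\<lambda>x. f x y))"

definition alternating_form :: "('v \<Rightarrow> 'v \<Rightarrow> 'k::zero) \<Rightarrow> bool" where
  "alternating_form f \<longleftrightarrow> (\<forall>x. f x x = 0)"

definition nondegenerate_form :: "('v::zero \<Rightarrow> 'v \<Rightarrow> 'k::zero) \<Rightarrow> bool" where
  "nondegenerate_form f \<longleftrightarrow>
     (\<forall>x. (\<forall>y. f x y = 0) \<longrightarrow> x = 0) \<and> (\<forall>y. (\<forall>x. f x y = 0) \<longrightarrow> y = 0)"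

definition symplectic_form ::
    "('k::field \<Rightarrow> 'v::ab_group_add \<Rightarrow> 'v) \<Rightarrow> ('v \<Rightarrow> 'v \<Rightarrow> 'k) \<Rightarrow> bool" where
  "symplectic_form s f \<longleftrightarrow> bilinear_form s f \<and> alternating_form f \<and> nondegenerate_form f"

definition form_aut_group ::
    "('k::field \<Rightarrow> 'v::ab_group_add \<Rightarrow> 'v) \<Rightarrow> ('v \<Rightarrow> 'v \<Rightarrow> 'k) \<Rightarrow> ('v \<Rightarrow> 'v) monoid" where
  "form_aut_group s f =
     \<lparr>carrier = {T. Vector_Spaces.linear s s T \<and> bij T \<and> (\<forall>x y. f (T x) (T y) = f x y)},
      mult = (\<circ>), one = id\<rparr>"


section \<open>Tensor products\<close>

text \<open>The vector space with basis \<open>'a \<times> 'b\<close>.\<close>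

definition free_scale :: "'k::field \<Rightarrow> ('a \<times> 'b \<Rightarrow>\<^sub>0 'k) \<Rightarrow> ('a \<times> 'b \<Rightarrow>\<^sub>0 'k)" where
  "free_scale c p = Poly_Mapping.map ((*) c) p"

lemma lookup_free_scale [simp]:
  "Poly_Mapping.lookup (free_scale c p) x = c * Poly_Mapping.lookup p x"
  by (simp add: free_scale_def Poly_Mapping.map.rep_eq when_def)

lemma vector_space_free_scale:
  "vector_space (free_scale :: 'k::field \<Rightarrow> ('a \<times> 'b \<Rightarrow>\<^sub>0 'k) \<Rightarrow> _)"
  by unfold_locales (auto intro!: poly_mapping_eqI simp: lookup_add algebra_simps)

definition tensor_relations ::
    "('k::field \<Rightarrow> 'a::ab_group_add \<Rightarrow> 'a) \<Rightarrow> ('k \<Rightarrow> 'b::ab_group_add \<Rightarrow> 'b) \<Rightarrow>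
     ('a \<times> 'b \<Rightarrow>\<^sub>0 'k) set" where
  "tensor_relations s1 s2 =
     {Poly_Mapping.single (a + a', b) 1 - Poly_Mapping.single (a, b) 1
        - Poly_Mapping.single (a', b) 1 | a a' b. True} \<union>
     {Poly_Mapping.single (a, b + b') 1 - Poly_Mapping.single (a, b) 1
        - Poly_Mapping.single (a, b') 1 | a b b'. True} \<union>
     {Poly_Mapping.single (s1 c a, b) 1 - Poly_Mapping.single (a, b) c | c a b. True} \<union>
     {Poly_Mapping.single (a, s2 c b) 1 - Poly_Mapping.single (a, b) c | c a b. True}"

text \<open>\<open>V\<close> (with scalar multiplication \<open>sV\<close>) together with \<open>\<tau> a b = a \<otimes> b\<close> is the tensor
  product: \<open>\<tau>\<close> induces an isomorphism from the quotient of the free vector space by the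
  bilinearity relations onto \<open>V\<close>.\<close>

definition is_tensor_product ::
    "('k::field \<Rightarrow> 'a::ab_group_add \<Rightarrow> 'a) \<Rightarrow> ('k \<Rightarrow> 'b::ab_group_add \<Rightarrow> 'b) \<Rightarrow>
     ('k \<Rightarrow> 'v::ab_group_add \<Rightarrow> 'v) \<Rightarrow> ('a \<Rightarrow> 'b \<Rightarrow> 'v) \<Rightarrow> bool" where
  "is_tensor_product s1 s2 sV \<tau> \<longleftrightarrow>
     (\<exists>\<pi>. Vector_Spaces.linear free_scale sV \<pi> \<and> surj \<pi> \<and>
          {p. \<pi> p = 0} = Modules.module.span free_scale (tensor_relations s1 s2) \<and>
          (\<forall>a b. \<pi> (Poly_Mapping.single (a, b) 1) = \<tau> a b))"

definition tensor_map ::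
    "('k::field \<Rightarrow> 'v::ab_group_add \<Rightarrow> 'v) \<Rightarrow> ('a \<Rightarrow> 'b \<Rightarrow> 'v) \<Rightarrow>
     ('a \<Rightarrow> 'a) \<Rightarrow> ('b \<Rightarrow> 'b) \<Rightarrow> 'v \<Rightarrow> 'v" where
  "tensor_map sV \<tau> S T =
     (THE R. Vector_Spaces.linear sV sV R \<and> (\<forall>a b. R (\<tau> a b) = \<tau> (S a) (T b)))"

definition tensor_form ::
    "('k::field \<Rightarrow> 'v::ab_group_add \<Rightarrow> 'v) \<Rightarrow> ('a \<Rightarrow> 'b \<Rightarrow> 'v) \<Rightarrow>
     ('a \<Rightarrow> 'a \<Rightarrow> 'k) \<Rightarrow> ('b \<Rightarrow> 'b \<Rightarrow> 'k) \<Rightarrow> 'v \<Rightarrow> 'v \<Rightarrow> 'k" where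
  "tensor_form sV \<tau> f1 f2 =
     (THE f. bilinear_form sV f \<and> (\<forall>a b a' b'. f (\<tau> a b) (\<tau> a' b') = f1 a a' * f2 b b'))"


section \<open>Simple and absolutely simple representations\<close>

definition simple_rep ::
    "('k::field \<Rightarrow> 'v::ab_group_add \<Rightarrow> 'v) \<Rightarrow> ('g, 'm) monoid_scheme \<Rightarrow> ('g \<Rightarrow> 'v \<Rightarrow> 'v) \<Rightarrow> bool"
  where
  "simple_rep s G \<rho> \<longleftrightarrow>
     (\<exists>v::'v. v \<noteq> 0) \<and>
     (\<forall>U. Modules.module.subspace s U \<and> (\<forall>g\<in>carrier G. \<rho> g ` U \<subseteq> U) \<longrightarrow> U = {0} \<or> U = UNIV)"

text \<open>\<open>'u\<close> with scalar multiplication \<open>sL\<close> by the larger field \<open>L\<close> is \<open>V \<otimes>\<^sub>K L\<close>, where \<open>L\<close> acts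
  through the second factor.\<close>

definition extension_of_scalars ::
    "('k::field \<Rightarrow> 'l::field) \<Rightarrow> ('k \<Rightarrow> 'v::ab_group_add \<Rightarrow> 'v) \<Rightarrow>
     ('l \<Rightarrow> 'u::ab_group_add \<Rightarrow> 'u) \<Rightarrow> ('v \<Rightarrow> 'l \<Rightarrow> 'u) \<Rightarrow> bool" where
  "extension_of_scalars h s sL \<tau> \<longleftrightarrow>
     vector_space sL \<and>
     is_tensor_product s (ext_scale h) (\<lambda>c. sL (h c)) \<tau> \<and>
     (\<forall>a v b. sL a (\<tau> v b) = \<tau> v (a * b))"

text \<open>Absolute simplicity: simplicity after extension of scalars to an algebraic closure.
  The type argument merely provides the set underlying the extended module; which realization
  of the tensor product is used is immaterial.\<close>

definition absolutely_simple ::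
    "'u::ab_group_add itself \<Rightarrow> ('k::field \<Rightarrow> 'v::ab_group_add \<Rightarrow> 'v) \<Rightarrow>
     ('g, 'm) monoid_scheme \<Rightarrow> ('g \<Rightarrow> 'v \<Rightarrow> 'v) \<Rightarrow> bool" where
  "absolutely_simple _ s G \<rho> \<longleftrightarrow>
     (\<exists>(sL :: 'k alg_closure \<Rightarrow> 'u \<Rightarrow> 'u) \<tau>.
        extension_of_scalars to_ac s sL \<tau> \<and>
        simple_rep sL G (\<lambda>g. tensor_map (\<lambda>c. sL (to_ac c)) \<tau> (\<rho> g) id))"

end

theory Submission
  imports Defs "HOL-Number_Theory.Cong"
begin

text \<open>
  Write \<open>O\<close> for the valuation ring of \<open>K\<close>. The orbit of a basis of \<open>W\<close> contains a basis of an
  \<open>N\<close>-stable lattice, so that \<open>N\<close> acts by matrices \<open>D g\<close> over \<open>O\<close>. By Schur's lemma over an algebraic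
  closure, \<open>\<Sum>g. D g a i * D (inv g) j b = [i = j, a = b] * \<bar>N\<bar> / 2t\<close>; the left-hand side is
  in \<open>O\<close> and \<open>\<bar>N\<bar>\<close> is a unit, hence the right-hand scalar is a unit as well and the relations survive
  reduction to \<open>L\<close>. They provide matrix units in the group algebra. Since the invariant form on \<open>W\<close> is
  alternating, every invariant bilinear form of the reduction is antisymmetric.

  In a representation of \<open>G\<close> on \<open>L\<^sup>4\<^sup>t\<close> with the prescribed trace, a diagonal matrix unit
  has trace \<open>2\<close>, which in odd characteristic forces its range \<open>P\<close> to have dimension at least \<open>2\<close>, so
  that the space is \<open>L\<^sup>2\<^sup>t \<otimes> P\<close> with \<open>dim P = 2\<close>. The invariant alternating form becomes a tensor product with
  a symmetric form on \<open>P\<close>, preserved by the unipotent image of \<open>\<zeta>\<close>. A nontrivial unipotent isometry of a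
  symmetric form on a plane has a vector in the radical, contradicting nondegeneracy.

  The first half needs \<open>\<zeta> \<notin> K\<close>, which follows from ramification: \<open>2 - \<zeta> - \<zeta>\<inverse>\<close> has
  valuation \<open>1\<close> in \<open>K\<close>, whereas \<open>\<zeta> (2 - \<zeta> - \<zeta>\<inverse>) = - (1 - \<zeta>)\<^sup>2\<close> would have
  even valuation if \<open>\<zeta>\<close> were in \<open>K\<close>.
\<close>

section \<open>Coordinates and traces\<close>

text \<open>The obstacle is the passage from K to L: simplicity of W and the form \<open>f1\<close>
  have no direct meaning over L. What does pass is an identity between matrix entries in the
  valuation ring, and two of them carry the proof. Besides orthogonality there is the statement that
  \<Sum>h. D h a i * D h b j changes sign when i and j are exchanged. Over K it holds because, for
  fixed a and b, these sums form an N-invariant bilinear form, which absolute simplicity makes a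
  multiple of the alternating \<open>f1\<close>. Over L every invariant form is a combination of
  such sums, as |N| is invertible there, and so inherits the antisymmetry.

  The image of \<zeta> is unipotent since \<zeta> has order l and l vanishes in L. Symmetry of the
  form on P is decisive: an alternating form on a plane is preserved by every unipotent map. Over K
  the corresponding plane is K(\<zeta>) with its trace form, on which \<zeta> is an isometry that is
  not unipotent.

  The valuation 1 comes from generation: 2 - \<zeta> - \<zeta>^-1 generates K over F, and its
  valuation d is tied to the ramification index by e = d (l - 1) / 2, so d divides every value of
  the normalized valuation.\<close>

lemma linear_map_rules:
  assumes "Vector_Spaces.linear s1 s2 h"
  shows linear_map_add: "h (x + y) = h x + h y"
    and linear_map_scale: "h (s1 a x) = s2 a (h x)"
    and linear_map_0: "h 0 = 0"
    and linear_map_diff: "h (x - y) = h x - h y"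
    and linear_map_sum: "h (\<Sum>i\<in>A. g i) = (\<Sum>i\<in>A. h (g i))"
proof -
  interpret Vector_Spaces.linear s1 s2 h by fact
  show "h (x + y) = h x + h y" "h (s1 a x) = s2 a (h x)" "h 0 = 0" "h (x - y) = h x - h y"
    "h (\<Sum>i\<in>A. g i) = (\<Sum>i\<in>A. h (g i))"
    by (simp_all add: add scale zero diff sum)
qed

lemma linear_mapI:
  assumes "vector_space s1" "vector_space s2"
    and "\<And>x y. h (x + y) = h x + h y" and "\<And>a x. h (s1 a x) = s2 a (h x)"
  shows "Vector_Spaces.linear s1 s2 h"
proof -
  interpret vs1: vector_space s1 by fact
  interpret vs2: vector_space s2 by fact
  show ?thesis by unfold_locales (use assms(3,4) in auto)
qed

lemma linear_map_vector_spaces: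
  assumes "Vector_Spaces.linear s1 s2 h"
  shows "vector_space s1" "vector_space s2"
proof -
  interpret Vector_Spaces.linear s1 s2 h by fact
  show "vector_space s1" "vector_space s2" by unfold_locales
qed

lemma vector_space_field: "vector_space ((*) :: 'a::field \<Rightarrow> 'a \<Rightarrow> 'a)"
  by unfold_locales (auto simp: algebra_simps)

text \<open>A finite basis together with its dual basis. It is indexed by an arbitrary set, so that
  products \<open>I \<times> J\<close> and the standard coordinates of \<open>'l ^ 'd\<close> fit;
  matrix entries are then \<open>c i (T (b j))\<close>.\<close>

definition coord_system ::
    "('k::field \<Rightarrow> 'v::ab_group_add \<Rightarrow> 'v) \<Rightarrow> 'i set \<Rightarrow> ('i \<Rightarrow> 'v) \<Rightarrow> ('i \<Rightarrow> 'v \<Rightarrow> 'k) \<Rightarrow> bool" where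
  "coord_system s I b c \<longleftrightarrow> vector_space s \<and> finite I \<and>
     (\<forall>i\<in>I. Vector_Spaces.linear s (*) (c i)) \<and>
     (\<forall>v. (\<Sum>i\<in>I. s (c i v) (b i)) = v) \<and>
     (\<forall>i\<in>I. \<forall>j\<in>I. c i (b j) = of_bool (i = j))"

lemma coord_system_dest:
  assumes "coord_system s I b c"
  shows "vector_space s" "finite I" "i \<in> I \<Longrightarrow> Vector_Spaces.linear s (*) (c i)"
    "(\<Sum>i\<in>I. s (c i v) (b i)) = v" "i \<in> I \<Longrightarrow> j \<in> I \<Longrightarrow> c i (b j) = of_bool (i = j)"
  using assms by (auto simp: coord_system_def)

lemma coord_system_comp:
  assumes C: "coord_system s I b c" and T: "Vector_Spaces.linear s (*) T"
  shows "T v = (\<Sum>i\<in>I. c i v * T (b i))"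
proof -
  have "T v = T (\<Sum>i\<in>I. s (c i v) (b i))" using coord_system_dest(4)[OF C] by simp
  thus ?thesis by (simp add: linear_map_sum[OF T] linear_map_scale[OF T])
qed

lemma coord_system_eqI:
  assumes C: "coord_system s I b c" and "\<And>i. i \<in> I \<Longrightarrow> c i v = c i w"
  shows "v = w"
proof -
  have "(\<Sum>i\<in>I. s (c i v) (b i)) = (\<Sum>i\<in>I. s (c i w) (b i))"
    by (intro sum.cong refl) (simp add: assms(2))
  thus ?thesis using coord_system_dest(4)[OF C] by simp
qed

lemma linear_map_compose:
  assumes "Vector_Spaces.linear s1 s2 g" "Vector_Spaces.linear s2 s3 h"
  shows "Vector_Spaces.linear s1 s3 (\<lambda>x. h (g x))"
  by (rule linear_mapI) (use assms in \<open>auto intro: linear_map_vector_spaces simp: linear_map_add linear_map_scale\<close>)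

text \<open>Both sides come from one double sum: expand \<open>b i\<close> in the second basis
  inside the functional v \<mapsto> c i (T v), exchange the sums, and read the inner sum as the
  expansion of \<open>c' j\<close> in the first basis. This is tr(PQ) = tr(QP).\<close>

lemma coord_trace_unique:
  assumes C: "coord_system s I b c" and C': "coord_system s J b' c'"
    and T: "Vector_Spaces.linear s s T"
  shows "(\<Sum>i\<in>I. c i (T (b i))) = (\<Sum>j\<in>J. c' j (T (b' j)))"
proof -
  have "(\<Sum>i\<in>I. c i (T (b i))) = (\<Sum>i\<in>I. \<Sum>j\<in>J. c' j (b i) * c i (T (b' j)))"
    by (intro sum.cong refl coord_system_comp[OF C'] linear_map_compose[OF T] coord_system_dest(3)[OF C])
  also have "\<dots> = (\<Sum>j\<in>J. \<Sum>i\<in>I. c i (T (b' j)) * c' j (b i))"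
    by (subst sum.swap) (simp add: mult.commute)
  also have "\<dots> = (\<Sum>j\<in>J. c' j (T (b' j)))"
    by (intro sum.cong refl coord_system_comp[OF C, symmetric] coord_system_dest(3)[OF C'])
  finally show ?thesis .
qed

lemma basis_coord_system:
  assumes vs: "vector_space s" and fin: "finite B" and ind: "\<not> Modules.module.dependent s B"
    and sp: "Modules.module.span s B = UNIV"
  shows "coord_system s B (\<lambda>b. b) (\<lambda>b v. Modules.module.representation s B v b)"
proof -
  interpret vector_space s by fact
  have ind: "independent B" and sp: "span B = UNIV" using ind sp by auto
  show ?thesis unfolding coord_system_def
  proof (intro conjI ballI allI)
    fix i assume "i \<in> B"
    show "Vector_Spaces.linear s (*) (\<lambda>v. representation B v i)"
      by (rule linear_mapI[OF vs vector_space_field])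
         (auto simp: representation_add[OF ind] representation_scale[OF ind] sp)
  next
    fix v show "(\<Sum>i\<in>B. s (representation B v i) i) = v"
      using sum_representation_eq[OF ind _ fin order_refl, of v] sp by simp
  next
    fix i j assume "i \<in> B" "j \<in> B"
    thus "representation B j i = of_bool (i = j)"
      using representation_basis[OF ind] by auto
  qed (use vs fin in auto)
qed

lemma coord_system_independent:
  assumes C: "coord_system s I b c"
  shows "inj_on b I" "\<not> Modules.module.dependent s (b ` I)" "Modules.module.span s (b ` I) = UNIV"
proof -
  interpret vector_space s using coord_system_dest(1)[OF C] .
  have fin: "finite I" using C by (auto simp: coord_system_def)
  show inj: "inj_on b I"
  proof (rule inj_onI)
    fix i j assume ij: "i \<in> I" "j \<in> I" "b i = b j"
    have "c i (b i) = c i (b j)" using ij(3) by simp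
    thus "i = j" using coord_system_dest(5)[OF C ij(1) ij(1)] coord_system_dest(5)[OF C ij(1,2)]
      by (cases "i = j") auto
  qed
  show "independent (b ` I)"
    unfolding independent_explicit_finite_subsets
  proof (intro allI impI ballI)
    fix A u v assume A: "A \<subseteq> b ` I" "finite A" "(\<Sum>v\<in>A. s (u v) v) = 0" "v \<in> A"
    obtain J where J: "J \<subseteq> I" "A = b ` J" using A(1) subset_imageE by blast
    have z: "(\<Sum>j\<in>J. s (u (b j)) (b j)) = 0"
      using A(3) inj J by (simp add: sum.reindex inj_on_subset)
    obtain i where i: "i \<in> J" "v = b i" using A(4) J by auto
    have iI: "i \<in> I" using i J by auto
    have finJ: "finite J" using J fin finite_subset by blast
    have "0 = c i (\<Sum>j\<in>J. s (u (b j)) (b j))"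
      using z linear_map_0[OF coord_system_dest(3)[OF C iI]] by simp
    also have "\<dots> = (\<Sum>j\<in>J. u (b j) * c i (b j))"
      using coord_system_dest(3)[OF C iI] by (simp add: linear_map_sum linear_map_scale)
    also have "\<dots> = (\<Sum>j\<in>J. u (b j) * of_bool (i = j))"
      using J(1) iI by (intro sum.cong refl) (auto simp: coord_system_dest(5)[OF C])
    also have "\<dots> = u (b i)"
      using i(1) finJ by (subst sum.remove[of _ i]) (auto intro!: sum.neutral)
    finally show "u v = 0" using i by simp
  qed
  show "span (b ` I) = UNIV"
  proof -
    have "v \<in> span (b ` I)" for v
    proof -
      have "(\<Sum>i\<in>I. s (c i v) (b i)) \<in> span (b ` I)"
        by (intro span_sum span_scale span_base) auto
      thus ?thesis using coord_system_dest(4)[OF C] by simp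
    qed
    thus ?thesis by auto
  qed
qed

text \<open>\<open>lin_trace\<close> uses an unspecified basis. An independent spanning set is
  finite here, being bounded by the given coordinates, so it yields coordinates of its own and
  \<open>coord_trace_unique\<close> applies.\<close>

lemma lin_trace_eq:
  assumes C: "coord_system s I b c" and T: "Vector_Spaces.linear s s T"
  shows "lin_trace s T = (\<Sum>i\<in>I. c i (T (b i)))"
proof -
  interpret vector_space s using coord_system_dest(1)[OF C] .
  define B where "B = (SOME B. independent B \<and> span B = UNIV)"
  have "independent (b ` I) \<and> span (b ` I) = UNIV"
    using coord_system_independent[OF C] by simp
  hence "independent B \<and> span B = UNIV"
    unfolding B_def by (rule someI)
  hence B: "independent B" "span B = UNIV" by auto
  have "finite B"
    using independent_span_bound[of "b ` I" B] B(1) coord_system_independent(3)[OF C]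
      coord_system_dest(2)[OF C] by simp
  hence "coord_system s B (\<lambda>b. b) (\<lambda>b v. representation B v b)"
    using B by (intro basis_coord_system) (auto intro: vector_space_axioms)
  from coord_trace_unique[OF this C T] show ?thesis
    unfolding lin_trace_def Let_def B_def by simp
qed

section \<open>Valuations and cyclotomic extensions\<close>

lemma field_embeddingD:
  assumes "field_embedding h"
  shows emb_1: "h 1 = 1" and emb_add: "h (x + y) = h x + h y" and emb_mult: "h (x * y) = h x * h y"
    and emb_0: "h 0 = 0" and emb_minus: "h (- x) = - h x" and emb_diff: "h (x - y) = h x - h y"
    and emb_eq_0_iff: "h x = 0 \<longleftrightarrow> x = 0" and emb_inverse: "h (inverse x) = inverse (h x)"
    and emb_divide: "h (x / y) = h x / h y"
    and emb_power: "h (x ^ n) = h x ^ n" and emb_of_nat: "h (of_nat n) = of_nat n"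
    and emb_sum: "h (\<Sum>i\<in>A. g i) = (\<Sum>i\<in>A. h (g i))"
    and emb_prod: "h (\<Prod>i\<in>A. g i) = (\<Prod>i\<in>A. h (g i))"
    and emb_eq_iff: "h x = h y \<longleftrightarrow> x = y"
    and emb_numeral: "h (numeral k) = numeral k"
proof -
  show h1: "h 1 = 1" and hadd: "h (x + y) = h x + h y" and hmult: "h (x * y) = h x * h y" for x y
    using assms by (auto simp: field_embedding_def)
  show h0: "h 0 = 0" using hadd[of 0 0] by (metis add_cancel_right_right add_0)
  show hm: "h (- x) = - h x" for x using hadd[of x "- x"] h0 by (simp add: add_eq_0_iff)
  show hd: "h (x - y) = h x - h y" for x y using hadd[of x "- y"] hm by simp
  have nz: "h x \<noteq> 0" if "x \<noteq> 0" for x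
  proof
    assume "h x = 0"
    hence "h (x * inverse x) = 0" using hmult by simp
    thus False using that h1 by simp
  qed
  show hz: "h x = 0 \<longleftrightarrow> x = 0" for x using nz h0 by auto
  show hi: "h (inverse x) = inverse (h x)" for x
  proof (cases "x = 0")
    case False
    have "h x * h (inverse x) = 1" using hmult[of x "inverse x"] False h1 by simp
    thus ?thesis by (simp add: inverse_unique)
  qed (simp add: h0)
  show "h (x / y) = h x / h y" by (simp add: divide_inverse hmult hi)
  show "h (x ^ n) = h x ^ n" by (induction n) (auto simp: h1 hmult)
  show hn: "h (of_nat n) = of_nat n" for n by (induction n) (auto simp: h0 h1 hadd)
  show "h (\<Sum>i\<in>A. g i) = (\<Sum>i\<in>A. h (g i))"
    by (induction A rule: infinite_finite_induct) (auto simp: h0 hadd)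
  show "h (\<Prod>i\<in>A. g i) = (\<Prod>i\<in>A. h (g i))"
    by (induction A rule: infinite_finite_induct) (auto simp: h1 hmult)
  show "h x = h y \<longleftrightarrow> x = y" using hz[of "x - y"] hd[of x y] by simp
  show "h (numeral k) = numeral k" using hn[of "numeral k"] by simp
qed

lemmas emb_simps = emb_1 emb_add emb_mult emb_0 emb_minus emb_diff emb_eq_0_iff emb_inverse
  emb_divide emb_power emb_of_nat emb_sum emb_prod emb_eq_iff emb_numeral

context
  fixes v :: "'a::field \<Rightarrow> int"
  assumes dv: "discrete_valuation v"
begin

lemma val_mult: "x \<noteq> 0 \<Longrightarrow> y \<noteq> 0 \<Longrightarrow> v (x * y) = v x + v y"
  and val_add: "x \<noteq> 0 \<Longrightarrow> y \<noteq> 0 \<Longrightarrow> x + y \<noteq> 0 \<Longrightarrow> min (v x) (v y) \<le> v (x + y)"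
  using dv by (auto simp: discrete_valuation_def)

lemma val_uniformizer: obtains x where "x \<noteq> 0" "v x = 1"
proof -
  have "1 \<in> v ` (- {0})" using dv by (auto simp: discrete_valuation_def)
  then obtain x where "x \<in> - {0}" "v x = 1" by force
  thus ?thesis using that[of x] by simp
qed

lemma val_1: "v 1 = 0" using val_mult[of 1 1] by simp

lemma val_power: "x \<noteq> 0 \<Longrightarrow> v (x ^ n) = int n * v x"
  by (induction n) (auto simp: val_1 val_mult algebra_simps)

lemma val_root_of_unity: assumes "x ^ n = 1" "n > 0" shows "v x = 0"
proof -
  have "x \<noteq> 0" using assms by (auto simp: power_0_left)
  thus ?thesis using val_power[of x n] assms val_1 by simp
qed

lemma val_minus: "x \<noteq> 0 \<Longrightarrow> v (- x) = v x"
  using val_mult[of "-1" x] val_root_of_unity[of "-1" 2] by simp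

lemma val_divide: "x \<noteq> 0 \<Longrightarrow> y \<noteq> 0 \<Longrightarrow> v (x / y) = v x - v y"
  using val_mult[of "x / y" y] by simp

lemma val_add_less:
  assumes "x \<noteq> 0" "y \<noteq> 0" "v x < v y"
  shows "x + y \<noteq> 0" "v (x + y) = v x"
proof -
  show nz: "x + y \<noteq> 0"
  proof
    assume "x + y = 0"
    hence "y = - x" by (simp add: add_eq_0_iff)
    thus False using val_minus[OF assms(1)] assms(3) by simp
  qed
  have "v (x + y) \<ge> v x" using val_add[OF assms(1,2) nz] assms(3) by simp
  moreover have "min (v (x + y)) (v (- y)) \<le> v (x + y + - y)"
    using assms nz by (intro val_add) auto
  ultimately show "v (x + y) = v x" using val_minus[OF assms(2)] assms(3) by simp
qed

text \<open>Adding a term to a partial sum of different valuation keeps the smaller of the two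
  valuations. The first alternative is separate because the valuation of zero is
  unspecified.\<close>

lemma val_sum_distinct:
  assumes "finite A"
    and "\<And>i j. i \<in> A \<Longrightarrow> j \<in> A \<Longrightarrow> i \<noteq> j \<Longrightarrow> g i \<noteq> 0 \<Longrightarrow> g j \<noteq> 0 \<Longrightarrow> v (g i) \<noteq> v (g j)"
  shows "(\<forall>i\<in>A. g i = 0) \<or> (\<exists>i\<in>A. g i \<noteq> 0 \<and> v (\<Sum>i\<in>A. g i) = v (g i) \<and> (\<Sum>i\<in>A. g i) \<noteq> 0)"
  using assms
proof (induction A rule: finite_induct)
  case (insert a A)
  have IH: "(\<forall>i\<in>A. g i = 0) \<or> (\<exists>i\<in>A. g i \<noteq> 0 \<and> v (\<Sum>i\<in>A. g i) = v (g i) \<and> (\<Sum>i\<in>A. g i) \<noteq> 0)"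
    using insert by blast
  show ?case
  proof (cases "g a = 0 \<or> (\<forall>i\<in>A. g i = 0)")
    case True
    thus ?thesis using IH insert(1,2) by (auto simp: sum.neutral)
  next
    case False
    then obtain i where i: "i \<in> A" "g i \<noteq> 0" "v (\<Sum>i\<in>A. g i) = v (g i)" "(\<Sum>i\<in>A. g i) \<noteq> 0"
      using IH by auto
    have ne: "v (g a) \<noteq> v (g i)" using insert(2) i False by (intro insert.prems) auto
    have S: "(\<Sum>i\<in>insert a A. g i) = g a + (\<Sum>i\<in>A. g i)" using insert by simp
    show ?thesis
    proof (cases "v (g a) < v (g i)")
      case True
      thus ?thesis using val_add_less[of "g a" "\<Sum>i\<in>A. g i"] False i S by auto
    next
      case c: False
      hence "v (\<Sum>i\<in>A. g i) < v (g a)" using ne i by simp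
      thus ?thesis using val_add_less[of "\<Sum>i\<in>A. g i" "g a"] False i S
        by (auto simp: add.commute)
    qed
  qed
qed simp

lemma val_ring_0: "0 \<in> valuation_ring v"
  and val_ring_1: "1 \<in> valuation_ring v"
  by (auto simp: valuation_ring_def val_1)

lemma val_ring_mult:
  assumes "x \<in> valuation_ring v" "y \<in> valuation_ring v" shows "x * y \<in> valuation_ring v"
  using assms val_mult[of x y] by (cases "x = 0 \<or> y = 0") (auto simp: valuation_ring_def)

lemma val_ring_minus: "x \<in> valuation_ring v \<Longrightarrow> - x \<in> valuation_ring v"
  using val_minus[of x] by (cases "x = 0") (auto simp: valuation_ring_def)

lemma val_ring_add:
  assumes "x \<in> valuation_ring v" "y \<in> valuation_ring v" shows "x + y \<in> valuation_ring v"
  using assms val_add[of x y]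
  by (cases "x = 0"; cases "y = 0"; cases "x + y = 0") (auto simp: valuation_ring_def)

lemma val_ring_diff:
  "x \<in> valuation_ring v \<Longrightarrow> y \<in> valuation_ring v \<Longrightarrow> x - y \<in> valuation_ring v"
  using val_ring_add[of x "- y"] val_ring_minus[of y] by simp

lemma val_ring_of_nat: "of_nat n \<in> valuation_ring v"
  by (induction n) (auto intro: val_ring_0 val_ring_1 val_ring_add)

lemma val_ring_sum:
  "(\<And>i. i \<in> A \<Longrightarrow> g i \<in> valuation_ring v) \<Longrightarrow> (\<Sum>i\<in>A. g i) \<in> valuation_ring v"
  by (induction A rule: infinite_finite_induct) (auto intro: val_ring_0 val_ring_add)

end

text \<open>The polynomials 2 T_n(x / 2), with T_n the Chebyshev polynomials. At z + z^-1 they take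
  the value z^n + z^-n, so the conjugates of \<zeta> + \<zeta>^-1 can be handled inside K, without
  \<zeta>.\<close>

fun cheb :: "'a::comm_ring_1 \<Rightarrow> nat \<Rightarrow> 'a" where
  "cheb x 0 = 2" |
  "cheb x (Suc 0) = x" |
  "cheb x (Suc (Suc n)) = x * cheb x (Suc n) - cheb x n"

lemma cheb_power_sum:
  assumes "z * w = 1" shows "cheb (z + w) n = z ^ n + w ^ n"
proof (induction n rule: induct_nat_012)
  case (ge2 n)
  have "(z + w) * (z ^ Suc n + w ^ Suc n) - (z ^ n + w ^ n)
      = z ^ Suc (Suc n) + w ^ Suc (Suc n) + (z * w - 1) * (z ^ n + w ^ n)"
    by (simp add: algebra_simps)
  thus ?case using ge2 assms by simp
qed auto

lemma emb_cheb: assumes "field_embedding h" shows "h (cheb x n) = cheb (h x) n"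
  by (induction n rule: induct_nat_012) (simp_all add: emb_simps[OF assms])

lemma poly_cheb: "poly (cheb p n) x = cheb (poly p x) n"
  by (induction n rule: induct_nat_012) simp_all

lemma degree_cheb: assumes "Polynomial.degree p \<le> 1" shows "Polynomial.degree (cheb p n) \<le> n"
proof (induction n rule: induct_nat_012)
  case (ge2 n)
  have "Polynomial.degree (p * cheb p (Suc n)) \<le> 1 + Suc n"
    using degree_mult_le[of p "cheb p (Suc n)"] assms ge2 by linarith
  thus ?case using ge2 by (auto intro!: degree_diff_le)
qed (use assms in auto)

lemma cheb_2: "cheb 2 n = 2"
  by (induction n rule: induct_nat_012) simp_all

text \<open>Integrality of a root of a monic integer polynomial: a negative valuation of
  \<open>x\<close> would make the leading term dominate, so \<open>cheb x n\<close> would have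
  valuation \<open>n * v x < 0\<close>, while that of 2 is nonnegative.\<close>

lemma val_ring_of_cheb:
  assumes dv: "discrete_valuation v" and n: "n > 0" and c: "cheb x n = 2"
    and two: "2 \<noteq> (0 :: 'a::field)"
  shows "(x :: 'a) \<in> valuation_ring v"
proof (rule ccontr)
  assume x: "x \<notin> valuation_ring v"
  hence x0: "x \<noteq> 0" and vx: "v x < 0" by (auto simp: valuation_ring_def)
  have "2 \<in> valuation_ring v" using val_ring_of_nat[OF dv, of 2] by simp
  hence v2: "v 2 \<ge> 0" using two by (auto simp: valuation_ring_def)
  \<comment> \<open>The last conjunct drives the induction: it makes the subtracted term of the
    recursion negligible. The value zero is set apart because \<open>v 0\<close> carries no
    information.\<close>
  have "cheb x (Suc k) \<noteq> 0 \<and> v (cheb x (Suc k)) = int (Suc k) * v x \<and>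
      (cheb x k = 0 \<or> v (cheb x (Suc k)) < v (cheb x k))" for k
  proof (induction k)
    case 0 thus ?case using x0 vx v2 by auto
  next
    case (Suc k)
    let ?a = "x * cheb x (Suc k)"
    have a: "?a \<noteq> 0" "v ?a = int (Suc (Suc k)) * v x"
      using Suc x0 val_mult[OF dv, of x "cheb x (Suc k)"] by (auto simp: algebra_simps)
    have lt: "v ?a < v (cheb x (Suc k))" using a Suc vx by (auto simp: algebra_simps)
    have "?a - cheb x k \<noteq> 0 \<and> v (?a - cheb x k) = v ?a"
    proof (cases "cheb x k = 0")
      case False
      hence "v ?a < v (- cheb x k)" using Suc lt val_minus[OF dv False] by auto
      thus ?thesis using val_add_less[OF dv, of ?a "- cheb x k"] a False by simp
    qed (use a in auto)
    thus ?case using a(2) lt by simp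
  qed
  from this[of "n - 1"] n have "v (cheb x n) = int n * v x" by simp
  moreover have "int n * v x < 0" using n vx by (simp add: mult_pos_neg)
  ultimately show False using c v2 by simp
qed

text \<open>Since \<open>cheb 2 n = 2\<close>, the polynomial 2 - cheb X n vanishes at 2. The
  recursion builds the cofactor of 2 - X with integer coefficients, so its value at an integral
  \<open>x\<close> is integral.\<close>

lemma cheb_dvd:
  assumes dv: "discrete_valuation v" and x: "x \<in> valuation_ring v"
  shows "\<exists>t\<in>valuation_ring v. 2 - cheb x n = (2 - x) * t"
proof (induction n rule: induct_nat_012)
  case (ge2 n)
  then obtain t u where t: "t \<in> valuation_ring v" "2 - cheb x n = (2 - x) * t"
    and u: "u \<in> valuation_ring v" "2 - cheb x (Suc n) = (2 - x) * u" by auto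
  have "2 - cheb x (Suc (Suc n)) = 2 * (2 - x) + x * (2 - cheb x (Suc n)) - (2 - cheb x n)"
    by (simp add: algebra_simps)
  also have "\<dots> = (2 - x) * (2 + x * u - t)" unfolding t(2) u(2) by (simp add: algebra_simps)
  finally show ?case
    using t u x val_ring_of_nat[OF dv, of 2] val_ring_mult[OF dv] val_ring_add[OF dv] val_ring_diff[OF dv]
    by (intro bexI[of _ "2 + x * u - t"]) auto
qed (auto intro: val_ring_0[OF dv] val_ring_1[OF dv] bexI[of _ 0] bexI[of _ 1])

lemma primitive_root_inj:
  assumes z: "primitive_root_of_unity n z" shows "inj_on (\<lambda>i. z ^ i) {..<n}"
proof -
  have z0: "z \<noteq> 0" if "n > 0" using z that by (auto simp: primitive_root_of_unity_def power_0_left)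
  have "False" if "i < j" "j < n" "z ^ i = z ^ j" for i j
  proof -
    have "z ^ j = z ^ i * z ^ (j - i)" using that by (metis le_add_diff_inverse less_imp_le power_add)
    hence "z ^ (j - i) = 1" using that z0 by simp
    moreover have "0 < j - i" "j - i < n" using that by auto
    ultimately show False using z unfolding primitive_root_of_unity_def by blast
  qed
  thus ?thesis by (intro linorder_inj_onI) (auto simp: )
qed

lemma primitive_root_sum:
  assumes z: "primitive_root_of_unity n z" and k: "0 < k" "k < n"
  shows "(\<Sum>i<n. (z ^ k) ^ i) = (0 :: 'a::field)"
proof -
  have "z ^ k \<noteq> 1" "(z ^ k) ^ n = 1"
    using z k by (auto simp: primitive_root_of_unity_def power_mult[symmetric] mult.commute[of k] power_mult)
  thus ?thesis using geometric_sum[of "z ^ k" n] by simp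
qed

text \<open>The product of the X - z^i and the sum 1 + X + ... + X^(n-1) are monic of degree n - 1
  and share n - 1 distinct roots. Their difference has too many roots for its degree, and the claim
  is their common value at 1.\<close>

lemma primitive_root_prod:
  assumes z: "primitive_root_of_unity n (z :: 'a::field)" and n: "n > 0"
  shows "(\<Prod>i\<in>{1..<n}. 1 - z ^ i) = of_nat n"
proof -
  define P where "P = (\<Prod>i\<in>{1..<n}. [:- (z ^ i), 1:])"
  define Q where "Q = (\<Sum>i<n. Polynomial.monom (1::'a) i)"
  have degP: "Polynomial.degree P = n - 1" unfolding P_def by (subst degree_prod_eq_sum_degree) auto
  have lcP: "Polynomial.coeff P (n - 1) = 1" using lead_coeff_prod[of "\<lambda>i. [:- (z ^ i), 1:]" "{1..<n}"] degP unfolding P_def by simp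
  have cQ: "Polynomial.coeff Q i = of_bool (i < n)" for i
    unfolding Q_def by (auto simp: coeff_sum sum.delta)
  have degQ: "Polynomial.degree Q \<le> n - 1" by (rule degree_le) (auto simp: cQ)
  have "P - Q = 0"
  proof (rule ccontr)
    assume nz: "P - Q \<noteq> 0"
    have "Polynomial.coeff (P - Q) i = 0" if "i \<ge> n - 1" for i
    proof (cases "i = n - 1")
      case True thus ?thesis using lcP degP n by (simp add: cQ)
    next
      case False thus ?thesis using that degP by (simp add: cQ coeff_eq_0)
    qed
    hence "Polynomial.degree (P - Q) < n - 1 \<or> n - 1 = 0"
      using nz by (metis leading_coeff_0_iff not_le)
    moreover have "n - 1 \<noteq> 0" using \<open>\<And>i. i \<ge> n - 1 \<Longrightarrow> Polynomial.coeff (P - Q) i = 0\<close> nz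
      by (metis le0 poly_eqI coeff_0)
    ultimately have d: "Polynomial.degree (P - Q) < n - 1" by simp
    have "(\<lambda>i. z ^ i) ` {1..<n} \<subseteq> {x. poly (P - Q) x = 0}"
    proof safe
      fix i assume i: "i \<in> {1..<n}"
      have "poly P (z ^ i) = 0" unfolding P_def poly_prod
        by (rule prod_zero) (use i in auto)
      moreover have "poly Q (z ^ i) = 0"
        unfolding Q_def poly_sum using primitive_root_sum[OF z, of i] i by (simp add: poly_monom)
      ultimately show "poly (P - Q) (z ^ i) = 0" by simp
    qed
    hence "card ((\<lambda>i. z ^ i) ` {1..<n}) \<le> card {x. poly (P - Q) x = 0}"
      using poly_roots_finite[OF nz] card_mono by blast
    also have "\<dots> \<le> Polynomial.degree (P - Q)" by (rule card_poly_roots_bound[OF nz])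
    finally have "card ((\<lambda>i. z ^ i) ` {1..<n}) < n - 1" using d by simp
    moreover have "inj_on (\<lambda>i. z ^ i) {1..<n}"
      by (rule inj_on_subset[OF primitive_root_inj[OF z]]) auto
    ultimately show False by (simp add: card_image)
  qed
  hence "poly P 1 = poly Q 1" by simp
  thus ?thesis by (simp add: P_def Q_def poly_prod poly_sum poly_monom)
qed

lemma embedding_image_subfield:
  assumes h: "field_embedding h" and S: "is_subfield S" shows "is_subfield (h ` S)"
  using S unfolding is_subfield_def
  by (auto simp: emb_simps[OF h, symmetric] intro!: image_eqI)

lemma poly_map_emb:
  assumes h: "field_embedding h"
  shows "poly (map_poly h (p + q)) x = poly (map_poly h p) x + poly (map_poly h q) x"
    and "poly (map_poly h (p * q)) x = poly (map_poly h p) x * poly (map_poly h q) x"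
    and "poly (map_poly h (p - q)) x = poly (map_poly h p) x - poly (map_poly h q) x"
    and "poly (map_poly h p) x = (\<Sum>i\<le>Polynomial.degree p. h (Polynomial.coeff p i) * x ^ i)"
    and "poly (map_poly h (pCons a p)) x = h a + x * poly (map_poly h p) x"
    and "poly (map_poly h 1) x = 1"
    and "poly (map_poly h 0) x = 0"
proof -
  let ?ev = "\<lambda>p. poly (map_poly h p) x"
  have pc: "?ev (pCons a p) = h a + x * ?ev p" for a p
    by (cases "pCons a p = 0") (auto simp: map_poly_pCons emb_simps[OF h])
  have add: "?ev (p + q) = ?ev p + ?ev q" for p q
    by (induction p q rule: poly_induct2) (auto simp: pc emb_simps[OF h] algebra_simps)
  have smult: "?ev (Polynomial.smult a p) = h a * ?ev p" for a p
    by (induction p) (auto simp: pc emb_simps[OF h] algebra_simps)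
  show "?ev (p * q) = ?ev p * ?ev q"
    by (induction p) (auto simp: pc add smult emb_simps[OF h] algebra_simps)
  have "?ev (p - q) + ?ev q = ?ev p" using add[of "p - q" q] by simp
  thus "?ev (p - q) = ?ev p - ?ev q" by (simp add: algebra_simps)
  show "?ev (p + q) = ?ev p + ?ev q" by (rule add)
  show "?ev (pCons a p) = h a + x * ?ev p" by (rule pc)
  show "?ev 1 = 1" by (simp add: one_pCons pc emb_simps[OF h])
  show "?ev 0 = 0" by simp
  have "Polynomial.degree (map_poly h p) = Polynomial.degree p"
    by (rule degree_map_poly) (auto simp: emb_simps[OF h])
  thus "?ev p = (\<Sum>i\<le>Polynomial.degree p. h (Polynomial.coeff p i) * x ^ i)"
    by (simp add: poly_altdef coeff_map_poly emb_simps[OF h])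
qed

text \<open>The elements 2 - \<zeta>^i - \<zeta>^-i for 0 < i < l have a common valuation d and
  product l^2, whence 2 e = (l - 1) d for the ramification index e of K over F. Next, d divides all
  values of \<open>vK\<close>, so d = 1. The assumption that \<zeta> lies in K enters only
  afterwards, in the parity contradiction.\<close>

lemma zeta_not_in_range:
  fixes vF :: "'f::field_char_0 \<Rightarrow> int" and vK :: "'k::field \<Rightarrow> int"
    and iK :: "'f \<Rightarrow> 'k" and iE :: "'k \<Rightarrow> 'e::field" and \<zeta> :: 'e
  assumes l: "Factorial_Ring.prime l" "odd l"
    and F: "discrete_valuation vF"
    and unramified: "vF (of_nat l) = 1"
    and embeddings: "field_embedding iK" "field_embedding iE"
    and zeta: "primitive_root_of_unity l \<zeta>"
    and K_eq: "range iE = adjoin (range (iE \<circ> iK)) {\<zeta> + inverse \<zeta>}"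
    and vK: "discrete_valuation vK" "valuation_extends iK vF vK"
  shows "\<zeta> \<notin> range iE"
proof
  assume "\<zeta> \<in> range iE"
  then obtain z where z: "\<zeta> = iE z" by auto
  note eK = emb_simps[OF embeddings(1)] and eE = emb_simps[OF embeddings(2)]
  have l3: "l \<ge> 3" using prime_ge_2_nat[OF l(1)] l(2) by (cases "l = 2") auto
  have zl: "\<zeta> ^ l = 1" and z1: "\<And>k. 0 < k \<Longrightarrow> k < l \<Longrightarrow> \<zeta> ^ k \<noteq> 1"
    using zeta by (auto simp: primitive_root_of_unity_def)
  have z0: "\<zeta> \<noteq> 0" using zl l3 by (auto simp: power_0_left)
  have charK: "of_nat n \<noteq> (0 :: 'k)" if "n > 0" for n
    using eK(11)[of n, symmetric] that by (simp add: eK(7))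
  have twoK: "(2 :: 'k) \<noteq> 0" using charK[of 2] by simp
  obtain e where e: "e > 0" "\<And>x. x \<noteq> 0 \<Longrightarrow> vK (iK x) = e * vF x"
    using vK(2) by (auto simp: valuation_extends_def)
  have vl: "vK (of_nat l) = e"
    using e(2)[of "of_nat l"] unramified l3 by (simp add: eK)
  obtain \<eta> where \<eta>: "iE \<eta> = \<zeta> + inverse \<zeta>"
  proof -
    have "\<zeta> + inverse \<zeta> \<in> adjoin (range (iE \<circ> iK)) {\<zeta> + inverse \<zeta>}"
      by (auto simp: adjoin_def)
    thus ?thesis using that K_eq by (metis imageE)
  qed
  \<comment> \<open>Minimality of \<open>adjoin\<close> lives in E; pulled back along the injective
    \<open>iE\<close> it says that K is generated over F by \<open>\<eta>\<close>.\<close>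
  have generate: "S = UNIV" if S: "is_subfield S" "range iK \<subseteq> S" "\<eta> \<in> S" for S
  proof -
    have "range iE \<subseteq> iE ` S"
      unfolding K_eq adjoin_def
      using S embedding_image_subfield[OF embeddings(2) S(1)] \<eta> by (intro Inter_lower) (auto simp flip: \<eta>)
    thus ?thesis by (auto simp: eE image_iff subset_iff)
  qed
  define A where "A i = cheb \<eta> i" for i
  have iEA: "iE (A i) = \<zeta> ^ i + inverse \<zeta> ^ i" for i
    unfolding A_def emb_cheb[OF embeddings(2)] \<eta> using z0 by (intro cheb_power_sum) simp
  have chebA: "cheb (A i) j = A (i * j)" for i j
  proof -
    have "iE (cheb (A i) j) = (\<zeta> ^ i) ^ j + (inverse \<zeta> ^ i) ^ j"
      unfolding emb_cheb[OF embeddings(2)] iEA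
      using z0 by (intro cheb_power_sum) (simp flip: power_mult_distrib)
    hence "iE (cheb (A i) j) = iE (A (i * j))" by (simp add: iEA power_mult)
    thus ?thesis by (simp add: eE)
  qed
  have A1: "A 1 = \<eta>" by (simp add: A_def)
  have Amod: "A (i mod l) = A i" for i
  proof -
    have "x ^ (i mod l) = x ^ i" if "x ^ l = 1" for x :: 'e
    proof -
      have "x ^ i = (x ^ l) ^ (i div l) * x ^ (i mod l)"
        by (simp flip: power_mult power_add)
      thus ?thesis using that by simp
    qed
    from this[of \<zeta>] this[of "inverse \<zeta>"] have "iE (A (i mod l)) = iE (A i)"
      unfolding iEA using zl by (simp add: power_inverse)
    thus ?thesis by (simp add: eE)
  qed
  \<comment> \<open>\<open>A (l * i) = 2\<close> because exponents count modulo \<open>l\<close>, so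
    \<open>A i\<close> is a root of cheb X l - 2.\<close>
  have AO: "A i \<in> valuation_ring vK" for i
  proof -
    have "A (l * i) = 2" using Amod[of "l * i"] by (simp add: A_def)
    hence "cheb (A i) l = 2" using chebA[of i l] by (simp add: mult.commute)
    thus ?thesis using l3 twoK by (intro val_ring_of_cheb[OF vK(1), of l]) auto
  qed
  define \<Lambda> where "\<Lambda> i = 2 - A i" for i
  have \<Lambda>E: "iE (\<Lambda> i) = (1 - \<zeta> ^ i) * (1 - inverse \<zeta> ^ i)" for i
  proof -
    have "\<zeta> ^ i * inverse \<zeta> ^ i = 1" using z0 by (simp flip: power_mult_distrib)
    thus ?thesis by (simp add: \<Lambda>_def eE iEA algebra_simps)
  qed
  have izpow: "inverse \<zeta> ^ i \<noteq> 1" if "0 < i" "i < l" for i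
    using z1[OF that] by (metis inverse_1 inverse_inverse_eq power_inverse)
  have \<Lambda>0: "\<Lambda> i \<noteq> 0" if "0 < i" "i < l" for i
  proof -
    have "iE (\<Lambda> i) \<noteq> 0" unfolding \<Lambda>E using z1[OF that] izpow[OF that] by simp
    thus ?thesis by (simp add: eE)
  qed
  have \<Lambda>_le: "vK (\<Lambda> i) \<le> vK (\<Lambda> (i * j))" if "\<Lambda> i \<noteq> 0" "\<Lambda> (i * j) \<noteq> 0" for i j
  proof -
    obtain t where t: "t \<in> valuation_ring vK" "2 - cheb (A i) j = (2 - A i) * t"
      using cheb_dvd[OF vK(1) AO, of i j] by blast
    hence eq: "\<Lambda> (i * j) = \<Lambda> i * t" by (simp add: \<Lambda>_def chebA)
    hence "t \<noteq> 0" using that by auto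
    thus ?thesis using eq t(1) val_mult[OF vK(1) that(1)] by (simp add: valuation_ring_def)
  qed
  define d where "d = vK (\<Lambda> 1)"
  \<comment> \<open>An inverse \<open>j\<close> of \<open>i\<close> modulo \<open>l\<close> gives
    \<open>\<Lambda> (i * j) = \<Lambda> 1\<close>, so \<open>\<Lambda> i\<close> and
    \<open>\<Lambda> 1\<close> divide each other in the valuation ring.\<close>
  have v\<Lambda>: "vK (\<Lambda> i) = d" if i: "i \<in> {1..<l}" for i
  proof -
    have cop: "coprime i l" using i l(1)
      by (metis atLeastLessThan_iff coprime_commute not_less nat_dvd_not_less prime_imp_coprime zero_less_one le_trans less_eq_Suc_le One_nat_def)
    obtain j where j: "[i * j = 1] (mod l)"
      using cong_solve_coprime_nat[OF cop] by auto
    have 1: "\<Lambda> 1 = \<Lambda> (i * j)"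
      using Amod[of "i * j"] Amod[of 1] j by (simp add: \<Lambda>_def cong_def)
    have "vK (\<Lambda> i) \<le> d"
      unfolding d_def 1 using i \<Lambda>0[of i] \<Lambda>0[of 1] 1 l3 by (intro \<Lambda>_le) auto
    moreover have "d \<le> vK (\<Lambda> i)"
      using \<Lambda>_le[of 1 i] \<Lambda>0[of i] \<Lambda>0[of 1] i l3 by (auto simp: d_def)
    ultimately show ?thesis by simp
  qed
  have izp: "primitive_root_of_unity l (inverse \<zeta>)"
    using zl izpow by (auto simp: primitive_root_of_unity_def power_inverse)
  have prod\<Lambda>: "(\<Prod>i\<in>{1..<l}. \<Lambda> i) = of_nat l * of_nat l"
  proof -
    have "iE (\<Prod>i\<in>{1..<l}. \<Lambda> i) = iE (of_nat l * of_nat l)"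
      using primitive_root_prod[OF zeta] primitive_root_prod[OF izp] l3
      by (simp add: eE \<Lambda>E prod.distrib)
    thus ?thesis by (simp only: eE(14))
  qed
  have "vK (\<Prod>i\<in>{1..<n}. \<Lambda> i) = int (n - 1) * d \<and> (\<Prod>i\<in>{1..<n}. \<Lambda> i) \<noteq> 0" if "n \<le> l" for n
    using that
  proof (induction n)
    case (Suc n)
    show ?case
    proof (cases "n = 0")
      case False
      have "{1..<Suc n} = insert n {1..<n}" using False by auto
      thus ?thesis using Suc False v\<Lambda>[of n] \<Lambda>0[of n] val_mult[OF vK(1), of "\<Lambda> n" "\<Prod>i\<in>{1..<n}. \<Lambda> i"]
        by (simp add: algebra_simps of_nat_diff)
    qed (simp add: val_1[OF vK(1)])
  qed (simp add: val_1[OF vK(1)])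
  from this[of l] have "2 * e = int (l - 1) * d"
    using prod\<Lambda> vl charK[of l] l3 val_mult[OF vK(1), of "of_nat l" "of_nat l"] by simp
  moreover define m where "m = (l - 1) div 2"
  have lm: "l = 2 * m + 1" using l(2) by (auto simp: m_def elim: oddE)
  ultimately have em: "e = int m * d" by simp
  hence d0: "d > 0" using e(1) by (simp add: zero_less_mult_iff)
  have \<Lambda>1: "\<Lambda> (Suc 0) = 2 - \<eta>" using A1 by (simp add: \<Lambda>_def)

  \<comment> \<open>The sum of 1 and all \<zeta>^i + \<zeta>^-i with 1 \<le> i \<le> m is the sum of
    all powers of \<zeta>, hence zero. Written in the variable X = 2 - (\<zeta> + \<zeta>^-1), which
    explains the argument \<open>[:2, -1:]\<close>, it is a polynomial over F of degree at most
    \<open>m\<close> with root \<open>\<Lambda> 1\<close>.\<close>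
  define Q :: "'f poly" where "Q = 1 + (\<Sum>i\<in>{1..m}. cheb [:2, -1:] i)"
  have "poly Q 0 = of_nat l"
    by (simp add: Q_def poly_sum poly_cheb cheb_2 lm)
  hence Q0: "Q \<noteq> 0" using l3 by auto
  have degQ: "Polynomial.degree Q \<le> m" unfolding Q_def
    by (intro degree_add_le degree_sum_le) (auto intro: order_trans[OF degree_cheb])
  define ev where "ev p = poly (map_poly iK p) (\<Lambda> 1)" for p
  note ev = poly_map_emb[OF embeddings(1), where x = "\<Lambda> 1", folded ev_def]
  note evs = ev(1-3,5-7)
  have evcheb: "ev (cheb p i) = cheb (ev p) i" for p i
  proof (induction i rule: induct_nat_012)
    case 0
    have "ev (1 + 1) = 1 + 1" by (simp only: ev(1,6))
    thus ?case by (simp only: one_add_one cheb.simps)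
  qed (simp_all add: evs)
  have "ev Q = 0"
  proof -
    have evsum: "ev (\<Sum>i\<in>I. g i) = (\<Sum>i\<in>I. ev (g i))" for I :: "nat set" and g
      by (induction I rule: infinite_finite_induct) (auto simp: evs)
    have "ev [:2, -1:] = \<eta>" by (simp add: evs eK \<Lambda>1)
    hence "ev Q = 1 + (\<Sum>i\<in>{1..m}. A i)"
      by (simp add: Q_def evs evsum evcheb A_def)
    hence "iE (ev Q) = 1 + (\<Sum>i\<in>{1..m}. \<zeta> ^ i) + (\<Sum>i\<in>{1..m}. inverse \<zeta> ^ i)"
      by (simp add: eE iEA sum.distrib)
    also have "(\<Sum>i\<in>{1..m}. inverse \<zeta> ^ i) = (\<Sum>i\<in>{m+1..<l}. \<zeta> ^ i)"
    proof (rule sum.reindex_bij_witness[of _ "\<lambda>i. l - i" "\<lambda>i. l - i"])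
      fix i assume "i \<in> {1..m}"
      hence "\<zeta> ^ (l - i) * \<zeta> ^ i = 1" using lm zl by (simp flip: power_add)
      thus "\<zeta> ^ (l - i) = inverse \<zeta> ^ i" using z0
        by (metis inverse_unique mult.commute power_inverse)
    qed (use lm in auto)
    also have "1 + (\<Sum>i\<in>{1..m}. \<zeta> ^ i) + (\<Sum>i\<in>{m+1..<l}. \<zeta> ^ i) = (\<Sum>i<l. \<zeta> ^ i)"
    proof -
      have "{..<l} = insert 0 ({1..m} \<union> {m+1..<l})" using lm by auto
      moreover have "(\<Sum>i\<in>insert 0 ({1..m} \<union> {m+1..<l}). \<zeta> ^ i)
          = \<zeta> ^ 0 + (\<Sum>i\<in>{1..m} \<union> {m+1..<l}. \<zeta> ^ i)"
        by (rule sum.insert) auto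
      moreover have "(\<Sum>i\<in>{1..m} \<union> {m+1..<l}. \<zeta> ^ i)
          = (\<Sum>i\<in>{1..m}. \<zeta> ^ i) + (\<Sum>i\<in>{m+1..<l}. \<zeta> ^ i)"
        by (rule sum.union_disjoint) auto
      ultimately show ?thesis by (simp only: power_0 add.assoc)
    qed
    also have "\<dots> = 0" using primitive_root_sum[OF zeta, of 1] l3 by simp
    finally show ?thesis by (simp add: eE)
  qed
  \<comment> \<open>Modulo \<open>Q\<close> only powers \<open>\<Lambda> 1 ^ i\<close> with \<open>i < m\<close> occur; as \<open>e = m d\<close>, the terms of such a sum have
    distinct valuations, all divisible by \<open>d\<close>. Since \<open>vK\<close> is normalized, this will force \<open>d = 1\<close>.\<close>
  have vev: "d dvd vK (ev p)" if nz: "ev p \<noteq> 0" for p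
  proof -
    define r where "r = p mod Q"
    have "ev p = ev (Q * (p div Q) + r)" by (simp add: r_def)
    hence er: "ev p = ev r" using \<open>ev Q = 0\<close> by (simp add: evs)
    have "r \<noteq> 0" using nz er by (auto simp: evs)
    hence degr: "Polynomial.degree r < m"
      using degree_mod_less[OF Q0, of p] degQ by (auto simp: r_def)
    define g where "g i = iK (Polynomial.coeff r i) * \<Lambda> 1 ^ i" for i
    have evr: "ev r = (\<Sum>i\<le>Polynomial.degree r. g i)" unfolding g_def by (rule ev(4))
    have vg: "vK (g i) = d * (int m * vF (Polynomial.coeff r i) + int i)" if "g i \<noteq> 0" for i
    proof -
      have "Polynomial.coeff r i \<noteq> 0" using that by (auto simp: g_def eK)
      thus ?thesis using \<Lambda>0[of 1] l3
        by (simp add: g_def eK val_mult[OF vK(1)] val_power[OF vK(1)] e em d_def algebra_simps)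
    qed
    have "(\<forall>i\<in>{..Polynomial.degree r}. g i = 0) \<or>
      (\<exists>i\<in>{..Polynomial.degree r}. g i \<noteq> 0 \<and> vK (\<Sum>i\<le>Polynomial.degree r. g i) = vK (g i) \<and>
        (\<Sum>i\<le>Polynomial.degree r. g i) \<noteq> 0)"
    proof (rule val_sum_distinct[OF vK(1)])
      fix i j assume ij: "i \<in> {..Polynomial.degree r}" "j \<in> {..Polynomial.degree r}" "i \<noteq> j"
        "g i \<noteq> 0" "g j \<noteq> 0"
      show "vK (g i) \<noteq> vK (g j)"
      proof
        assume "vK (g i) = vK (g j)"
        hence "int m * vF (Polynomial.coeff r i) + int i = int m * vF (Polynomial.coeff r j) + int j"
          using d0 ij by (simp add: vg)
        hence "(int m * vF (Polynomial.coeff r i) + int i) mod int m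
          = (int m * vF (Polynomial.coeff r j) + int j) mod int m" by simp
        thus False using ij degr by simp
      qed
    qed simp
    thus ?thesis using nz er evr vg by auto
  qed
  \<comment> \<open>Quotients of polynomial values at \<open>\<Lambda> 1\<close> form a subfield by
    plain fraction arithmetic, so they exhaust K; divisibility of valuations by \<open>d\<close>
    passes to quotients.\<close>
  define S where "S = {ev p / ev q | p q. ev q \<noteq> 0}"
  have SI: "ev p / ev q \<in> S" if "ev q \<noteq> 0" for p q using that by (auto simp: S_def)
  have "is_subfield S"
    unfolding is_subfield_def
  proof (intro conjI ballI)
    show "0 \<in> S" using SI[of 1 0] by (simp add: evs)
    show "1 \<in> S" using SI[of 1 1] by (simp add: evs)
  next
    fix x y assume "x \<in> S" "y \<in> S"
    then obtain p q p' q' where x: "x = ev p / ev q" "ev q \<noteq> 0" and y: "y = ev p' / ev q'" "ev q' \<noteq> 0"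
      by (auto simp: S_def)
    show "x - y \<in> S" using SI[of "q * q'" "p * q' - p' * q"] x y by (simp add: evs diff_frac_eq)
    show "x * y \<in> S" using SI[of "q * q'" "p * p'"] x y by (simp add: evs)
  next
    fix x assume "x \<in> S"
    then obtain p q where x: "x = ev p / ev q" "ev q \<noteq> 0" by (auto simp: S_def)
    show "inverse x \<in> S"
    proof (cases "ev p = 0")
      case True thus ?thesis using x SI[of 1 0] by (simp add: evs)
    next
      case False thus ?thesis using x SI[of p q] by simp
    qed
  qed
  moreover have "range iK \<subseteq> S"
  proof safe
    fix c show "iK c \<in> S" using SI[of 1 "[:c:]"] by (simp add: evs)
  qed
  moreover have "\<eta> \<in> S" using SI[of 1 "[:2, -1:]"] by (simp add: evs eK \<Lambda>1)
  ultimately have SU: "S = UNIV" by (rule generate)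
  obtain \<pi> where \<pi>: "\<pi> \<noteq> 0" "vK \<pi> = 1" using val_uniformizer[OF vK(1)] by blast
  obtain p q where pq: "\<pi> = ev p / ev q" "ev q \<noteq> 0"
  proof -
    have "\<pi> \<in> S" using SU by simp
    thus ?thesis using that unfolding S_def by blast
  qed
  hence "ev p \<noteq> 0" using \<pi> by auto
  hence "d dvd vK \<pi>" using pq vev by (simp add: val_divide[OF vK(1)])
  hence d1: "d = 1" using \<pi> d0 by (simp add: zdvd1_eq)
  have "iE (z ^ l) = iE 1" using zl z by (simp add: eE)
  hence zl': "z ^ l = 1" by (simp only: eE(14))
  have zn0: "z \<noteq> 0" using z z0 by (auto simp: eE)
  have vz: "vK z = 0" using val_root_of_unity[OF vK(1) zl'] l3 by simp
  have "iE \<eta> = iE (z + inverse z)" using \<eta> z by (simp add: eE)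
  hence "\<eta> = z + inverse z" by (simp only: eE(14))
  hence eq: "\<Lambda> 1 * z = - ((1 - z) * (1 - z))" using zn0 by (simp add: \<Lambda>1 field_simps)
  have z1n: "1 - z \<noteq> 0" using z1[of 1] l3 z by (auto simp: eE)
  have "vK (\<Lambda> 1 * z) = 1" using \<Lambda>0[of 1] l3 zn0 d1 vz val_mult[OF vK(1)] by (simp add: d_def)
  moreover have "vK (- ((1 - z) * (1 - z))) = 2 * vK (1 - z)"
    using z1n by (simp add: val_minus[OF vK(1)] val_mult[OF vK(1)])
  ultimately have "2 * vK (1 - z) = 1" using eq by simp
  thus False by presburger
qed

section \<open>The quadratic extension\<close>

text \<open>The quadratic field E = K(z), where z is a root of X^2 - y X + 1 outside K; the other
  root is the inverse of z. It will be used with z = \<zeta> and y = \<zeta> + \<zeta>^-1.\<close>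

locale inverse_pair_extension =
  fixes h :: "'k::field \<Rightarrow> 'e::field" and z :: 'e and y :: 'k
  assumes emb: "field_embedding h" and z0: "z \<noteq> 0" and y: "h y = z + inverse z"
    and notin: "z \<notin> range h" and gen: "UNIV = adjoin (range h) {z}"
begin

lemmas h_simps = emb_simps[OF emb]

lemma z_square: "z * z = h y * z - 1"
  using z0 by (simp add: y algebra_simps)

lemma inverse_z_square: "inverse z * inverse z = h y * inverse z - 1"
  using z0 by (simp add: y algebra_simps)

lemma independent: assumes "h a + h b * z = 0" shows "a = 0 \<and> b = 0"
proof (cases "b = 0")
  case True thus ?thesis using assms by (simp add: h_simps)
next
  case False
  hence "z = h (- a / b)" using assms by (simp add: h_simps field_simps add_eq_0_iff)
  thus ?thesis using notin by auto
qed

text \<open>The combinations a + b z form a subfield: products reduce by \<open>z_square\<close>,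
  and inverses are obtained from the conjugate and the norm.\<close>

lemma generated: "\<exists>a b. x = h a + h b * z"
proof -
  define M where "M = {h a + h b * z | a b. True}"
  have I: "h a + h b * z \<in> M" for a b by (auto simp: M_def)
  have "is_subfield M"
    unfolding is_subfield_def
  proof (intro conjI ballI)
    show "0 \<in> M" "1 \<in> M" using I[of 0 0] I[of 1 0] by (simp_all add: h_simps)
  next
    fix u v assume "u \<in> M" "v \<in> M"
    then obtain a b c d where u: "u = h a + h b * z" and v: "v = h c + h d * z"
      by (auto simp: M_def)
    have "u - v = h (a - c) + h (b - d) * z" unfolding u v by (simp add: h_simps algebra_simps)
    thus "u - v \<in> M" using I by simp
    have "u * v = h a * h c + (h a * h d + h b * h c) * z + h b * h d * (z * z)"
      unfolding u v by (simp add: algebra_simps)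
    also have "\<dots> = h (a * c - b * d) + h (a * d + b * c + b * d * y) * z"
      unfolding z_square by (simp add: h_simps algebra_simps)
    finally show "u * v \<in> M" using I by simp
  next
    fix u assume "u \<in> M"
    then obtain a b where u: "u = h a + h b * z" by (auto simp: M_def)
    show "inverse u \<in> M"
    proof (cases "u = 0")
      case True thus ?thesis using I[of 0 0] by (simp add: h_simps)
    next
      case False
      \<comment> \<open>The norm (a + b z)(a + b z^-1); its second factor is written (a + b y) - b z
        to stay in the same basis.\<close>
      define n where "n = a * a + a * b * y + b * b"
      have "u * (h (a + b * y) + h (- b) * z)
          = h a * h a + h a * h b * h y + h b * h b * h y * z - h b * h b * (z * z)"
        unfolding u by (simp add: h_simps algebra_simps)
      also have "\<dots> = h n" unfolding z_square by (simp add: h_simps n_def algebra_simps)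
      finally have eq: "u * (h (a + b * y) + h (- b) * z) = h n" .
      have "h (a + b * y) + h (- b) * z \<noteq> 0"
        using independent[of "a + b * y" "- b"] False u by (auto simp: h_simps)
      hence n0: "h n \<noteq> 0" using eq False by (metis mult_eq_0_iff)
      hence "inverse u = (h (a + b * y) + h (- b) * z) / h n"
        using eq False by (simp add: field_simps)
      also have "\<dots> = h ((a + b * y) / n) + h (- b / n) * z"
        using n0 by (simp add: h_simps add_divide_distrib diff_divide_distrib)
      finally show ?thesis using I by simp
    qed
  qed
  moreover have "range h \<subseteq> M" using I[of _ 0] by (auto simp: h_simps)
  moreover have "z \<in> M" using I[of 0 1] by (simp add: h_simps)
  ultimately have "UNIV \<subseteq> M" by (subst gen) (auto simp: adjoin_def)
  thus ?thesis by (auto simp: M_def)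
qed

text \<open>Coordinates along 1 and z, in spite of the names \<open>re\<close> and
  \<open>im\<close>; \<open>re_imI\<close> shows that the choices are unique.\<close>

definition re where "re x = (SOME a. \<exists>b. x = h a + h b * z)"
definition im where "im x = (SOME b. x = h (re x) + h b * z)"

lemma re_im: "h (re x) + h (im x) * z = x"
proof -
  have "\<exists>b. x = h (re x) + h b * z" unfolding re_def by (rule someI_ex) (rule generated)
  hence "x = h (re x) + h (im x) * z" unfolding im_def by (rule someI_ex)
  thus ?thesis by simp
qed

lemma re_imI: assumes "x = h a + h b * z" shows "re x = a" "im x = b"
proof -
  have "h (re x - a) + h (im x - b) * z = 0"
    using re_im[of x] assms by (simp add: h_simps algebra_simps)
  from independent[OF this] show "re x = a" "im x = b" by auto
qed

lemma re_im_add: "re (u + v) = re u + re v" "im (u + v) = im u + im v"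
proof -
  have "u + v = h (re u + re v) + h (im u + im v) * z"
    using re_im[of u] re_im[of v] by (simp add: h_simps algebra_simps)
  from re_imI[OF this] show "re (u + v) = re u + re v" "im (u + v) = im u + im v" .
qed

lemma re_im_scale: "re (h c * v) = c * re v" "im (h c * v) = c * im v"
proof -
  have "h c * v = h c * (h (re v) + h (im v) * z)" by (simp add: re_im)
  hence "h c * v = h (c * re v) + h (c * im v) * z"
    by (simp add: h_simps algebra_simps)
  from re_imI[OF this] show "re (h c * v) = c * re v" "im (h c * v) = c * im v" .
qed

lemma re_im_values: "re 1 = 1" "im 1 = 0" "re z = 0" "im z = 1" "re (h a) = a" "im (h a) = 0"
  using re_imI[of 1 1 0] re_imI[of z 0 1] re_imI[of "h a" a 0] by (auto simp: h_simps)

lemma vector_space_ext: "vector_space (ext_scale h)"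
  by unfold_locales (auto simp: ext_scale_def h_simps algebra_simps)

definition ebasis where "ebasis i = (if i then z else 1)"
definition ecoord where "ecoord i x = (if i then im x else re x)"

lemma coord_system_ext: "coord_system (ext_scale h) (UNIV :: bool set) ebasis ecoord"
  unfolding coord_system_def
proof (intro conjI ballI allI)
  fix i show "Vector_Spaces.linear (ext_scale h) (*) (ecoord i)"
    by (rule linear_mapI[OF vector_space_ext vector_space_field])
      (auto simp: ecoord_def re_im_add ext_scale_def re_im_scale)
next
  fix v show "(\<Sum>i\<in>UNIV. ext_scale h (ecoord i v) (ebasis i)) = v"
    using re_im[of v] by (simp add: UNIV_bool ext_scale_def ecoord_def ebasis_def add.commute)
next
  fix i j show "ecoord i (ebasis j) = of_bool (i = j)"
    by (auto simp: ecoord_def ebasis_def re_im_values)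
qed (auto intro: vector_space_ext)

definition cj where "cj x = h (re x) + h (im x) * inverse z"

text \<open>Both z and its inverse satisfy w^2 = y w - 1, so the product formula derived for z holds
  verbatim with the inverse in its place.\<close>

lemma cj_embedding: "field_embedding cj"
  unfolding field_embedding_def
proof (intro conjI allI)
  show "cj 1 = 1" by (simp add: cj_def re_im_values h_simps)
  fix u v
  show "cj (u + v) = cj u + cj v" by (simp add: cj_def re_im_add h_simps algebra_simps)
  define a b c d where "a = re u" "b = im u" "c = re v" "d = im v"
  have uv: "u = h a + h b * z" "v = h c + h d * z" by (simp_all add: a_b_c_d_def re_im)
  have "u * v = h a * h c + (h a * h d + h b * h c) * z + h b * h d * (z * z)"
    unfolding uv by (simp add: algebra_simps)
  also have "\<dots> = h (a * c - b * d) + h (a * d + b * c + b * d * y) * z"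
    unfolding z_square by (simp add: h_simps algebra_simps)
  finally have "cj (u * v) = h (a * c - b * d) + h (a * d + b * c + b * d * y) * inverse z"
    unfolding cj_def by (simp add: re_imI)
  also have "\<dots> = h a * h c + (h a * h d + h b * h c) * inverse z
      + h b * h d * (inverse z * inverse z)"
    unfolding inverse_z_square by (simp add: h_simps algebra_simps)
  also have "\<dots> = cj u * cj v" by (simp add: cj_def a_b_c_d_def algebra_simps)
  finally show "cj (u * v) = cj u * cj v" .
qed

lemma cj_h: "cj (h a) = h a" by (simp add: cj_def re_im_values h_simps)
lemma cj_z: "cj z = inverse z" by (simp add: cj_def re_im_values h_simps)

lemma cj_cj: "cj (cj x) = x"
proof -
  note c = emb_simps[OF cj_embedding]
  have "cj (inverse z) = z" using cj_z c(8)[of z] by simp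
  hence "cj (cj x) = h (re x) + h (im x) * z"
    unfolding cj_def[of x] by (simp add: c cj_h)
  thus ?thesis by (simp add: re_im)
qed

lemma cj_z_ne: "cj z \<noteq> z"
proof
  assume "cj z = z"
  hence "z * z = 1" using z0 cj_z by (metis left_inverse)
  hence "z = 1 \<or> z = - 1" by (simp add: square_eq_1_iff)
  thus False using notin h_simps(1) h_simps(5)[of 1] by (metis rangeI)
qed

text \<open>An automorphism over K sends z to a root of X^2 - y X + 1, so to z or its inverse, and
  fixing z would make it the identity. The definite description is thus satisfied by
  \<open>cj\<close> alone.\<close>

lemma nontrivial_automorphism_eq: "nontrivial_automorphism h = cj"
  unfolding nontrivial_automorphism_def
proof (rule the_equality)
  have "bij cj" by (rule o_bij[of cj]) (auto simp: cj_cj)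
  thus "field_embedding cj \<and> bij cj \<and> (\<forall>c. cj (h c) = h c) \<and> cj \<noteq> id"
    using cj_embedding cj_h cj_z_ne by auto
next
  fix s assume s: "field_embedding s \<and> bij s \<and> (\<forall>c. s (h c) = h c) \<and> s \<noteq> id"
  note c = emb_simps[OF conjunct1[OF s]]
  have eq: "s x = h (re x) + h (im x) * s z" for x
  proof -
    have "s x = s (h (re x) + h (im x) * z)" by (simp only: re_im)
    thus ?thesis using s by (simp add: c)
  qed
  have "s z \<noteq> z"
  proof
    assume "s z = z"
    hence "s x = x" for x using eq[of x] re_im[of x] by simp
    thus False using s by auto
  qed
  moreover have "s z * s z = h y * s z - 1"
    using z_square s by (metis c(1) c(3) c(6))
  hence "(s z - z) * (s z - inverse z) = 0"
    using z0 by (simp add: y algebra_simps)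
  ultimately have "s z = inverse z" by simp
  hence "s x = cj x" for x using eq[of x] by (simp add: cj_def)
  thus "s = cj" by (rule ext)
qed

text \<open>In the basis 1, z the diagonal entries of multiplication by x are \<open>re x\<close>
  and \<open>im (x * z)\<close>.\<close>

lemma h_field_trace: "h (field_trace h x) = x + cj x"
proof -
  have "Vector_Spaces.linear (ext_scale h) (ext_scale h) (\<lambda>u. x * u)"
    by (rule linear_mapI[OF vector_space_ext vector_space_ext]) (auto simp: ext_scale_def algebra_simps)
  hence "field_trace h x = re x + im (x * z)"
    unfolding field_trace_def
    by (subst lin_trace_eq[OF coord_system_ext])
      (simp_all add: UNIV_bool ecoord_def ebasis_def add.commute)
  also have "x * z = h (- im x) + h (re x + im x * y) * z"
  proof -
    have "x * z = h (re x) * z + h (im x) * (z * z)"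
      using re_im[of x] by (metis distrib_right mult.assoc)
    thus ?thesis unfolding z_square by (simp add: h_simps algebra_simps)
  qed
  hence "im (x * z) = re x + im x * y" by (rule re_imI)
  finally have "h (field_trace h x) = 2 * h (re x) + h (im x) * h y" by (simp add: h_simps)
  also have "\<dots> = (h (re x) + h (im x) * z) + cj x" by (simp add: cj_def y algebra_simps)
  finally show ?thesis by (simp add: re_im)
qed

definition tr_form where "tr_form u v = field_trace h (u * nontrivial_automorphism h v)"

lemma h_tr_form: "h (tr_form u v) = u * cj v + cj u * v"
  by (simp add: tr_form_def nontrivial_automorphism_eq h_field_trace emb_simps[OF cj_embedding] cj_cj)

lemma tr_form_sym: "tr_form u v = tr_form v u"
proof -
  have "h (tr_form u v) = h (tr_form v u)" by (simp add: h_tr_form algebra_simps)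
  thus ?thesis by (simp only: h_simps(14))
qed

lemma tr_form_linear: "Vector_Spaces.linear (ext_scale h) (*) (tr_form u)"
proof (rule linear_mapI[OF vector_space_ext vector_space_field])
  fix x w :: 'e and a :: 'k
  have "h (tr_form u (x + w)) = h (tr_form u x + tr_form u w)"
    by (simp add: h_tr_form h_simps(2) emb_simps[OF cj_embedding] algebra_simps)
  thus "tr_form u (x + w) = tr_form u x + tr_form u w" by (simp only: h_simps(14))
  have "h (tr_form u (ext_scale h a x)) = h (a * tr_form u x)"
    by (simp add: h_tr_form ext_scale_def h_simps(3) emb_simps[OF cj_embedding] cj_h algebra_simps)
  thus "tr_form u (ext_scale h a x) = a * tr_form u x" by (simp only: h_simps(14))
qed

lemma tr_form_nondegenerate:
  assumes "\<And>v. tr_form u v = 0" "(2::'k) \<noteq> 0" shows "u = 0"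
proof (rule ccontr)
  assume u: "u \<noteq> 0"
  hence "cj u \<noteq> 0" by (simp add: emb_simps[OF cj_embedding])
  moreover have "cj (inverse (cj u)) = inverse u"
    by (simp add: emb_simps[OF cj_embedding] cj_cj)
  \<comment> \<open>The test vector v is chosen with u * cj v = 1; the conjugate of this product is
    1 as well, so the trace is 2.\<close>
  ultimately have "h (tr_form u (inverse (cj u))) = 2" using u by (simp add: h_tr_form)
  hence "h 2 = 0" using assms(1) h_simps(4) h_simps(15) by metis
  thus False using assms(2) by (simp only: h_simps(7))
qed

lemma tr_form_isometry:
  assumes "b * cj b = 1" shows "tr_form (b * u) (b * v) = tr_form u v"
proof -
  have "h (tr_form (b * u) (b * v)) = (b * cj b) * (u * cj v + cj u * v)"
    by (simp add: h_tr_form emb_simps[OF cj_embedding] algebra_simps)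
  hence "h (tr_form (b * u) (b * v)) = h (tr_form u v)" using assms by (simp add: h_tr_form)
  thus ?thesis by (simp only: h_simps(14))
qed

end

section \<open>Tensor products\<close>

lemma linear_free_scale_extension:
  fixes sX :: "'k::field \<Rightarrow> 'x::ab_group_add \<Rightarrow> 'x" and g :: "'a \<times> 'b \<Rightarrow> 'x"
  assumes "vector_space sX"
  obtains R where "Vector_Spaces.linear free_scale sX R" "\<And>x. R (Poly_Mapping.single x 1) = g x"
proof -
  interpret vector_space sX by fact
  define R where "R p = (\<Sum>x\<in>Poly_Mapping.keys p. sX (Poly_Mapping.lookup p x) (g x))" for p
  have R: "R p = (\<Sum>x\<in>A. sX (Poly_Mapping.lookup p x) (g x))"
    if "finite A" "Poly_Mapping.keys p \<subseteq> A" for p A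
    unfolding R_def by (rule sum.mono_neutral_left) (use that in \<open>auto simp: in_keys_iff\<close>)
  have "Vector_Spaces.linear free_scale sX R"
  proof (rule linear_mapI[OF vector_space_free_scale vector_space_axioms])
    fix p q :: "'a \<times> 'b \<Rightarrow>\<^sub>0 'k" and c
    let ?A = "Poly_Mapping.keys p \<union> Poly_Mapping.keys q"
    have "Poly_Mapping.keys (p + q) \<subseteq> ?A" by (rule keys_add)
    thus "R (p + q) = R p + R q"
      by (simp add: R[of ?A] lookup_add scale_left_distrib sum.distrib)
    have "Poly_Mapping.keys (free_scale c p) \<subseteq> Poly_Mapping.keys p"
      by (auto simp: in_keys_iff)
    thus "R (free_scale c p) = sX c (R p)"
      by (simp add: R[of "Poly_Mapping.keys p"] scale_sum_right)
  qed
  moreover have "R (Poly_Mapping.single x 1) = g x" for x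
    by (simp add: R_def)
  ultimately show ?thesis using that by blast
qed

lemma free_scale_expansion:
  fixes p :: "'a \<times> 'b \<Rightarrow>\<^sub>0 'k::field"
  shows "p = (\<Sum>x\<in>Poly_Mapping.keys p. free_scale (Poly_Mapping.lookup p x) (Poly_Mapping.single x 1))"
proof (rule poly_mapping_eqI)
  fix k
  have "(\<Sum>x\<in>Poly_Mapping.keys p. Poly_Mapping.lookup p x * Poly_Mapping.lookup (Poly_Mapping.single x 1) k)
      = (\<Sum>x\<in>Poly_Mapping.keys p. if x = k then Poly_Mapping.lookup p x else 0)"
    by (intro sum.cong refl) (auto simp: lookup_single when_def)
  also have "\<dots> = Poly_Mapping.lookup p k"
    by (auto simp: sum.delta in_keys_iff)
  finally show "Poly_Mapping.lookup p k = Poly_Mapping.lookup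
      (\<Sum>x\<in>Poly_Mapping.keys p. free_scale (Poly_Mapping.lookup p x) (Poly_Mapping.single x 1)) k"
    by (simp add: lookup_sum)
qed

locale tensor_product =
  fixes s1 :: "'k::field \<Rightarrow> 'a::ab_group_add \<Rightarrow> 'a" and s2 :: "'k \<Rightarrow> 'b::ab_group_add \<Rightarrow> 'b"
    and sV :: "'k \<Rightarrow> 'v::ab_group_add \<Rightarrow> 'v" and \<tau> :: "'a \<Rightarrow> 'b \<Rightarrow> 'v"
  assumes tensor: "is_tensor_product s1 s2 sV \<tau>"
    and vs1: "vector_space s1" and vs2: "vector_space s2"
begin

definition proj where
  "proj = (SOME \<pi>. Vector_Spaces.linear free_scale sV \<pi> \<and> surj \<pi> \<and>
          {p. \<pi> p = 0} = Modules.module.span free_scale (tensor_relations s1 s2) \<and>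
          (\<forall>a b. \<pi> (Poly_Mapping.single (a, b) 1) = \<tau> a b))"

lemma proj: "Vector_Spaces.linear free_scale sV proj" "surj proj"
  "{p. proj p = 0} = Modules.module.span free_scale (tensor_relations s1 s2)"
  "proj (Poly_Mapping.single (a, b) 1) = \<tau> a b"
  using someI_ex[OF tensor[unfolded is_tensor_product_def]] unfolding proj_def by blast+

lemma vsV: "vector_space sV" using linear_map_vector_spaces(2)[OF proj(1)] .

sublocale F: vector_space "free_scale :: 'k \<Rightarrow> ('a \<times> 'b \<Rightarrow>\<^sub>0 'k) \<Rightarrow> _" by (rule vector_space_free_scale)

lemma linear_eq_on_tensors:
  assumes R: "Vector_Spaces.linear sV sX R" and R': "Vector_Spaces.linear sV sX R'"
    and eq: "\<And>a b. R (\<tau> a b) = R' (\<tau> a b)"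
  shows "R v = R' v"
proof -
  obtain p where p: "v = proj p" using proj(2) by (metis surjD)
  have e: "v = (\<Sum>x\<in>Poly_Mapping.keys p. sV (Poly_Mapping.lookup p x) (\<tau> (fst x) (snd x)))"
    unfolding p
    by (subst free_scale_expansion[of p])
      (simp add: linear_map_sum[OF proj(1)] linear_map_scale[OF proj(1)] proj(4)[symmetric])
  show ?thesis unfolding e
    by (simp add: linear_map_sum[OF R] linear_map_sum[OF R'] linear_map_scale[OF R] linear_map_scale[OF R'] eq)
qed

lemma tensor_zero: assumes "p \<in> tensor_relations s1 s2" shows "proj p = 0"
  using proj(3) F.span_base[OF assms] by auto

lemma single_scale: "Poly_Mapping.single (x :: 'a \<times> 'b) (c :: 'k) = free_scale c (Poly_Mapping.single x 1)"
  by (rule poly_mapping_eqI) (auto simp: lookup_single when_def)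

lemma tensor_add_left: "\<tau> (a + a') b = \<tau> a b + \<tau> a' b"
proof -
  have "proj (Poly_Mapping.single (a + a', b) 1 - Poly_Mapping.single (a, b) 1
        - Poly_Mapping.single (a', b) 1) = 0"
    by (rule tensor_zero) (unfold tensor_relations_def, blast)
  from this[unfolded linear_map_diff[OF proj(1)] proj(4)] show ?thesis by (simp add: algebra_simps)
qed

lemma tensor_add_right: "\<tau> a (b + b') = \<tau> a b + \<tau> a b'"
proof -
  have "proj (Poly_Mapping.single (a, b + b') 1 - Poly_Mapping.single (a, b) 1
        - Poly_Mapping.single (a, b') 1) = 0"
    by (rule tensor_zero) (unfold tensor_relations_def, blast)
  from this[unfolded linear_map_diff[OF proj(1)] proj(4)] show ?thesis by (simp add: algebra_simps)
qed

lemma tensor_scale_left: "\<tau> (s1 c a) b = sV c (\<tau> a b)"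
proof -
  have "proj (Poly_Mapping.single (s1 c a, b) 1 - Poly_Mapping.single (a, b) c) = 0"
    by (rule tensor_zero) (unfold tensor_relations_def, blast)
  thus ?thesis
    by (simp add: linear_map_diff[OF proj(1)] linear_map_scale[OF proj(1)] single_scale[of _ c] proj(4))
qed

lemma tensor_scale_right: "\<tau> a (s2 c b) = sV c (\<tau> a b)"
proof -
  have "proj (Poly_Mapping.single (a, s2 c b) 1 - Poly_Mapping.single (a, b) c) = 0"
    by (rule tensor_zero) (unfold tensor_relations_def, blast)
  thus ?thesis
    by (simp add: linear_map_diff[OF proj(1)] linear_map_scale[OF proj(1)] single_scale[of _ c] proj(4))
qed

lemma tensor_linear_left: "Vector_Spaces.linear s1 sV (\<lambda>a. \<tau> a b)"
  by (rule linear_mapI[OF vs1 vsV]) (auto simp: tensor_add_left tensor_scale_left)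

lemma tensor_linear_right: "Vector_Spaces.linear s2 sV (\<lambda>b. \<tau> a b)"
  by (rule linear_mapI[OF vs2 vsV]) (auto simp: tensor_add_right tensor_scale_right)

text \<open>A bilinear map extends to the free space, where it kills the bilinearity relations and
  hence their span, the kernel of \<open>proj\<close>. It therefore factors through
  \<open>proj\<close>.\<close>

lemma universal:
  assumes left: "\<And>b. Vector_Spaces.linear s1 sX (\<lambda>a. \<beta> a b)"
    and right: "\<And>a. Vector_Spaces.linear s2 sX (\<lambda>b. \<beta> a b)"
  obtains R where "Vector_Spaces.linear sV sX R" "\<And>a b. R (\<tau> a b) = \<beta> a b"
proof -
  have vsX: "vector_space sX" using linear_map_vector_spaces(2)[OF left] .
  interpret X: vector_space sX by fact
  obtain B where B: "Vector_Spaces.linear free_scale sX B"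
    "\<And>x. B (Poly_Mapping.single x 1) = \<beta> (fst x) (snd x)"
    using linear_free_scale_extension[OF vsX, of "\<lambda>x. \<beta> (fst x) (snd x)"] by blast
  have Bs: "B (Poly_Mapping.single x c) = sX c (\<beta> (fst x) (snd x))" for x c
    unfolding single_scale[of x c] linear_map_scale[OF B(1)] B(2) ..
  note lin = linear_map_add[OF left] linear_map_add[OF right] linear_map_scale[OF left] linear_map_scale[OF right]
  have rel: "B p = 0" if "p \<in> tensor_relations s1 s2" for p
    using that unfolding tensor_relations_def
    by (auto simp: linear_map_diff[OF B(1)] Bs lin)
  have "F.subspace {p. B p = 0}"
    by (rule F.subspaceI) (auto simp: linear_map_0[OF B(1)] linear_map_add[OF B(1)] linear_map_scale[OF B(1)])
  hence "F.span (tensor_relations s1 s2) \<subseteq> {p. B p = 0}"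
    by (intro F.span_minimal) (use rel in auto)
  hence ker: "B p = 0" if "proj p = 0" for p using that proj(3) by auto
  have ker': "B p = B q" if "proj p = proj q" for p q
    using ker[of "p - q"] that by (simp add: linear_map_diff[OF B(1)] linear_map_diff[OF proj(1)])
  define R where "R v = B (SOME p. proj p = v)" for v
  have R: "R (proj p) = B p" for p
    unfolding R_def by (rule ker', rule someI) (rule refl)
  have surj: "\<exists>p. v = proj p" for v using proj(2) by (metis surjD)
  have "Vector_Spaces.linear sV sX R"
  proof (rule linear_mapI[OF vsV vsX])
    fix v w c
    obtain p q where pq: "v = proj p" "w = proj q" using surj by metis
    show "R (v + w) = R v + R w"
      unfolding pq linear_map_add[OF proj(1), symmetric] R by (rule linear_map_add[OF B(1)])
    show "R (sV c v) = sX c (R v)"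
      unfolding pq linear_map_scale[OF proj(1), symmetric] R by (rule linear_map_scale[OF B(1)])
  qed
  moreover have "R (\<tau> a b) = \<beta> a b" for a b
    using R[of "Poly_Mapping.single (a, b) 1"] by (simp add: proj(4) B(2))
  ultimately show ?thesis using that by blast
qed

lemma tensor_map:
  assumes S: "Vector_Spaces.linear s1 s1 S" and T: "Vector_Spaces.linear s2 s2 T"
  shows tensor_map_linear: "Vector_Spaces.linear sV sV (tensor_map sV \<tau> S T)"
    and tensor_map_tensor: "tensor_map sV \<tau> S T (\<tau> a b) = \<tau> (S a) (T b)"
proof -
  obtain R where R: "Vector_Spaces.linear sV sV R" "\<And>a b. R (\<tau> a b) = \<tau> (S a) (T b)"
    using universal[of sV "\<lambda>a b. \<tau> (S a) (T b)"]
      linear_map_compose[OF S tensor_linear_left] linear_map_compose[OF T tensor_linear_right] by blast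
  have "tensor_map sV \<tau> S T = R"
    unfolding tensor_map_def
  proof (rule the_equality)
    show "Vector_Spaces.linear sV sV R \<and> (\<forall>a b. R (\<tau> a b) = \<tau> (S a) (T b))" using R by blast
    fix R' assume "Vector_Spaces.linear sV sV R' \<and> (\<forall>a b. R' (\<tau> a b) = \<tau> (S a) (T b))"
    hence "R' v = R v" for v by - (rule linear_eq_on_tensors[of sV], simp_all add: R)
    thus "R' = R" by (rule ext)
  qed
  thus "Vector_Spaces.linear sV sV (tensor_map sV \<tau> S T)"
    "tensor_map sV \<tau> S T (\<tau> a b) = \<tau> (S a) (T b)" using R by auto
qed

lemma bilinear_form_eq_on_tensors:
  assumes f: "bilinear_form sV f" and g: "bilinear_form sV g"
    and eq: "\<And>a b a' b'. f (\<tau> a b) (\<tau> a' b') = g (\<tau> a b) (\<tau> a' b')"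
  shows "f v w = g v w"
proof -
  have "f (\<tau> a b) w = g (\<tau> a b) w" for a b
    by (rule linear_eq_on_tensors[of "(*)"]) (use f g eq in \<open>auto simp: bilinear_form_def\<close>)
  thus ?thesis
    by - (rule linear_eq_on_tensors[of "(*)" "\<lambda>v. f v w"], use f g in \<open>auto simp: bilinear_form_def\<close>)
qed

text \<open>Existence takes two rounds of \<open>universal\<close>: a functional
  \<open>L a' b'\<close> of the first argument for each pure tensor in the second, then, since
  \<open>L a' b' v\<close> is bilinear in \<open>a'\<close> and \<open>b'\<close>, an extension to
  the whole second argument. Uniqueness justifies the definite description.\<close>

lemma tensor_form:
  assumes f1: "bilinear_form s1 f1" and f2: "bilinear_form s2 f2"
  shows tensor_form_bilinear: "bilinear_form sV (tensor_form sV \<tau> f1 f2)"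
    and tensor_form_tensor: "tensor_form sV \<tau> f1 f2 (\<tau> a b) (\<tau> a' b') = f1 a a' * f2 b b'"
proof -
  note l1 = f1[unfolded bilinear_form_def, THEN conjunct1, rule_format]
    f1[unfolded bilinear_form_def, THEN conjunct2, rule_format]
    f2[unfolded bilinear_form_def, THEN conjunct1, rule_format]
    f2[unfolded bilinear_form_def, THEN conjunct2, rule_format]
  note ls = l1[THEN linear_map_add] l1[THEN linear_map_scale]
  have "\<exists>R. Vector_Spaces.linear sV (*) R \<and> (\<forall>a b. R (\<tau> a b) = f1 a a' * f2 b b')" for a' b'
    by (rule universal[of "(*)" "\<lambda>a b. f1 a a' * f2 b b'"])
      (auto intro!: linear_mapI[OF vs1 vector_space_field] linear_mapI[OF vs2 vector_space_field]
        simp: ls algebra_simps)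
  then obtain L where L: "\<And>a' b'. Vector_Spaces.linear sV (*) (L a' b')"
    "\<And>a b a' b'. L a' b' (\<tau> a b) = f1 a a' * f2 b b'" by metis
  \<comment> \<open>The coefficients 1, 1 serve additivity and c, 0 homogeneity of \<open>L\<close>
    in its parameters.\<close>
  have lin: "Vector_Spaces.linear sV (*) (\<lambda>v. x * L a b v + y * L a' b' v)" for a b a' b' x y
    by (rule linear_mapI[OF vsV vector_space_field])
      (auto simp: linear_map_add[OF L(1)] linear_map_scale[OF L(1)] algebra_simps)
  have La: "L (a + a') b v = L a b v + L a' b v" for a a' b v
    using linear_eq_on_tensors[OF L(1) lin[of 1 a b 1 a' b], of "a + a'" b v]
    by (simp add: L(2) ls algebra_simps)
  have Lb: "L a (b + b') v = L a b v + L a b' v" for a b b' v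
    using linear_eq_on_tensors[OF L(1) lin[of 1 a b 1 a b'], of a "b + b'" v]
    by (simp add: L(2) ls algebra_simps)
  have Lc: "L (s1 c a) b v = c * L a b v" for c a b v
    using linear_eq_on_tensors[OF L(1) lin[of c a b 0 a b], of "s1 c a" b v]
    by (simp add: L(2) ls algebra_simps)
  have Ld: "L a (s2 c b) v = c * L a b v" for c a b v
    using linear_eq_on_tensors[OF L(1) lin[of c a b 0 a b], of a "s2 c b" v]
    by (simp add: L(2) ls algebra_simps)
  have "\<exists>R. Vector_Spaces.linear sV (*) R \<and> (\<forall>a b. R (\<tau> a b) = L a b v)" for v
    by (rule universal[of "(*)" "\<lambda>a b. L a b v"])
      (auto intro!: linear_mapI[OF vs1 vector_space_field] linear_mapI[OF vs2 vector_space_field]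
        simp: La Lb Lc Ld)
  then obtain f where f: "\<And>v. Vector_Spaces.linear sV (*) (f v)"
    "\<And>a b v. f v (\<tau> a b) = L a b v" by metis
  have lin2: "Vector_Spaces.linear sV (*) (\<lambda>w. x * f v w + y * f v' w)" for v v' x y
    by (rule linear_mapI[OF vsV vector_space_field])
      (auto simp: linear_map_add[OF f(1)] linear_map_scale[OF f(1)] algebra_simps)
  have "f (v + v') w = f v w + f v' w" for v v' w
    using linear_eq_on_tensors[OF f(1) lin2[of 1 v 1 v'], of "v + v'" w]
    by (simp add: f(2) linear_map_add[OF L(1)])
  moreover have "f (sV c v) w = c * f v w" for c v w
    using linear_eq_on_tensors[OF f(1) lin2[of c v 0 v], of "sV c v" w]
    by (simp add: f(2) linear_map_scale[OF L(1)])
  ultimately have bil: "bilinear_form sV f"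
    unfolding bilinear_form_def using f(1) by (auto intro!: linear_mapI[OF vsV vector_space_field])
  have val: "f (\<tau> a b) (\<tau> a' b') = f1 a a' * f2 b b'" for a b a' b' by (simp add: f(2) L(2))
  have "tensor_form sV \<tau> f1 f2 = f"
    unfolding tensor_form_def
  proof (rule the_equality)
    show "bilinear_form sV f \<and> (\<forall>a b a' b'. f (\<tau> a b) (\<tau> a' b') = f1 a a' * f2 b b')"
      using bil val by blast
    fix g assume g: "bilinear_form sV g \<and> (\<forall>a b a' b'. g (\<tau> a b) (\<tau> a' b') = f1 a a' * f2 b b')"
    have "g v w = f v w" for v w
      by (rule bilinear_form_eq_on_tensors) (use g bil val in auto)
    thus "g = f" by (intro ext)
  qed
  thus "bilinear_form sV (tensor_form sV \<tau> f1 f2)"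
    "tensor_form sV \<tau> f1 f2 (\<tau> a b) (\<tau> a' b') = f1 a a' * f2 b b'" using bil val by auto
qed

text \<open>\<open>P i\<close> reads off the coefficient of \<open>b i\<close>, which presents V as
  a direct sum of copies of the second factor. It is induced by the bilinear map sending (a, x) to
  \<open>s2 (c i a) x\<close>.\<close>

lemma left_coordinates:
  assumes C: "coord_system s1 I b c"
  obtains P where "\<And>i. i \<in> I \<Longrightarrow> Vector_Spaces.linear sV s2 (P i)"
    "\<And>i a x. i \<in> I \<Longrightarrow> P i (\<tau> a x) = s2 (c i a) x"
    "\<And>v. (\<Sum>i\<in>I. \<tau> (b i) (P i v)) = v"
proof -
  interpret S2: vector_space s2 by (rule vs2)
  interpret SV: vector_space sV by (rule vsV)
  have "\<exists>R. i \<in> I \<longrightarrow> Vector_Spaces.linear sV s2 R \<and> (\<forall>a x. R (\<tau> a x) = s2 (c i a) x)" for i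
  proof (cases "i \<in> I")
    case True
    note ci = coord_system_dest(3)[OF C True]
    show ?thesis
      by (rule universal[of s2 "\<lambda>a x. s2 (c i a) x"])
        (auto intro!: linear_mapI[OF vs1 vs2] linear_mapI[OF vs2 vs2]
          simp: linear_map_add[OF ci] linear_map_scale[OF ci] S2.scale_left_distrib S2.scale_right_distrib
          mult.commute)
  qed auto
  then obtain P where P: "\<And>i. i \<in> I \<Longrightarrow> Vector_Spaces.linear sV s2 (P i)"
    "\<And>i a x. i \<in> I \<Longrightarrow> P i (\<tau> a x) = s2 (c i a) x" by metis
  have "(\<Sum>i\<in>I. \<tau> (b i) (P i v)) = v" for v
  proof (rule linear_eq_on_tensors[of sV "\<lambda>v. \<Sum>i\<in>I. \<tau> (b i) (P i v)" "\<lambda>v. v"])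
    show "Vector_Spaces.linear sV sV (\<lambda>v. \<Sum>i\<in>I. \<tau> (b i) (P i v))"
      by (rule linear_mapI[OF vsV vsV])
        (auto simp: linear_map_add[OF P(1)] linear_map_scale[OF P(1)] tensor_add_right tensor_scale_right
          sum.distrib SV.scale_sum_right)
    show "Vector_Spaces.linear sV sV (\<lambda>v. v)" by (rule linear_mapI[OF vsV vsV]) auto
    fix a x
    have "(\<Sum>i\<in>I. \<tau> (b i) (P i (\<tau> a x))) = (\<Sum>i\<in>I. \<tau> (s1 (c i a) (b i)) x)"
      by (intro sum.cong refl) (simp add: P(2) tensor_scale_right tensor_scale_left)
    also have "\<dots> = \<tau> (\<Sum>i\<in>I. s1 (c i a) (b i)) x"
      by (rule linear_map_sum[OF tensor_linear_left, symmetric])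
    finally show "(\<Sum>i\<in>I. \<tau> (b i) (P i (\<tau> a x))) = \<tau> a x"
      by (simp add: coord_system_dest(4)[OF C])
  qed
  thus ?thesis using that[OF P] by blast
qed

lemma right_coordinates:
  assumes C: "coord_system s2 I b c"
  obtains P where "\<And>i. i \<in> I \<Longrightarrow> Vector_Spaces.linear sV s1 (P i)"
    "\<And>i a x. i \<in> I \<Longrightarrow> P i (\<tau> a x) = s1 (c i x) a"
    "\<And>v. (\<Sum>i\<in>I. \<tau> (P i v) (b i)) = v"
proof -
  interpret S1: vector_space s1 by (rule vs1)
  interpret SV: vector_space sV by (rule vsV)
  have "\<exists>R. i \<in> I \<longrightarrow> Vector_Spaces.linear sV s1 R \<and> (\<forall>a x. R (\<tau> a x) = s1 (c i x) a)" for i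
  proof (cases "i \<in> I")
    case True
    note ci = coord_system_dest(3)[OF C True]
    show ?thesis
      by (rule universal[of s1 "\<lambda>a x. s1 (c i x) a"])
        (auto intro!: linear_mapI[OF vs1 vs1] linear_mapI[OF vs2 vs1]
          simp: linear_map_add[OF ci] linear_map_scale[OF ci] S1.scale_left_distrib S1.scale_right_distrib
          mult.commute)
  qed auto
  then obtain P where P: "\<And>i. i \<in> I \<Longrightarrow> Vector_Spaces.linear sV s1 (P i)"
    "\<And>i a x. i \<in> I \<Longrightarrow> P i (\<tau> a x) = s1 (c i x) a" by metis
  have "(\<Sum>i\<in>I. \<tau> (P i v) (b i)) = v" for v
  proof (rule linear_eq_on_tensors[of sV "\<lambda>v. \<Sum>i\<in>I. \<tau> (P i v) (b i)" "\<lambda>v. v"])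
    show "Vector_Spaces.linear sV sV (\<lambda>v. \<Sum>i\<in>I. \<tau> (P i v) (b i))"
      by (rule linear_mapI[OF vsV vsV])
        (auto simp: linear_map_add[OF P(1)] linear_map_scale[OF P(1)] tensor_add_left tensor_scale_left
          sum.distrib SV.scale_sum_right)
    show "Vector_Spaces.linear sV sV (\<lambda>v. v)" by (rule linear_mapI[OF vsV vsV]) auto
    fix a x
    have "(\<Sum>i\<in>I. \<tau> (P i (\<tau> a x)) (b i)) = (\<Sum>i\<in>I. \<tau> a (s2 (c i x) (b i)))"
      by (intro sum.cong refl) (simp add: P(2) tensor_scale_right tensor_scale_left)
    also have "\<dots> = \<tau> a (\<Sum>i\<in>I. s2 (c i x) (b i))"
      by (rule linear_map_sum[OF tensor_linear_right, symmetric])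
    finally show "(\<Sum>i\<in>I. \<tau> (P i (\<tau> a x)) (b i)) = \<tau> a x"
      by (simp add: coord_system_dest(4)[OF C])
  qed
  thus ?thesis using that[OF P] by blast
qed

text \<open>In the basis of pure tensors of basis vectors, each diagonal entry of \<open>S\<close>
  is repeated once for every element of \<open>J\<close>.\<close>

lemma lin_trace_tensor_id:
  assumes C: "coord_system s1 I b c" and C': "coord_system s2 J b' c'"
    and S: "Vector_Spaces.linear s1 s1 S"
  shows "lin_trace sV (tensor_map sV \<tau> S (\<lambda>x. x)) = of_nat (card J) * lin_trace s1 S"
proof -
  interpret S1: vector_space s1 by (rule vs1)
  interpret SV: vector_space sV by (rule vsV)
  obtain P where P: "\<And>i. i \<in> J \<Longrightarrow> Vector_Spaces.linear sV s1 (P i)"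
    "\<And>i a x. i \<in> J \<Longrightarrow> P i (\<tau> a x) = s1 (c' i x) a"
    "\<And>v. (\<Sum>i\<in>J. \<tau> (P i v) (b' i)) = v"
    using right_coordinates[OF C'] by blast
  have CV: "coord_system sV (I \<times> J) (\<lambda>(i,j). \<tau> (b i) (b' j)) (\<lambda>(i,j) v. c i (P j v))"
    unfolding coord_system_def
  proof (intro conjI ballI allI)
    fix x y assume xy: "x \<in> I \<times> J" "y \<in> I \<times> J"
    show "Vector_Spaces.linear sV (*) ((\<lambda>(i, j) v. c i (P j v)) x)"
      using xy linear_map_compose[OF P(1) coord_system_dest(3)[OF C], of "snd x" "fst x"]
      by (simp add: case_prod_beta mem_Times_iff)
    show "(case x of (i, j) \<Rightarrow> \<lambda>v. c i (P j v)) (case y of (i, j) \<Rightarrow> \<tau> (b i) (b' j)) = of_bool (x = y)"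
      using xy by (auto simp: P(2) linear_map_scale[OF coord_system_dest(3)[OF C]]
          coord_system_dest(5)[OF C] coord_system_dest(5)[OF C'])
  next
    fix v
    have "(\<Sum>x\<in>I \<times> J. sV ((case x of (i, j) \<Rightarrow> \<lambda>v. c i (P j v)) v) (case x of (i, j) \<Rightarrow> \<tau> (b i) (b' j)))
       = (\<Sum>i\<in>I. \<Sum>j\<in>J. sV (c i (P j v)) (\<tau> (b i) (b' j)))"
      by (simp add: sum.cartesian_product case_prod_beta)
    also have "\<dots> = (\<Sum>j\<in>J. \<Sum>i\<in>I. \<tau> (s1 (c i (P j v)) (b i)) (b' j))"
      by (subst sum.swap) (simp add: tensor_scale_left)
    also have "\<dots> = (\<Sum>j\<in>J. \<tau> (P j v) (b' j))"
      by (intro sum.cong refl)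
        (simp add: linear_map_sum[OF tensor_linear_left, symmetric] coord_system_dest(4)[OF C])
    finally show "(\<Sum>x\<in>I \<times> J. sV ((case x of (i, j) \<Rightarrow> \<lambda>v. c i (P j v)) v)
        (case x of (i, j) \<Rightarrow> \<tau> (b i) (b' j))) = v" using P(3) by simp
  qed (use vsV coord_system_dest(2)[OF C] coord_system_dest(2)[OF C'] in auto)
  have id: "Vector_Spaces.linear s2 s2 (\<lambda>x. x)" by (rule linear_mapI[OF vs2 vs2]) auto
  have "lin_trace sV (tensor_map sV \<tau> S (\<lambda>x. x))
      = (\<Sum>(i,j)\<in>I \<times> J. c i (P j (tensor_map sV \<tau> S (\<lambda>x. x) (\<tau> (b i) (b' j)))))"
    by (subst lin_trace_eq[OF CV tensor_map_linear[OF S id]]) (simp add: case_prod_beta)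
  also have "\<dots> = (\<Sum>(i,j)\<in>I \<times> J. c i (S (b i)))"
    by (intro sum.cong refl)
      (auto simp: tensor_map_tensor[OF S id] P(2) coord_system_dest(5)[OF C'])
  also have "\<dots> = of_nat (card J) * (\<Sum>i\<in>I. c i (S (b i)))"
    by (simp add: sum.cartesian_product[symmetric] sum_distrib_left)
  finally show ?thesis by (simp add: lin_trace_eq[OF C S])
qed

end

section \<open>Schur orthogonality\<close>

text \<open>The vector p(T) v. It serves twice: for eigenvectors over an algebraic closure, and for
  turning a polynomial identity in characteristic l into nilpotency of T - 1.\<close>

definition poly_act :: "('k::field \<Rightarrow> 'v::ab_group_add \<Rightarrow> 'v) \<Rightarrow> ('v \<Rightarrow> 'v) \<Rightarrow> 'k poly \<Rightarrow> 'v \<Rightarrow> 'v" where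
  "poly_act s T p v = (\<Sum>i\<le>Polynomial.degree p. s (Polynomial.coeff p i) ((T ^^ i) v))"

context
  fixes s :: "'k::field \<Rightarrow> 'v::ab_group_add \<Rightarrow> 'v" and T
  assumes T: "Vector_Spaces.linear s s T"
begin

interpretation vector_space s using linear_map_vector_spaces[OF T] by simp

lemma poly_act_eq:
  assumes "Polynomial.degree p \<le> n"
  shows "poly_act s T p v = (\<Sum>i\<le>n. s (Polynomial.coeff p i) ((T ^^ i) v))"
  unfolding poly_act_def
  by (rule sum.mono_neutral_left) (use assms in \<open>auto simp: coeff_eq_0\<close>)

lemma poly_act_add: "poly_act s T (p + q) v = poly_act s T p v + poly_act s T q v"
proof -
  let ?n = "max (Polynomial.degree p) (Polynomial.degree q)"
  have "Polynomial.degree (p + q) \<le> ?n" by (rule degree_add_le_max)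
  thus ?thesis by (simp add: poly_act_eq[of _ ?n] scale_left_distrib sum.distrib)
qed

lemma poly_act_smult: "poly_act s T (Polynomial.smult a p) v = s a (poly_act s T p v)"
  by (simp add: poly_act_eq[OF degree_smult_le] poly_act_def scale_sum_right)

lemma poly_act_shift: "poly_act s T (pCons 0 p) v = T (poly_act s T p v)"
proof -
  have "Polynomial.degree (pCons 0 p) \<le> Suc (Polynomial.degree p)" by (rule degree_pCons_le)
  hence "poly_act s T (pCons 0 p) v
      = (\<Sum>i\<le>Suc (Polynomial.degree p). s (Polynomial.coeff (pCons 0 p) i) ((T ^^ i) v))"
    by (rule poly_act_eq)
  also have "\<dots> = (\<Sum>i\<le>Polynomial.degree p. s (Polynomial.coeff p i) ((T ^^ Suc i) v))"
    by (subst sum.atMost_Suc_shift) simp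
  also have "\<dots> = T (poly_act s T p v)"
    by (simp add: poly_act_def linear_map_sum[OF T] linear_map_scale[OF T])
  finally show ?thesis .
qed

lemma poly_act_linear_factor:
  "poly_act s T ([:- a, 1:] * p) v = T (poly_act s T p v) - s a (poly_act s T p v)"
proof -
  have "[:- a, 1:] * p = Polynomial.smult (- a) p + pCons 0 p" by simp
  thus ?thesis by (simp only: poly_act_add poly_act_smult poly_act_shift) simp
qed

lemma poly_act_const: "poly_act s T [:a:] v = s a v"
  by (simp add: poly_act_def)

end

text \<open>Split a root off an annihilating polynomial, p = (X - a) q: either q(T) v is an
  eigenvector for a, or q annihilates v in smaller degree.\<close>

lemma exists_eigenvector:
  fixes s :: "'k::alg_closed_field \<Rightarrow> 'v::ab_group_add \<Rightarrow> 'v"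
  assumes T: "Vector_Spaces.linear s s T" and v: "v \<noteq> 0"
    and p: "p \<noteq> 0" "poly_act s T p v = 0"
  shows "\<exists>a w. w \<noteq> 0 \<and> T w = s a w"
  using p
proof (induction "Polynomial.degree p" arbitrary: p rule: less_induct)
  case less
  interpret vector_space s using linear_map_vector_spaces[OF T] by simp
  show ?case
  proof (cases "Polynomial.degree p = 0")
    case True
    then obtain a where "p = [:a:]" by (meson degree_eq_zeroE)
    hence "s a v = 0" "a \<noteq> 0" using less.prems by (auto simp: poly_act_const[OF T])
    thus ?thesis using v by simp
  next
    case False
    then obtain a where "poly p a = 0" using alg_closed_imp_poly_has_root by blast
    then obtain q where q: "p = [:- a, 1:] * q" by (auto simp: poly_eq_0_iff_dvd dvd_def)
    have q0: "q \<noteq> 0" using less.prems q by auto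
    have e: "T (poly_act s T q v) = s a (poly_act s T q v)"
      using less.prems(2)[unfolded q poly_act_linear_factor[OF T]] by simp
    have "Polynomial.degree p = Suc (Polynomial.degree q)"
      unfolding q using q0 by (subst degree_mult_eq) auto
    thus ?thesis using less.hyps[of q] q0 e by (cases "poly_act s T q v = 0") auto
  qed
qed

lemma exists_annihilating_poly:
  fixes s :: "'k::field \<Rightarrow> 'v::ab_group_add \<Rightarrow> 'v"
  assumes C: "coord_system s I b c" and T: "Vector_Spaces.linear s s T"
  shows "\<exists>p. p \<noteq> 0 \<and> poly_act s T p v = 0"
proof -
  interpret vector_space s using linear_map_vector_spaces[OF T] by simp
  define n where "n = card I"
  let ?g = "\<lambda>i. (T ^^ i) v"
  have nonzero: ?thesis if u: "(\<Sum>i\<le>n. s (u i) (?g i)) = 0" "k \<le> n" "u k \<noteq> 0" for u :: "nat \<Rightarrow> 'k" and k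
  proof -
    define p where "p = (\<Sum>i\<le>n. Polynomial.monom (u i) i)"
    have cp: "Polynomial.coeff p i = (if i \<le> n then u i else 0)" for i
      unfolding p_def by (simp add: Polynomial.coeff_sum sum.delta)
    have "Polynomial.degree p \<le> n" by (rule degree_le) (simp add: cp)
    hence "poly_act s T p v = 0" using u(1) by (simp add: poly_act_eq[OF T] cp)
    moreover have "p \<noteq> 0" using cp[of k] u(2,3) by auto
    ultimately show ?thesis by blast
  qed
  show ?thesis
  proof (cases "inj_on ?g {..n}")
    \<comment> \<open>A repetition among the vectors T^i v is a relation that the set of these
      vectors does not show; here the coefficients are 1 and -1.\<close>
    case False
    then obtain i j where ij: "i \<le> n" "j \<le> n" "i \<noteq> j" "?g i = ?g j" by (auto simp: inj_on_def)
    have "(\<Sum>k\<le>n. s (of_bool (k = i) - of_bool (k = j)) (?g k))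
        = (\<Sum>k\<le>n. if k = i then ?g k else 0) - (\<Sum>k\<le>n. if k = j then ?g k else 0)"
      unfolding sum_subtractf[symmetric] by (rule sum.cong) (auto simp: scale_left_diff_distrib)
    also have "\<dots> = 0" using ij by (simp add: sum.delta)
    finally show ?thesis by (rule nonzero[of _ i]) (use ij in auto)
  next
    case True
    have fin: "finite (b ` I)" using coord_system_dest(2)[OF C] by simp
    have "dependent (?g ` {..n})"
    proof (rule ccontr)
      assume "\<not> dependent (?g ` {..n})"
      hence "card (?g ` {..n}) \<le> card (b ` I)"
        using independent_span_bound[OF fin, of "?g ` {..n}"] coord_system_independent(3)[OF C] by simp
      also have "\<dots> \<le> n" unfolding n_def by (rule card_image_le) (rule coord_system_dest(2)[OF C])
      finally show False using True by (simp add: card_image)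
    qed
    then obtain u x where u: "x \<in> ?g ` {..n}" "u x \<noteq> 0" "(\<Sum>x\<in>?g ` {..n}. s (u x) x) = 0"
      using dependent_finite[of "?g ` {..n}"] by auto
    obtain k where k: "x = ?g k" "k \<le> n" using u(1) by auto
    have "(\<Sum>i\<le>n. s (u (?g i)) (?g i)) = 0" using u(3) True by (simp add: sum.reindex)
    thus ?thesis by (rule nonzero[of _ k]) (use k u in auto)
  qed
qed

text \<open>Over the algebraic closure the extended map has an eigenvalue a, whose eigenspace is
  stable and hence everything. As a is also a diagonal matrix entry of \<open>Y\<close>, it lies in
  the ground field, and \<open>Y\<close> is scalar before extension.\<close>

lemma schur:
  fixes s :: "'k::field \<Rightarrow> 'v::ab_group_add \<Rightarrow> 'v"
  assumes abs: "absolutely_simple TYPE('u::ab_group_add) s N \<rho>"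
    and C: "coord_system s I b c" and I: "I \<noteq> {}" and Y: "Vector_Spaces.linear s s Y"
    and \<rho>: "\<And>g. g \<in> carrier N \<Longrightarrow> Vector_Spaces.linear s s (\<rho> g)"
    and comm: "\<And>g v. g \<in> carrier N \<Longrightarrow> Y (\<rho> g v) = \<rho> g (Y v)"
  shows "\<exists>a. \<forall>v. Y v = s a v"
proof -
  obtain sL :: "'k alg_closure \<Rightarrow> 'u \<Rightarrow> 'u" and \<tau> where
    ext: "extension_of_scalars to_ac s sL \<tau>" and
    simple: "simple_rep sL N (\<lambda>g. tensor_map (\<lambda>c. sL (to_ac c)) \<tau> (\<rho> g) id)"
    using abs unfolding absolutely_simple_def by blast
  have vsL: "vector_space sL" using ext by (simp add: extension_of_scalars_def)
  have sLt: "sL a (\<tau> v x) = \<tau> v (a * x)" for a v x using ext by (simp add: extension_of_scalars_def)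
  have vss: "vector_space s" using coord_system_dest(1)[OF C] .
  have vse: "vector_space (ext_scale (to_ac :: 'k \<Rightarrow> _))"
    by unfold_locales (auto simp: ext_scale_def algebra_simps)
  interpret L: vector_space sL by fact
  interpret tensor_product s "ext_scale to_ac" "\<lambda>c. sL (to_ac c)" \<tau>
    by (intro tensor_product.intro vss vse) (use ext in \<open>simp add: extension_of_scalars_def\<close>)
  have idl: "Vector_Spaces.linear (ext_scale to_ac) (ext_scale to_ac) (id :: 'k alg_closure \<Rightarrow> _)"
    by (rule linear_mapI[OF vse vse]) auto
  define ex where "ex S = tensor_map (\<lambda>c. sL (to_ac c)) \<tau> S id" for S
  have ext': "ex S (\<tau> v x) = \<tau> (S v) x" if "Vector_Spaces.linear s s S" for S v x
    unfolding ex_def by (simp add: tensor_map_tensor[OF that idl])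
  have exl: "Vector_Spaces.linear (\<lambda>c. sL (to_ac c)) (\<lambda>c. sL (to_ac c)) (ex S)"
    if "Vector_Spaces.linear s s S" for S
    unfolding ex_def by (rule tensor_map_linear[OF that idl])
  \<comment> \<open>The tensor product provides linearity over the small field only. Linearity of
    \<open>ex S\<close> over the closure follows by comparing its two composites with
    \<open>sL a\<close> on pure tensors.\<close>
  have sLlin: "Vector_Spaces.linear (\<lambda>c. sL (to_ac c)) (\<lambda>c. sL (to_ac c)) (sL a)" for a
    by (rule linear_mapI[OF vsV vsV]) (auto simp: L.scale_right_distrib mult.commute)
  have exL: "Vector_Spaces.linear sL sL (ex S)" if S: "Vector_Spaces.linear s s S" for S
  proof (rule linear_mapI[OF vsL vsL])
    fix x y :: 'u and a
    show "ex S (x + y) = ex S x + ex S y" by (rule linear_map_add[OF exl[OF S]])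
    show "ex S (sL a x) = sL a (ex S x)"
      by (rule linear_eq_on_tensors[OF linear_map_compose[OF sLlin exl[OF S]] linear_map_compose[OF exl[OF S] sLlin]])
        (simp add: sLt ext'[OF S])
  qed
  have excomm: "ex Y (ex (\<rho> g) u) = ex (\<rho> g) (ex Y u)" if g: "g \<in> carrier N" for g u
    by (rule linear_eq_on_tensors[OF linear_map_compose[OF exl[OF \<rho>[OF g]] exl[OF Y]]
          linear_map_compose[OF exl[OF Y] exl[OF \<rho>[OF g]]]])
      (simp add: ext'[OF Y] ext'[OF \<rho>[OF g]] comm[OF g])
  obtain P where P: "\<And>i. i \<in> I \<Longrightarrow> Vector_Spaces.linear (\<lambda>c. sL (to_ac c)) (ext_scale to_ac) (P i)"
    "\<And>i a x. i \<in> I \<Longrightarrow> P i (\<tau> a x) = ext_scale to_ac (c i a) x"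
    "\<And>v. (\<Sum>i\<in>I. \<tau> (b i) (P i v)) = v"
    using left_coordinates[OF C] by blast
  obtain i0 where i0: "i0 \<in> I" using I by auto
  have c00: "c i0 (b i0) = 1" using coord_system_dest(5)[OF C i0 i0] by simp
  have u0: "\<tau> (b i0) 1 \<noteq> 0"
  proof
    assume "\<tau> (b i0) 1 = 0"
    hence "P i0 (\<tau> (b i0) 1) = 0" using linear_map_0[OF P(1)[OF i0]] by simp
    thus False using P(2)[OF i0] c00 by (simp add: ext_scale_def)
  qed
  \<comment> \<open>An annihilating polynomial over the small field remains one after extension, so
    no basis over the closure has to be produced.\<close>
  obtain p where p: "p \<noteq> 0" "poly_act s Y p (b i0) = 0"
    using exists_annihilating_poly[OF C Y] by blast
  have pow: "(ex Y ^^ n) (\<tau> v 1) = \<tau> ((Y ^^ n) v) 1" for n v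
    by (induction n) (auto simp: ext'[OF Y])
  have deg: "Polynomial.degree (map_poly to_ac p) = Polynomial.degree p"
    by (rule degree_map_poly) auto
  have "poly_act sL (ex Y) (map_poly to_ac p) (\<tau> (b i0) 1)
      = \<tau> (poly_act s Y p (b i0)) 1"
    unfolding poly_act_def deg
    by (simp add: coeff_map_poly pow linear_map_sum[OF tensor_linear_left] tensor_scale_left)
  also have "\<dots> = 0" using p(2) linear_map_0[OF tensor_linear_left] by simp
  finally have "poly_act sL (ex Y) (map_poly to_ac p) (\<tau> (b i0) 1) = 0" .
  moreover have "map_poly to_ac p \<noteq> 0" using p(1) by (simp add: map_poly_eq_0_iff)
  ultimately obtain a w where w: "w \<noteq> 0" "ex Y w = sL a w"
    using exists_eigenvector[OF exL[OF Y] u0] by blast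
  define U where "U = {u. ex Y u = sL a u}"
  have "L.subspace U" unfolding U_def
    by (rule L.subspaceI)
      (auto simp: linear_map_0[OF exL[OF Y]] linear_map_add[OF exL[OF Y]] linear_map_scale[OF exL[OF Y]]
        L.scale_right_distrib mult.commute)
  moreover have "ex (\<rho> g) ` U \<subseteq> U" if g: "g \<in> carrier N" for g
    unfolding U_def by (auto simp: excomm[OF g] linear_map_scale[OF exL[OF \<rho>[OF g]]])
  ultimately have "U = {0} \<or> U = UNIV"
    using simple unfolding simple_rep_def ex_def by blast
  moreover have "w \<in> U" using w by (simp add: U_def)
  ultimately have UU: "U = UNIV" using w(1) by auto
  have eq: "to_ac (c i (Y v)) = a * to_ac (c i v)" if i: "i \<in> I" for i v
  proof -
    have "\<tau> v 1 \<in> U" using UU by simp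
    hence "\<tau> (Y v) 1 = \<tau> v a" by (simp add: U_def ext'[OF Y] sLt)
    hence "P i (\<tau> (Y v) 1) = P i (\<tau> v a)" by simp
    thus ?thesis using P(2)[OF i] by (simp add: ext_scale_def)
  qed
  define m where "m = c i0 (Y (b i0))"
  have a: "a = to_ac m" using eq[OF i0, of "b i0"] c00 by (simp add: m_def)
  have "Y v = s m v" for v
  proof (rule coord_system_eqI[OF C])
    fix i assume i: "i \<in> I"
    have "to_ac (c i (Y v)) = to_ac (m * c i v)" using eq[OF i] by (simp add: a)
    hence "c i (Y v) = m * c i v" by (simp only: to_ac_eq_iff)
    thus "c i (Y v) = c i (s m v)" using linear_map_scale[OF coord_system_dest(3)[OF C i]] by simp
  qed
  thus ?thesis by blast
qed

text \<open>Only the matrix entries of a representation, without a space: in this form it can be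
  carried from K to L entry by entry.\<close>

locale matrix_rep = group N for N (structure) +
  fixes I :: "'i set" and D :: "'a \<Rightarrow> 'i \<Rightarrow> 'i \<Rightarrow> 'k::field"
  assumes finN: "finite (carrier N)" and finI: "finite I"
    and D_mult: "\<And>g h i j. g \<in> carrier N \<Longrightarrow> h \<in> carrier N \<Longrightarrow> i \<in> I \<Longrightarrow> j \<in> I \<Longrightarrow>
      D (g \<otimes> h) i j = (\<Sum>k\<in>I. D g i k * D h k j)"
    and D_one: "\<And>i j. i \<in> I \<Longrightarrow> j \<in> I \<Longrightarrow> D \<one> i j = of_bool (i = j)"
begin

text \<open>D(g)^T F = F D(g^-1), that is D(g)^T F D(g) = F with one factor moved over, which lets g
  be pushed across F inside a sum.\<close>

definition invariant_matrix :: "('i \<Rightarrow> 'i \<Rightarrow> 'k) \<Rightarrow> bool" where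
  "invariant_matrix F \<longleftrightarrow> (\<forall>g\<in>carrier N. \<forall>i\<in>I. \<forall>j\<in>I.
     (\<Sum>k\<in>I. D g k i * F k j) = (\<Sum>k\<in>I. F i k * D (inv g) k j))"

text \<open>The summand is the entry (i, j) of D(h)^T E D(h), with E the elementary matrix at (a,
  b); summation over the group makes the result invariant.\<close>

lemma invariant_average:
  assumes ab: "a \<in> I" "b \<in> I"
  shows "invariant_matrix (\<lambda>i j. \<Sum>h\<in>carrier N. D h a i * D h b j)"
  unfolding invariant_matrix_def
proof (intro ballI)
  fix g i j assume g: "g \<in> carrier N" and ij: "i \<in> I" "j \<in> I"
  have "(\<Sum>k\<in>I. D g k i * (\<Sum>h\<in>carrier N. D h a k * D h b j))
      = (\<Sum>h\<in>carrier N. (\<Sum>k\<in>I. D h a k * D g k i) * D h b j)"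
    by (simp add: sum_distrib_left sum_distrib_right sum.swap[of _ I] mult_ac)
  also have "\<dots> = (\<Sum>h\<in>carrier N. D (h \<otimes> g) a i * D h b j)"
    by (intro sum.cong refl) (simp add: D_mult g ij ab)
  also have "\<dots> = (\<Sum>h\<in>carrier N. D h a i * D (h \<otimes> inv g) b j)"
    by (rule sum.reindex_bij_witness[of _ "\<lambda>h. h \<otimes> inv g" "\<lambda>h. h \<otimes> g"])
      (use g in \<open>auto simp: m_assoc\<close>)
  also have "\<dots> = (\<Sum>h\<in>carrier N. D h a i * (\<Sum>k\<in>I. D h b k * D (inv g) k j))"
    by (intro sum.cong refl) (simp add: D_mult g ij ab)
  also have "\<dots> = (\<Sum>k\<in>I. (\<Sum>h\<in>carrier N. D h a i * D h b k) * D (inv g) k j)"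
    by (simp add: sum_distrib_left sum_distrib_right sum.swap[of _ I] mult_ac)
  finally show "(\<Sum>k\<in>I. D g k i * (\<Sum>h\<in>carrier N. D h a k * D h b j))
      = (\<Sum>k\<in>I. (\<Sum>h\<in>carrier N. D h a i * D h b k) * D (inv g) k j)" .
qed

end

text \<open>These relations stand in for absolute simplicity: they control invariant forms and
  supply matrix units, and they survive reduction as soon as \<open>\<gamma>\<close> stays
  nonzero.\<close>

locale orthogonal_rep = matrix_rep N I D
  for N (structure) and I :: "'i set" and D :: "'a \<Rightarrow> 'i \<Rightarrow> 'i \<Rightarrow> 'k::field" +
  fixes \<gamma> :: 'k
  assumes orth: "\<And>a i j b. a \<in> I \<Longrightarrow> i \<in> I \<Longrightarrow> j \<in> I \<Longrightarrow> b \<in> I \<Longrightarrow>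
      (\<Sum>g\<in>carrier N. D g a i * D (inv g) j b) = (if i = j \<and> a = b then \<gamma> else 0)"
    and \<gamma>0: "\<gamma> \<noteq> 0"
begin

lemma invariant_proportional:
  assumes F: "invariant_matrix F" and J: "invariant_matrix J"
    and I: "i \<in> I" "j \<in> I" "x \<in> I" "z \<in> I"
  shows "J z x * F i j = F x z * J j i"
proof -
  \<comment> \<open>Evaluate one average by orthogonality in two ways: moving \<open>g\<close> across \<open>F\<close>, or across \<open>J\<close>.\<close>
  define S where "S = (\<Sum>g\<in>carrier N. (\<Sum>k\<in>I. D g k i * F k z) * (\<Sum>m\<in>I. D g m j * J m x))"
  have "S = (\<Sum>g\<in>carrier N. (\<Sum>k\<in>I. F i k * D (inv g) k z) * (\<Sum>m\<in>I. D g m j * J m x))"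
    unfolding S_def using F I by (intro sum.cong refl) (simp add: invariant_matrix_def)
  also have "\<dots> = (\<Sum>g\<in>carrier N. \<Sum>k\<in>I. \<Sum>m\<in>I. F i k * J m x * (D g m j * D (inv g) k z))"
    by (intro sum.cong refl) (simp only: sum_product, simp add: mult_ac)
  also have "\<dots> = (\<Sum>k\<in>I. \<Sum>m\<in>I. \<Sum>g\<in>carrier N. F i k * J m x * (D g m j * D (inv g) k z))"
    by (subst sum.swap, intro sum.cong refl sum.swap)
  also have "\<dots> = (\<Sum>k\<in>I. \<Sum>m\<in>I. if m = z then (if k = j then F i k * J m x * \<gamma> else 0) else 0)"
    unfolding sum_distrib_left[symmetric]
    by (intro sum.cong refl) (auto simp: orth I)
  also have "\<dots> = F i j * J z x * \<gamma>" using I finI by (simp add: sum.delta sum.delta')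
  finally have S1: "S = F i j * J z x * \<gamma>" .
  have "S = (\<Sum>g\<in>carrier N. (\<Sum>k\<in>I. D g k i * F k z) * (\<Sum>m\<in>I. J j m * D (inv g) m x))"
    unfolding S_def using J I by (intro sum.cong refl) (simp add: invariant_matrix_def)
  also have "\<dots> = (\<Sum>g\<in>carrier N. \<Sum>k\<in>I. \<Sum>m\<in>I. F k z * J j m * (D g k i * D (inv g) m x))"
    by (intro sum.cong refl) (simp only: sum_product, simp add: mult_ac)
  also have "\<dots> = (\<Sum>k\<in>I. \<Sum>m\<in>I. \<Sum>g\<in>carrier N. F k z * J j m * (D g k i * D (inv g) m x))"
    by (subst sum.swap, intro sum.cong refl sum.swap)
  also have "\<dots> = (\<Sum>k\<in>I. \<Sum>m\<in>I. if m = i then (if k = x then F k z * J j m * \<gamma> else 0) else 0)"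
    unfolding sum_distrib_left[symmetric]
    by (intro sum.cong refl) (auto simp: orth I)
  also have "\<dots> = F x z * J j i * \<gamma>" using I finI by (simp add: sum.delta sum.delta')
  finally show ?thesis using S1 \<gamma>0 by (simp add: mult.commute)
qed

text \<open>The sums form an invariant matrix, hence a multiple of the antisymmetric
  \<open>J\<close>; a nonzero entry of \<open>J\<close> is cancelled at the end. As an identity of
  entries the conclusion can be reduced modulo the maximal ideal.\<close>

lemma average_antisymmetric:
  assumes J: "invariant_matrix J" and anti: "\<And>i j. i \<in> I \<Longrightarrow> j \<in> I \<Longrightarrow> J i j = - J j i"
    and nz: "z \<in> I" "x \<in> I" "J z x \<noteq> 0" and I: "a \<in> I" "b \<in> I" "i \<in> I" "j \<in> I"
  shows "(\<Sum>h\<in>carrier N. D h a i * D h b j) = - (\<Sum>h\<in>carrier N. D h a j * D h b i)"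
proof -
  define F where "F i j = (\<Sum>h\<in>carrier N. D h a i * D h b j)" for i j
  have F: "invariant_matrix F" unfolding F_def using I by (intro invariant_average)
  have "J z x * F i j = J z x * (- F j i)"
    using invariant_proportional[OF F J, of i j x z] invariant_proportional[OF F J, of j i x z]
      nz I anti[of i j] by simp
  hence "F i j = - F j i" using mult_left_cancel[OF nz(3)] by blast
  thus ?thesis by (simp add: F_def)
qed

end

text \<open>The average of a rank one map over the group commutes with it, so \<open>schur\<close>
  makes it scalar; its trace identifies the scalar.\<close>

lemma schur_orthogonality:
  fixes s :: "'k::field \<Rightarrow> 'v::ab_group_add \<Rightarrow> 'v" and N (structure)
  assumes abs: "absolutely_simple TYPE('u::ab_group_add) s N \<rho>"
    and C: "coord_system s I b c" and I: "I \<noteq> {}"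
    and N: "group N" "finite (carrier N)"
    and \<rho>: "\<And>g. g \<in> carrier N \<Longrightarrow> Vector_Spaces.linear s s (\<rho> g)"
    and mult: "\<And>g h v. g \<in> carrier N \<Longrightarrow> h \<in> carrier N \<Longrightarrow> \<rho> (g \<otimes> h) v = \<rho> g (\<rho> h v)"
    and one: "\<And>v. \<rho> \<one> v = v"
    and char0: "\<And>n. n > 0 \<Longrightarrow> of_nat n \<noteq> (0::'k)"
  shows "orthogonal_rep N I (\<lambda>g i j. c i (\<rho> g (b j))) (of_nat (card (carrier N)) / of_nat (card I))"
proof -
  interpret group N by fact
  interpret vector_space s using coord_system_dest(1)[OF C] .
  have finI: "finite I" using coord_system_dest(2)[OF C] .
  define D where "D g i j = c i (\<rho> g (b j))" for g i j
  have expand: "c i (\<rho> g v) = (\<Sum>k\<in>I. D g i k * c k v)" if "g \<in> carrier N" "i \<in> I" for g i v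
    unfolding D_def
    using coord_system_comp[OF C linear_map_compose[OF \<rho>[OF that(1)] coord_system_dest(3)[OF C that(2)]], of v]
    by (simp add: mult.commute)
  interpret matrix_rep N I D
  proof unfold_locales
    fix g h i j assume gh: "g \<in> carrier N" "h \<in> carrier N" "i \<in> I" "j \<in> I"
    show "D (g \<otimes> h) i j = (\<Sum>k\<in>I. D g i k * D h k j)"
      using expand[OF gh(1,3), of "\<rho> h (b j)"] gh by (simp add: D_def mult)
  next
    fix i j assume "i \<in> I" "j \<in> I"
    thus "D \<one> i j = of_bool (i = j)" by (simp add: D_def one coord_system_dest(5)[OF C])
  qed (use N finI in auto)
  have "(\<Sum>g\<in>carrier N. D g a i * D (inv g) j x)
      = (if i = j \<and> a = x then of_nat (card (carrier N)) / of_nat (card I) else 0)"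
    if aI: "a \<in> I" "i \<in> I" "j \<in> I" "x \<in> I" for a i j x
  proof -
    \<comment> \<open>The sum over g of the conjugates by \<open>\<rho> g\<close> of the rank one
      map sending v to \<open>s (c j v) (b i)\<close>.\<close>
    define Y where "Y v = (\<Sum>g\<in>carrier N. s (c j (\<rho> (inv g) v)) (\<rho> g (b i)))" for v
    note cj = coord_system_dest(3)[OF C aI(3)]
    have "Vector_Spaces.linear s s Y"
      by (rule linear_mapI)
        (auto simp: Y_def linear_map_add[OF \<rho>] linear_map_scale[OF \<rho>] linear_map_add[OF cj] linear_map_scale[OF cj]
          vector_space_axioms scale_left_distrib sum.distrib scale_sum_right)
    moreover have "Y (\<rho> h v) = \<rho> h (Y v)" if h: "h \<in> carrier N" for h v
    proof -
      have key: "\<rho> (inv (h \<otimes> g)) (\<rho> h v) = \<rho> (inv g) v" if g: "g \<in> carrier N" for g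
        using g h by (simp add: inv_mult_group m_assoc flip: mult)
      have "\<rho> h (Y v) = (\<Sum>g\<in>carrier N. s (c j (\<rho> (inv g) v)) (\<rho> (h \<otimes> g) (b i)))"
        unfolding Y_def by (simp add: linear_map_sum[OF \<rho>[OF h]] linear_map_scale[OF \<rho>[OF h]] mult h)
      also have "\<dots> = (\<Sum>g\<in>carrier N. s (c j (\<rho> (inv g) (\<rho> h v))) (\<rho> g (b i)))"
        by (rule sum.reindex_bij_witness[of _ "\<lambda>g. inv h \<otimes> g" "\<lambda>g. h \<otimes> g"])
          (use h in \<open>auto simp: m_assoc[symmetric] key\<close>)
      finally show ?thesis by (simp add: Y_def)
    qed
    ultimately obtain m where m: "\<And>v. Y v = s m v"
      using schur[OF abs C I _ \<rho>, of Y] by metis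
    have S: "(\<Sum>g\<in>carrier N. D g p i * D (inv g) j q) = m * of_bool (p = q)"
      if pq: "p \<in> I" "q \<in> I" for p q
    proof -
      have "c p (Y (b q)) = (\<Sum>g\<in>carrier N. D g p i * D (inv g) j q)"
        unfolding Y_def D_def using coord_system_dest(3)[OF C pq(1)]
        by (simp add: linear_map_sum linear_map_scale mult.commute)
      thus ?thesis using m[of "b q"] coord_system_dest(3)[OF C pq(1)] coord_system_dest(5)[OF C pq]
        by (simp add: linear_map_scale)
    qed
    \<comment> \<open>Taking the trace of \<open>Y\<close>: the inner sum over p contracts D(g^-1)
      D(g) to the identity matrix.\<close>
    have "m * of_nat (card I) = (\<Sum>p\<in>I. \<Sum>g\<in>carrier N. D g p i * D (inv g) j p)"
      by (simp add: S)
    also have "\<dots> = (\<Sum>g\<in>carrier N. \<Sum>p\<in>I. D (inv g) j p * D g p i)"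
      by (subst sum.swap) (simp add: mult.commute)
    also have "\<dots> = (\<Sum>g\<in>carrier N. D \<one> j i)"
      by (intro sum.cong refl) (simp add: D_mult[symmetric] aI)
    also have "\<dots> = of_nat (card (carrier N)) * of_bool (i = j)"
      using aI by (simp add: D_one)
    finally have "m = of_nat (card (carrier N)) * of_bool (i = j) / of_nat (card I)"
      using char0[of "card I"] I finI by (simp add: field_simps card_gt_0_iff)
    thus ?thesis using S[OF aI(1,4)] by simp
  qed
  moreover have "of_nat (card (carrier N)) / of_nat (card I) \<noteq> (0::'k)"
  proof -
    have "carrier N \<noteq> {}" using one_closed by blast
    thus ?thesis using char0[of "card I"] char0[of "card (carrier N)"] I finI N(2)
      by (simp add: card_gt_0_iff)
  qed
  ultimately show ?thesis
    using matrix_rep_axioms unfolding orthogonal_rep_def orthogonal_rep_axioms_def D_def by blast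
qed

section \<open>Integral bases and idempotents\<close>

text \<open>Vectors are inserted one at a time; a vector with a non-integral coefficient over
  \<open>B\<close> is exchanged for an element of \<open>B\<close>. That the basis is found inside
  \<open>S\<close> matters later: if a group permutes \<open>S\<close>, the integral span of the
  basis is stable.\<close>

lemma exists_integral_basis:
  fixes s :: "'k::field \<Rightarrow> 'v::ab_group_add \<Rightarrow> 'v"
  assumes vs: "vector_space s" and dv: "discrete_valuation v" and S: "finite S"
  shows "\<exists>B\<subseteq>S. \<not> Modules.module.dependent s B \<and>
    (\<forall>x\<in>S. \<exists>u. (\<forall>b\<in>B. u b \<in> valuation_ring v) \<and> x = (\<Sum>b\<in>B. s (u b) b))"
proof -
  interpret vector_space s by fact
  let ?O = "valuation_ring v"
  show ?thesis using S
  proof (induction S rule: finite_induct)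
    case empty
    show ?case by (intro exI[of _ "{}"]) (simp add: independent_empty)
  next
    case (insert x S)
    then obtain B where B: "B \<subseteq> S" "independent B"
      and int: "\<And>y. y \<in> S \<Longrightarrow> \<exists>u. (\<forall>b\<in>B. u b \<in> ?O) \<and> y = (\<Sum>b\<in>B. s (u b) b)" by blast
    have finB: "finite B" using B(1) insert(1) finite_subset by blast
    have xB: "x \<notin> B" using B(1) insert(2) by blast
    have self: "\<exists>u. (\<forall>b\<in>C. u b \<in> ?O) \<and> x = (\<Sum>b\<in>C. s (u b) b)"
      if C: "x \<in> C" "finite C" for C
    proof (intro exI conjI ballI)
      show "of_bool (b = x) \<in> ?O" for b using val_ring_0[OF dv] val_ring_1[OF dv] by auto
      have "(\<Sum>b\<in>C. s (of_bool (b = x)) b) = (\<Sum>b\<in>C. if b = x then b else 0)"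
        by (intro sum.cong) auto
      thus "x = (\<Sum>b\<in>C. s (of_bool (b = x)) b)" using C by (simp add: sum.delta)
    qed
    show ?case
    proof (cases "x \<in> span B")
      case False
      have "\<exists>u. (\<forall>b\<in>insert x B. u b \<in> ?O) \<and> y = (\<Sum>b\<in>insert x B. s (u b) b)" if y: "y \<in> S" for y
      proof -
        obtain u where u: "\<forall>b\<in>B. u b \<in> ?O" "y = (\<Sum>b\<in>B. s (u b) b)" using int[OF y] by blast
        have "(\<Sum>b\<in>insert x B. s ((u(x := 0)) b) b) = (\<Sum>b\<in>B. s ((u(x := 0)) b) b)"
          using finB xB by simp
        also have "\<dots> = (\<Sum>b\<in>B. s (u b) b)" using xB by (intro sum.cong) auto
        finally show ?thesis using u val_ring_0[OF dv]
          by (intro exI[of _ "u(x := 0)"]) auto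
      qed
      moreover have "independent (insert x B)" using False B(2) by (rule independent_insertI)
      moreover have "insert x B \<subseteq> insert x S" using B(1) by blast
      ultimately show ?thesis using self[of "insert x B"] finB
        by (intro exI[of _ "insert x B"]) auto
    next
      case True
      then obtain u where u: "x = (\<Sum>b\<in>B. s (u b) b)"
        using span_finite[OF finB] by auto
      show ?thesis
      proof (cases "\<forall>b\<in>B. u b \<in> ?O")
        case True
        hence "\<exists>u. (\<forall>b\<in>B. u b \<in> ?O) \<and> x = (\<Sum>b\<in>B. s (u b) b)" using u by blast
        thus ?thesis using int B by (intro exI[of _ B]) auto
      next
        case False
        define A where "A = {b\<in>B. u b \<noteq> 0}"
        have finA: "finite A" using finB by (simp add: A_def)
        obtain b1 where b1: "b1 \<in> A" "v (u b1) < 0"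
          using False unfolding A_def valuation_ring_def by (auto simp: not_le)
        \<comment> \<open>The pivot: since its valuation is minimal, every \<open>u b / u b0\<close>
          is integral, and since it is negative, so is \<open>1 / u b0\<close>.\<close>
        define b0 where "b0 = arg_min_on (\<lambda>b. v (u b)) A"
        have b0: "b0 \<in> A" and b0min: "\<And>b. b \<in> A \<Longrightarrow> v (u b0) \<le> v (u b)"
          unfolding b0_def using arg_min_if_finite(1)[OF finA, of "\<lambda>b. v (u b)"] b1(1)
            arg_min_least[OF finA, of _ "\<lambda>b. v (u b)"] by auto
        have vb0: "v (u b0) < 0" using b0min[OF b1(1)] b1(2) by simp
        have b0B: "b0 \<in> B" and ub0: "u b0 \<noteq> 0" using b0 by (auto simp: A_def)
        let ?B = "insert x (B - {b0})"
        have x: "x = s (u b0) b0 + (\<Sum>b\<in>B - {b0}. s (u b) b)"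
          unfolding u using finB b0B by (simp add: sum.remove)
        have "s (u b0) b0 = x - (\<Sum>b\<in>B - {b0}. s (u b) b)" by (subst x) simp
        hence "s (inverse (u b0)) (s (u b0) b0) = s (inverse (u b0)) (x - (\<Sum>b\<in>B - {b0}. s (u b) b))"
          by simp
        hence b0e: "b0 = s (1 / u b0) (x - (\<Sum>b\<in>B - {b0}. s (u b) b))"
          using ub0 by (simp add: divide_inverse)
        have nspan: "x \<notin> span (B - {b0})"
        proof
          assume "x \<in> span (B - {b0})"
          moreover have "(\<Sum>b\<in>B - {b0}. s (u b) b) \<in> span (B - {b0})"
            by (intro span_sum span_scale span_base) auto
          ultimately have "b0 \<in> span (B - {b0})" by (subst b0e) (intro span_scale span_diff)
          thus False using B(2) b0B by (auto simp: dependent_def)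
        qed
        have ind: "independent ?B"
          by (rule independent_insertI[OF nspan independent_mono[OF B(2)]]) auto
        have fr: "u b / u b0 \<in> ?O" if "b \<in> B" for b
        proof (cases "u b = 0")
          case True thus ?thesis using val_ring_0[OF dv] by simp
        next
          case False
          thus ?thesis using b0min[of b] that ub0
            by (simp add: valuation_ring_def A_def val_divide[OF dv])
        qed
        have fr1: "1 / u b0 \<in> ?O"
          using vb0 ub0 by (simp add: valuation_ring_def val_divide[OF dv] val_1[OF dv])
        have "\<exists>u. (\<forall>b\<in>?B. u b \<in> ?O) \<and> y = (\<Sum>b\<in>?B. s (u b) b)" if y: "y \<in> S" for y
        proof -
          obtain w where w: "\<forall>b\<in>B. w b \<in> ?O" "y = (\<Sum>b\<in>B. s (w b) b)" using int[OF y] by blast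
          define w' where "w' b = (if b = x then w b0 * (1 / u b0) else w b - w b0 * (u b / u b0))" for b
          have "y = s (w b0) b0 + (\<Sum>b\<in>B - {b0}. s (w b) b)"
            unfolding w(2) using finB b0B by (simp add: sum.remove)
          also have "s (w b0) b0 = s (w b0) (s (1 / u b0) (x - (\<Sum>b\<in>B - {b0}. s (u b) b)))"
            by (subst b0e) (rule refl)
          also have "\<dots> = s (w b0 * (1 / u b0)) x - (\<Sum>b\<in>B - {b0}. s (w b0 * (u b / u b0)) b)"
            by (simp add: scale_right_diff_distrib scale_sum_right)
          also have "\<dots> + (\<Sum>b\<in>B - {b0}. s (w b) b)
              = s (w b0 * (1 / u b0)) x + (\<Sum>b\<in>B - {b0}. s (w b - w b0 * (u b / u b0)) b)"
            by (simp add: scale_left_diff_distrib sum_subtractf)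
          also have "\<dots> = s (w' x) x + (\<Sum>b\<in>B - {b0}. s (w' b) b)"
          proof -
            have "(\<Sum>b\<in>B - {b0}. s (w b - w b0 * (u b / u b0)) b) = (\<Sum>b\<in>B - {b0}. s (w' b) b)"
              using xB by (intro sum.cong refl) (auto simp: w'_def)
            thus ?thesis by (simp add: w'_def)
          qed
          also have "\<dots> = (\<Sum>b\<in>?B. s (w' b) b)" using finB xB by simp
          finally have "y = (\<Sum>b\<in>?B. s (w' b) b)" .
          moreover have "\<forall>b\<in>?B. w' b \<in> ?O"
            using w(1) b0B fr fr1 val_ring_mult[OF dv] val_ring_diff[OF dv] xB
            by (auto simp: w'_def simp del: times_divide_eq_right)
          ultimately show ?thesis by blast
        qed
        moreover have "?B \<subseteq> insert x S" using B(1) by blast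
        ultimately show ?thesis using self[of ?B] finB ind
          by (intro exI[of _ ?B]) auto
      qed
    qed
  qed
qed

text \<open>Independence of a family also excludes repetitions, so its image has as many elements as
  a basis and cannot be enlarged by a vector outside its span.\<close>

lemma independent_family_spans:
  assumes C: "coord_system s I b c" and A: "finite A" "card A = card I"
    and ind: "\<And>u a. (\<Sum>a\<in>A. s (u a) (g a)) = 0 \<Longrightarrow> a \<in> A \<Longrightarrow> u a = 0"
  shows "\<exists>u. v = (\<Sum>a\<in>A. s (u a) (g a))"
proof -
  interpret vector_space s using coord_system_dest(1)[OF C] .
  have inj: "inj_on g A"
  proof (rule inj_onI, rule ccontr)
    fix a a' assume a: "a \<in> A" "a' \<in> A" "g a = g a'" "a \<noteq> a'"
    have "(\<Sum>x\<in>A. s (of_bool (x = a) - of_bool (x = a')) (g x))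
        = (\<Sum>x\<in>A. if x = a then g x else 0) - (\<Sum>x\<in>A. if x = a' then g x else 0)"
      unfolding sum_subtractf[symmetric] by (rule sum.cong) (auto simp: scale_left_diff_distrib)
    also have "\<dots> = 0" using a A(1) by (simp add: sum.delta)
    finally show False using ind[OF _ a(1)] a(4) by fastforce
  qed
  have indep: "independent (g ` A)"
  proof
    assume "dependent (g ` A)"
    then obtain u x where u: "x \<in> g ` A" "u x \<noteq> 0" "(\<Sum>x\<in>g ` A. s (u x) x) = 0"
      using dependent_finite[of "g ` A"] A(1) by auto
    have "(\<Sum>a\<in>A. s (u (g a)) (g a)) = 0" using u(3) inj by (simp add: sum.reindex)
    thus False using ind[of "\<lambda>a. u (g a)"] u by auto
  qed
  have finI: "finite (b ` I)" using coord_system_dest(2)[OF C] by simp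
  have "v \<in> span (g ` A)"
  proof (rule ccontr)
    assume v: "v \<notin> span (g ` A)"
    hence "independent (insert v (g ` A))" by (rule independent_insertI[OF _ indep])
    hence "card (insert v (g ` A)) \<le> card (b ` I)"
      using independent_span_bound[OF finI] coord_system_independent(3)[OF C] by auto
    moreover have "v \<notin> g ` A" using v span_base by blast
    ultimately show False
      using A inj coord_system_independent(1)[OF C] by (simp add: card_image)
  qed
  then obtain u where "v = (\<Sum>x\<in>g ` A. s (u x) x)" using span_finite[of "g ` A"] A(1) by auto
  hence "v = (\<Sum>a\<in>A. s (u (g a)) (g a))" using inj by (simp add: sum.reindex)
  thus ?thesis by (intro exI[of _ "\<lambda>a. u (g a)"])
qed

text \<open>Extend a basis of the range to the whole space. On the range \<open>e\<close> is the
  identity, and the remaining basis vectors are sent into the range, so they add nothing to the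
  diagonal. In positive characteristic the trace knows the rank only modulo the
  characteristic.\<close>

lemma lin_trace_idempotent:
  assumes C: "coord_system s I b c" and e: "Vector_Spaces.linear s s e"
    and idem: "\<And>x. e (e x) = e x"
  obtains B where "finite B" "\<not> Modules.module.dependent s B" "B \<subseteq> range e"
    "lin_trace s e = of_nat (card B)"
proof -
  interpret vector_space s using coord_system_dest(1)[OF C] .
  obtain B where B: "B \<subseteq> range e" "independent B" "range e \<subseteq> span B"
    by (rule maximal_independent_subset)
  obtain B' where B': "B \<subseteq> B'" "B' \<subseteq> UNIV" "independent B'" "UNIV \<subseteq> span B'"
    by (rule maximal_independent_subset_extend[OF subset_UNIV B(2)])
  have "finite (b ` I)" using coord_system_dest(2)[OF C] by simp
  hence finB': "finite B'"
    using independent_span_bound[OF _ B'(3), of "b ` I"] coord_system_independent(3)[OF C] by auto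
  have CB: "coord_system s B' (\<lambda>b. b) (\<lambda>b v. representation B' v b)"
    using B' finB' vector_space_axioms by (intro basis_coord_system) auto
  have "lin_trace s e = (\<Sum>x\<in>B'. representation B' (e x) x)"
    by (rule lin_trace_eq[OF CB e])
  also have "\<dots> = (\<Sum>x\<in>B'. of_bool (x \<in> B))"
  proof (rule sum.cong[OF refl])
    fix x assume x: "x \<in> B'"
    show "representation B' (e x) x = of_bool (x \<in> B)"
    proof (cases "x \<in> B")
      case True
      hence "e x = x" using B(1) idem by auto
      thus ?thesis using True x representation_basis[OF B'(3) x] by simp
    next
      case False
      have "e x \<in> span B" using B(3) by auto
      hence "representation B' (e x) = representation B (e x)"
        by (rule representation_extend[OF B'(3) _ B'(1)])
      thus ?thesis using False representation_ne_zero[of B "e x" x] by auto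
    qed
  qed
  also have "\<dots> = (\<Sum>x\<in>B. of_bool (x \<in> B))"
    by (rule sum.mono_neutral_right) (use B'(1) finB' in auto)
  finally have "lin_trace s e = of_nat (card B)" by simp
  thus ?thesis using that B B'(1) finB' finite_subset by blast
qed

section \<open>Unipotent isometries commuting with a representation\<close>

text \<open>With l the characteristic, (X - 1)^l = X^l - 1, so T - 1 is nilpotent on v. The last two
  nonzero vectors among v, n v, n (n v), ... span a Jordan block of size two.\<close>

lemma unipotent_vector:
  fixes s :: "'k::field \<Rightarrow> 'v::ab_group_add \<Rightarrow> 'v"
  assumes T: "Vector_Spaces.linear s s T" and p: "Factorial_Ring.prime CHAR('k)"
    and pow: "(T ^^ CHAR('k)) v = v" and v: "T v \<noteq> v" and n: "\<And>x. n x = T x - x"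
  obtains k where "T (n ((n ^^ k) v)) = n ((n ^^ k) v)" and "n ((n ^^ k) v) \<noteq> 0"
proof -
  interpret vector_space s using linear_map_vector_spaces[OF T] by simp
  let ?l = "CHAR('k)"
  have act: "(n ^^ k) v = poly_act s T ([:- 1, 1:] ^ k) v" for k
  proof (induction k)
    case 0
    have "poly_act s T [:1:] v = v" by (simp only: poly_act_const[OF T] scale_one)
    thus ?case by (simp add: one_pCons)
  next
    case (Suc k)
    have "poly_act s T ([:- 1, 1:] * [:- 1, 1:] ^ k) v = n (poly_act s T ([:- 1, 1:] ^ k) v)"
      by (simp only: poly_act_linear_factor[OF T] scale_one n)
    thus ?case using Suc by simp
  qed
  \<comment> \<open>The power of a sum is expanded in the commutative ring of polynomials rather
    than among operators; \<open>act\<close> translates.\<close>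
  have "[:- 1, 1:] ^ ?l = ([:- 1:] + [:0, 1:] :: 'k poly) ^ ?l" by simp
  also have "\<dots> = [:- 1:] ^ ?l + [:0, 1:] ^ ?l"
    by (rule freshmans_dream) (use p in simp_all)
  also have "[:- 1 :: 'k:] ^ ?l = [:(- 1) ^ ?l:]" by (simp add: poly_const_pow)
  also have "(- 1) ^ ?l = (- 1 :: 'k)" using minus_power_prime_CHAR[OF refl p, of 1] by simp
  also have "[:0, 1 :: 'k:] ^ ?l = Polynomial.monom 1 ?l" by (simp add: monom_altdef)
  finally have e: "[:- 1, 1:] ^ ?l = [:- 1 :: 'k:] + Polynomial.monom 1 ?l" .
  have "poly_act s T (Polynomial.monom 1 ?l) v = (\<Sum>i\<le>?l. s (if ?l = i then 1 else 0) ((T ^^ i) v))"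
    by (subst poly_act_eq[OF T degree_monom_le]) simp
  also have "\<dots> = (\<Sum>i\<le>?l. if ?l = i then (T ^^ i) v else 0)"
    by (intro sum.cong) auto
  also have "\<dots> = v" using pow by (simp add: sum.delta')
  finally have "poly_act s T (Polynomial.monom 1 ?l) v = v" .
  hence nl: "(n ^^ ?l) v = 0"
    unfolding act e by (simp only: poly_act_add[OF T] poly_act_const[OF T]) simp
  \<comment> \<open>Neither v nor n v is zero, so \<open>m\<close> is at least 2 and the exponent
    sought is \<open>m - 2\<close>.\<close>
  define m where "m = (LEAST k. (n ^^ k) v = 0)"
  have m0: "(n ^^ m) v = 0" unfolding m_def using nl by (rule LeastI)
  have mmin: "(n ^^ k) v \<noteq> 0" if "k < m" for k using not_less_Least[OF that[unfolded m_def]] .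
  have "n v \<noteq> 0" using v by (simp add: n)
  hence v0: "v \<noteq> 0" using linear_map_0[OF T] by (auto simp: n)
  have "m \<noteq> 0"
  proof
    assume "m = 0" thus False using m0 v0 by simp
  qed
  moreover have "m \<noteq> 1"
  proof
    assume "m = 1" thus False using m0 \<open>n v \<noteq> 0\<close> by simp
  qed
  ultimately obtain k where k: "m = Suc (Suc k)" by (metis One_nat_def not0_implies_Suc)
  have "n (n ((n ^^ k) v)) = 0" using m0 k by simp
  moreover have "n ((n ^^ k) v) \<noteq> 0" using mmin[of "Suc k"] k by simp
  ultimately show ?thesis using that[of k] n by simp
qed

context orthogonal_rep
begin

text \<open>No tensor decomposition is formed: P is the range of one diagonal matrix unit, and the
  units \<open>E i o'\<close> carry copies of P through the space. The hypothesis
  \<open>anti\<close> is all that is left here of the alternating form on W.\<close>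

lemma commuting_unipotent_isometry:
  fixes s :: "'k \<Rightarrow> 'v::ab_group_add \<Rightarrow> 'v" and R :: "'a \<Rightarrow> 'v \<Rightarrow> 'v" and f :: "'v \<Rightarrow> 'v \<Rightarrow> 'k"
  assumes C: "coord_system s A b c" and dim: "card A = 2 * card I" and I: "I \<noteq> {}"
    and R: "\<And>g. g \<in> carrier N \<Longrightarrow> Vector_Spaces.linear s s (R g)"
    and R_mult: "\<And>g h v. g \<in> carrier N \<Longrightarrow> h \<in> carrier N \<Longrightarrow> R (g \<otimes> h) v = R g (R h v)"
    and tr: "\<And>g. g \<in> carrier N \<Longrightarrow> lin_trace s (R g) = 2 * (\<Sum>i\<in>I. D g i i)"
    and f: "symplectic_form s f"
    and R_f: "\<And>g x y. g \<in> carrier N \<Longrightarrow> f (R g x) (R g y) = f x y"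
    and anti: "\<And>a b i j. a \<in> I \<Longrightarrow> b \<in> I \<Longrightarrow> i \<in> I \<Longrightarrow> j \<in> I \<Longrightarrow>
      (\<Sum>h\<in>carrier N. D h a i * D h b j) = - (\<Sum>h\<in>carrier N. D h a j * D h b i)"
    and char: "Factorial_Ring.prime CHAR('k)" "odd CHAR('k)" "\<not> CHAR('k) dvd card (carrier N)"
    and \<sigma>: "Vector_Spaces.linear s s \<sigma>" and \<sigma>_pow: "\<And>v. (\<sigma> ^^ CHAR('k)) v = v"
    and \<sigma>_R: "\<And>g v. g \<in> carrier N \<Longrightarrow> \<sigma> (R g v) = R g (\<sigma> v)"
    and \<sigma>_f: "\<And>x y. f (\<sigma> x) (\<sigma> y) = f x y"
  shows "\<sigma> v = v"
proof (rule ccontr)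
  assume \<sigma>v: "\<sigma> v \<noteq> v"
  interpret vector_space s using coord_system_dest(1)[OF C] .
  have two: "(2::'k) \<noteq> 0"
  proof
    assume "(2::'k) = 0"
    hence "of_nat 2 = (0::'k)" by simp
    hence "CHAR('k) dvd 2" by (simp only: of_nat_eq_0_iff_char_dvd)
    hence "CHAR('k) \<le> 2" by (intro dvd_imp_le) auto
    thus False using char(1,2) prime_ge_2_nat[OF char(1)] by auto
  qed
  have one_ne_two: "(1::'k) \<noteq> 2" by (metis add_cancel_right_right one_add_one zero_neq_one)
  have cardN: "of_nat (card (carrier N)) \<noteq> (0::'k)" using char(3) by (simp add: of_nat_eq_0_iff_char_dvd)
  have bil: "bilinear_form s f" and alt: "\<And>x. f x x = 0"
    and nondeg: "\<And>x. (\<And>y. f x y = 0) \<Longrightarrow> x = 0"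
    using f by (auto simp: symplectic_form_def alternating_form_def nondegenerate_form_def)
  have f_right: "Vector_Spaces.linear s (*) (f x)" and f_left: "Vector_Spaces.linear s (*) (\<lambda>x. f x y)" for x y
    using bil unfolding bilinear_form_def by auto
  have f_anti: "f x y = - f y x" for x y
    using alt[of "x + y"] alt[of x] alt[of y]
    by (simp add: linear_map_add[OF f_right] linear_map_add[OF f_left] add_eq_0_iff)

  \<comment> \<open>The group algebra elements that act as matrix units in the representation \<open>D\<close>.\<close>
  define E where "E i j v = (\<Sum>g\<in>carrier N. s (D (inv g) j i / \<gamma>) (R g v))" for i j v
  have E_lin: "Vector_Spaces.linear s s (E i j)" for i j
    by (rule linear_mapI)
      (auto simp: E_def vector_space_axioms linear_map_add[OF R] linear_map_scale[OF R] scale_right_distrib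
        sum.distrib scale_sum_right mult.commute)
  \<comment> \<open>Substituting h^-1 g for g turns the action of h into multiplication of the
    matrix units by the matrix of h.\<close>
  have R_E: "R h (E i j v) = (\<Sum>k\<in>I. s (D h k i) (E k j v))"
    if h: "h \<in> carrier N" and ij: "i \<in> I" "j \<in> I" for h i j v
  proof -
    have "R h (E i j v) = (\<Sum>g\<in>carrier N. s (D (inv g) j i / \<gamma>) (R (h \<otimes> g) v))"
      using h by (simp add: E_def linear_map_sum[OF R] linear_map_scale[OF R] R_mult)
    also have "\<dots> = (\<Sum>g\<in>carrier N. s (D (inv g \<otimes> h) j i / \<gamma>) (R g v))"
      by (rule sum.reindex_bij_witness[of _ "\<lambda>g. inv h \<otimes> g" "\<lambda>g. h \<otimes> g"])
        (use h in \<open>auto simp: m_assoc[symmetric] inv_mult_group, auto simp: m_assoc\<close>)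
    also have "\<dots> = (\<Sum>g\<in>carrier N. \<Sum>k\<in>I. s (D h k i) (s (D (inv g) j k / \<gamma>) (R g v)))"
      by (intro sum.cong refl)
        (simp add: D_mult h ij sum_divide_distrib scale_sum_left mult.commute)
    also have "\<dots> = (\<Sum>k\<in>I. s (D h k i) (E k j v))"
      by (subst sum.swap) (simp add: E_def scale_sum_right)
    finally show ?thesis .
  qed
  have E_E: "E i j (E k m v) = (if j = k then E i m v else 0)"
    if ij: "i \<in> I" "j \<in> I" "k \<in> I" "m \<in> I" for i j k m v
  proof -
    have "E i j (E k m v) = (\<Sum>g\<in>carrier N. \<Sum>p\<in>I. s (D g p k * D (inv g) j i / \<gamma>) (E p m v))"
      unfolding E_def[of i j]
      by (intro sum.cong refl) (simp add: R_E ij scale_sum_right mult.commute)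
    also have "\<dots> = (\<Sum>p\<in>I. s ((\<Sum>g\<in>carrier N. D g p k * D (inv g) j i) / \<gamma>) (E p m v))"
      by (subst sum.swap) (simp add: sum_divide_distrib scale_sum_left)
    also have "\<dots> = (\<Sum>p\<in>I. if p = i then (if j = k then E p m v else 0) else 0)"
      by (intro sum.cong refl) (use ij \<gamma>0 in \<open>auto simp: orth\<close>)
    also have "\<dots> = (if j = k then E i m v else 0)" using finI ij by (simp add: sum.delta)
    finally show ?thesis .
  qed
  obtain o' where o: "o' \<in> I" using I by auto
  have \<sigma>_E: "\<sigma> (E i j v) = E i j (\<sigma> v)" for i j v
    by (simp add: E_def linear_map_sum[OF \<sigma>] linear_map_scale[OF \<sigma>] \<sigma>_R)

  \<comment> \<open>Orthogonality leaves only the diagonal term i = o', where the factor 2 of the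
    trace hypothesis remains.\<close>
  have trE: "lin_trace s (E o' o') = 2"
  proof -
    have "lin_trace s (E o' o') = (\<Sum>x\<in>A. c x (E o' o' (b x)))"
      by (rule lin_trace_eq[OF C E_lin])
    also have "\<dots> = (\<Sum>x\<in>A. \<Sum>g\<in>carrier N. D (inv g) o' o' / \<gamma> * c x (R g (b x)))"
      by (intro sum.cong refl)
        (simp add: E_def linear_map_sum[OF coord_system_dest(3)[OF C]] linear_map_scale[OF coord_system_dest(3)[OF C]])
    also have "\<dots> = (\<Sum>g\<in>carrier N. D (inv g) o' o' / \<gamma> * lin_trace s (R g))"
      by (subst sum.swap) (simp add: lin_trace_eq[OF C R] sum_distrib_left)
    also have "\<dots> = (\<Sum>g\<in>carrier N. \<Sum>i\<in>I. 2 / \<gamma> * (D g i i * D (inv g) o' o'))"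
      by (intro sum.cong refl) (simp add: tr sum_distrib_left mult_ac)
    also have "\<dots> = (\<Sum>i\<in>I. 2 / \<gamma> * (\<Sum>g\<in>carrier N. D g i i * D (inv g) o' o'))"
      by (subst sum.swap) (simp add: sum_distrib_left)
    also have "\<dots> = (\<Sum>i\<in>I. if i = o' then 2 else 0)"
      by (intro sum.cong refl) (use o \<gamma>0 in \<open>auto simp: orth\<close>)
    also have "\<dots> = 2" using o finI by simp
    finally show ?thesis .
  qed
  obtain B where B: "finite B" "independent B" "B \<subseteq> range (E o' o')"
    "lin_trace s (E o' o') = of_nat (card B)"
    using lin_trace_idempotent[OF C E_lin, of o' o'] E_E o by auto
  \<comment> \<open>The rank is known only as an element of the field, but 2 differs there from 0
    and 1, so the rank is at least 2. Two independent vectors suffice: their images under the units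
    number \<open>2 * card I\<close>, the full dimension.\<close>
  have cardB: "of_nat (card B) = (2::'k)" using B(4) trE by simp
  have "card B \<noteq> 0"
  proof
    assume "card B = 0" thus False using cardB two by simp
  qed
  moreover have "card B \<noteq> 1"
  proof
    assume "card B = 1" thus False using cardB one_ne_two by simp
  qed
  ultimately have "2 \<le> card B" by simp
  then obtain B2 where B2: "B2 \<subseteq> B" "card B2 = 2" by (rule obtain_subset_with_card_n)
  then obtain p1 p2 where p12: "B2 = {p1, p2}" "p1 \<noteq> p2" by (meson card_2_iff)
  have E_fix: "E o' o' x = x" if "x \<in> range (E o' o')" for x using that E_E o by auto
  have P12: "p1 \<in> range (E o' o')" "p2 \<in> range (E o' o')" using B(3) B2 p12 by auto

  \<comment> \<open>Stated for an arbitrary independent pair in the range of \<open>E o' o'\<close>,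
    because it is applied to \<open>p1\<close>, \<open>p2\<close> and again to a pair adapted to
    \<sigma>.\<close>
  have expand: "\<exists>u w. v = (\<Sum>i\<in>I. s (u i) (E i o' x)) + (\<Sum>i\<in>I. s (w i) (E i o' y))"
    if xy: "x \<in> range (E o' o')" "y \<in> range (E o' o')"
      and ind: "\<And>a d. s a x + s d y = 0 \<Longrightarrow> a = 0 \<and> d = 0" for x y v
  proof -
    define g where "g q = (case q of (i, True) \<Rightarrow> E i o' x | (i, False) \<Rightarrow> E i o' y)" for q
    have split: "(\<Sum>q\<in>I \<times> UNIV. s (u q) (g q))
        = (\<Sum>i\<in>I. s (u (i, True)) (E i o' x)) + (\<Sum>i\<in>I. s (u (i, False)) (E i o' y))" for u
    proof -
      have "(\<Sum>q\<in>I \<times> UNIV. s (u q) (g q)) = (\<Sum>i\<in>I. \<Sum>t\<in>UNIV. s (u (i, t)) (g (i, t)))"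
        by (simp add: sum.cartesian_product case_prod_beta)
      thus ?thesis by (simp add: g_def UNIV_bool sum.distrib add.commute)
    qed
    have "\<exists>u. v = (\<Sum>q\<in>I \<times> UNIV. s (u q) (g q))"
    proof (rule independent_family_spans[OF C])
      show "finite (I \<times> (UNIV :: bool set))" using finI by simp
      show "card (I \<times> (UNIV :: bool set)) = card A" using dim by (simp add: card_cartesian_product)
      fix u q assume z: "(\<Sum>q\<in>I \<times> UNIV. s (u q) (g q)) = 0" and q: "q \<in> I \<times> (UNIV :: bool set)"
      obtain k t where kt: "q = (k, t)" "k \<in> I" using q by auto
      \<comment> \<open>\<open>E o' k\<close> isolates the term with i = k and brings it back into
        the range of \<open>E o' o'\<close>.\<close>
      have pick: "E o' k (\<Sum>i\<in>I. s (w i) (E i o' x')) = s (w k) x'"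
        if "x' \<in> range (E o' o')" for w x'
      proof -
        have "E o' k (\<Sum>i\<in>I. s (w i) (E i o' x')) = (\<Sum>i\<in>I. s (w i) (E o' k (E i o' x')))"
          by (simp add: linear_map_sum[OF E_lin] linear_map_scale[OF E_lin])
        also have "\<dots> = (\<Sum>i\<in>I. if i = k then s (w i) x' else 0)"
          by (intro sum.cong refl) (use o kt E_fix[OF that] in \<open>auto simp: E_E\<close>)
        finally show ?thesis using kt finI by (simp add: sum.delta)
      qed
      have "E o' k 0 = s (u (k, True)) x + s (u (k, False)) y"
        using pick[OF xy(1), of "\<lambda>i. u (i, True)"] pick[OF xy(2), of "\<lambda>i. u (i, False)"]
        unfolding z[symmetric] split by (simp add: linear_map_add[OF E_lin])
      hence "u (k, True) = 0 \<and> u (k, False) = 0" using ind linear_map_0[OF E_lin] by metis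
      thus "u q = 0" unfolding kt by (cases t) auto
    qed
    then obtain u where "v = (\<Sum>q\<in>I \<times> UNIV. s (u q) (g q))" by blast
    thus ?thesis unfolding split
      by (intro exI[of _ "\<lambda>i. u (i, True)"] exI[of _ "\<lambda>i. u (i, False)"])
  qed
  have ind12: "a = 0 \<and> d = 0" if "s a p1 + s d p2 = 0" for a d
  proof -
    have "independent {p1, p2}" using B(2) B2(1) p12(1) independent_mono by blast
    moreover have "(\<Sum>x\<in>{p1, p2}. s ((if x = p1 then a else d)) x) = 0"
      using that p12(2) by simp
    ultimately have "(if x = p1 then a else d) = 0" if "x \<in> {p1, p2}" for x
      using independentD[of "{p1, p2}" "{p1, p2}" "\<lambda>x. if x = p1 then a else d"] that by blast
    from this[of p1] this[of p2] show ?thesis using p12(2) by auto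
  qed

  \<comment> \<open>If \<sigma> fixed both vectors it would fix their images under the units, with
    which it commutes, and so the whole space.\<close>
  obtain p where p: "p \<in> range (E o' o')" "\<sigma> p \<noteq> p"
  proof (rule ccontr)
    assume "\<not> thesis"
    hence "\<sigma> p1 = p1" "\<sigma> p2 = p2" using that P12 by auto
    moreover obtain u w where
      "v = (\<Sum>i\<in>I. s (u i) (E i o' p1)) + (\<Sum>i\<in>I. s (w i) (E i o' p2))"
      using expand[OF P12 ind12] by blast
    ultimately have "\<sigma> v = v"
      by (simp add: linear_map_add[OF \<sigma>] linear_map_sum[OF \<sigma>] linear_map_scale[OF \<sigma>] \<sigma>_E)
    thus False using \<sigma>v by simp
  qed
  define n where "n x = \<sigma> x - x" for x
  obtain k where k: "\<sigma> (n ((n ^^ k) p)) = n ((n ^^ k) p)" "n ((n ^^ k) p) \<noteq> 0"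
    using unipotent_vector[OF \<sigma> char(1) \<sigma>_pow p(2) n_def] by blast
  \<comment> \<open>A basis of the Jordan block of \<sigma>; it stays in the range of
    \<open>E o' o'\<close> because \<sigma> commutes with that unit.\<close>
  define x y where "x = (n ^^ k) p" and "y = n x"
  have E_n: "E o' o' (n z) = n z" if "E o' o' z = z" for z
    using \<sigma>_E[of o' o' z] that by (simp add: n_def linear_map_diff[OF E_lin])
  have "E o' o' ((n ^^ j) p) = (n ^^ j) p" for j
    by (induction j) (use E_fix[OF p(1)] E_n in auto)
  hence xP: "E o' o' x = x" by (simp add: x_def)
  hence yP: "E o' o' y = y" unfolding y_def by (rule E_n)
  have \<sigma>x: "\<sigma> x = x + y" by (simp add: y_def n_def)
  have \<sigma>y: "\<sigma> y = y" and y0: "y \<noteq> 0" using k by (auto simp: x_def y_def)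

  \<comment> \<open>For fixed q and r the values of f on the copies form an invariant form of the
    representation \<open>D\<close>. Up to the invertible factor |N| it equals its average, which is
    antisymmetric by \<open>anti\<close>.\<close>
  have F_anti: "f (E i o' q) (E j o' r) = - f (E j o' q) (E i o' r)"
    if ij: "i \<in> I" "j \<in> I" for i j q r
  proof -
    define F where "F i j = f (E i o' q) (E j o' r)" for i j
    have inv: "F i j = (\<Sum>k\<in>I. \<Sum>m\<in>I. F k m * (D g k i * D g m j))"
      if g: "g \<in> carrier N" and ij: "i \<in> I" "j \<in> I" for g i j
    proof -
      have "F i j = f (R g (E i o' q)) (R g (E j o' r))" by (simp add: F_def R_f[OF g])
      also have "\<dots> = (\<Sum>k\<in>I. \<Sum>m\<in>I. F k m * (D g k i * D g m j))"
        by (simp only: R_E[OF g ij(1) o] R_E[OF g ij(2) o] linear_map_sum[OF f_left] linear_map_scale[OF f_left])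
          (simp add: linear_map_sum[OF f_right] linear_map_scale[OF f_right] F_def sum_distrib_left mult_ac)
      finally show ?thesis .
    qed
    have avg: "of_nat (card (carrier N)) * F i j
        = (\<Sum>k\<in>I. \<Sum>m\<in>I. F k m * (\<Sum>g\<in>carrier N. D g k i * D g m j))"
      if ij: "i \<in> I" "j \<in> I" for i j
    proof -
      have "of_nat (card (carrier N)) * F i j = (\<Sum>g\<in>carrier N. F i j)" by simp
      also have "\<dots> = (\<Sum>g\<in>carrier N. \<Sum>k\<in>I. \<Sum>m\<in>I. F k m * (D g k i * D g m j))"
        by (rule sum.cong[OF refl]) (rule inv[OF _ ij])
      also have "\<dots> = (\<Sum>k\<in>I. \<Sum>m\<in>I. \<Sum>g\<in>carrier N. F k m * (D g k i * D g m j))"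
        by (subst sum.swap, intro sum.cong refl sum.swap)
      finally show ?thesis by (simp add: sum_distrib_left)
    qed
    have "of_nat (card (carrier N)) * F i j = of_nat (card (carrier N)) * (- F j i)"
      unfolding mult_minus_right avg[OF ij] avg[OF ij(2,1)] sum_negf[symmetric]
      by (intro sum.cong refl) (simp add: anti[OF _ _ ij])
    hence "F i j = - F j i" using mult_left_cancel[OF cardN] by blast
    thus ?thesis by (simp add: F_def)
  qed
  have h_zero: "f (E i o' y) (E j o' x) = 0 \<and> f (E i o' y) (E j o' y) = 0"
    if ij: "i \<in> I" "j \<in> I" for i j
  proof -
    define h where "h q r = f (E i o' q) (E j o' r)" for q r
    \<comment> \<open>Exchanging the copies i and j costs one sign and exchanging the arguments of f
      another, so h is symmetric.\<close>
    have h_sym: "h q r = h r q" for q r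
      unfolding h_def using F_anti[OF ij, of q r] f_anti[of "E j o' q" "E i o' r"] by simp
    have h_add: "h (q + q') r = h q r + h q' r" "h r (q + q') = h r q + h r q'" for q q' r
      by (simp_all add: h_def linear_map_add[OF E_lin] linear_map_add[OF f_left] linear_map_add[OF f_right])
    have h_\<sigma>: "h (\<sigma> q) (\<sigma> r) = h q r" for q r
      by (simp add: h_def \<sigma>_E[symmetric] \<sigma>_f)
    \<comment> \<open>Invariance at (x, y) gives h y y = 0, and at (x, x) then h x y + h y x = 0;
      symmetry is what turns the latter into 2 h y x = 0.\<close>
    have yy: "h y y = 0" using h_\<sigma>[of x y] by (simp add: \<sigma>x \<sigma>y h_add)
    have "h x y + h y x = 0" using h_\<sigma>[of x x] yy by (simp add: \<sigma>x h_add algebra_simps)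
    hence "2 * h y x = 0" using h_sym[of x y] by simp
    hence "h y x = 0" using two by simp
    thus ?thesis using yy by (simp add: h_def)
  qed
  \<comment> \<open>Applying \<sigma> adds a y to the relation, and y is nonzero, so a = 0.\<close>
  have indxy: "a = 0 \<and> d = 0" if "s a x + s d y = 0" for a d
  proof -
    have "\<sigma> (s a x + s d y) = s a (x + y) + s d y"
      by (simp only: linear_map_add[OF \<sigma>] linear_map_scale[OF \<sigma>] \<sigma>x \<sigma>y)
    also have "\<dots> = (s a x + s d y) + s a y" by (simp add: scale_right_distrib algebra_simps)
    finally have "s a y = 0" using that linear_map_0[OF \<sigma>] by simp
    hence "a = 0" using y0 by simp
    thus ?thesis using that y0 by simp
  qed
  have "f y w = 0" for w
  proof -
    have "x \<in> range (E o' o')" "y \<in> range (E o' o')" using xP yP by (metis rangeI)+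
    from expand[OF this indxy, of w] obtain u u' where
      w: "w = (\<Sum>i\<in>I. s (u i) (E i o' x)) + (\<Sum>i\<in>I. s (u' i) (E i o' y))" by blast
    have "f (E o' o' y) w = 0"
      unfolding w using h_zero[OF o]
      by (simp add: linear_map_add[OF f_right] linear_map_sum[OF f_right] linear_map_scale[OF f_right])
    thus ?thesis using yP by simp
  qed
  hence "y = 0" by (rule nondeg)
  thus False using y0 by simp
qed

end

section \<open>Reduction modulo the maximal ideal\<close>

text \<open>Alternating times symmetric is antisymmetric, hence alternating as 2 is invertible. For
  the radical, pair v with \<open>\<tau> a x\<close>: nondegeneracy of \<open>f2\<close> in x and
  then of \<open>f1\<close> in a removes every component of v.\<close>

lemma (in tensor_product) symplectic_tensor_form:
  assumes f1: "symplectic_form s1 f1" and f2: "bilinear_form s2 f2"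
    and f2_sym: "\<And>x y. f2 x y = f2 y x" and f2_nondeg: "\<And>x. (\<And>y. f2 x y = 0) \<Longrightarrow> x = 0"
    and C: "coord_system s2 J b c" and two: "(2::'k) \<noteq> 0"
  shows "symplectic_form sV (tensor_form sV \<tau> f1 f2)"
proof -
  have bil1: "bilinear_form s1 f1" and alt1: "\<And>x. f1 x x = 0"
    and nondeg1: "\<And>x. (\<And>y. f1 x y = 0) \<Longrightarrow> x = 0"
    using f1 by (auto simp: symplectic_form_def alternating_form_def nondegenerate_form_def)
  have l1: "Vector_Spaces.linear s1 (*) (f1 x)" "Vector_Spaces.linear s1 (*) (\<lambda>x. f1 x y)" for x y
    using bil1 unfolding bilinear_form_def by auto
  have l2: "Vector_Spaces.linear s2 (*) (f2 x)" "Vector_Spaces.linear s2 (*) (\<lambda>x. f2 x y)" for x y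
    using f2 unfolding bilinear_form_def by auto
  have anti1: "f1 x y = - f1 y x" for x y
    using alt1[of "x + y"] alt1[of x] alt1[of y]
    by (simp add: linear_map_add[OF l1(1)] linear_map_add[OF l1(2)] add_eq_0_iff)
  define f where "f = tensor_form sV \<tau> f1 f2"
  have f_bil: "bilinear_form sV f" and f_t: "f (\<tau> a x) (\<tau> a' x') = f1 a a' * f2 x x'" for a a' x x'
    unfolding f_def using tensor_form[OF bil1 f2] by auto
  have lf: "Vector_Spaces.linear sV (*) (f v)" "Vector_Spaces.linear sV (*) (\<lambda>v. f v w)" for v w
    using f_bil unfolding bilinear_form_def by auto
  have "bilinear_form sV (\<lambda>v w. - f w v)"
    unfolding bilinear_form_def
    by (auto intro!: linear_mapI[OF vsV vector_space_field]
        simp: linear_map_add[OF lf(1)] linear_map_add[OF lf(2)] linear_map_scale[OF lf(1)] linear_map_scale[OF lf(2)])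
  hence anti: "f v w = - f w v" for v w
  proof (rule bilinear_form_eq_on_tensors[OF f_bil])
    fix a x a' x'
    show "f (\<tau> a x) (\<tau> a' x') = - f (\<tau> a' x') (\<tau> a x)"
      by (simp add: f_t anti1[of a a'] f2_sym[of x x'])
  qed
  have "f v v = 0" for v
  proof -
    have "2 * f v v = 0" using anti[of v v] by (simp add: eq_neg_iff_add_eq_0)
    thus ?thesis using two by simp
  qed
  moreover have nd: "v = 0" if z: "\<And>w. f v w = 0" for v
  proof -
    obtain P where P: "\<And>i. i \<in> J \<Longrightarrow> Vector_Spaces.linear sV s1 (P i)"
      "\<And>i a x. i \<in> J \<Longrightarrow> P i (\<tau> a x) = s1 (c i x) a"
      "\<And>v. (\<Sum>i\<in>J. \<tau> (P i v) (b i)) = v"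
      using right_coordinates[OF C] by blast
    have "P j v = 0" if j: "j \<in> J" for j
    proof (rule nondeg1)
      fix a
      have "f2 (\<Sum>i\<in>J. s2 (f1 (P i v) a) (b i)) x = 0" for x
      proof -
        have "f2 (\<Sum>i\<in>J. s2 (f1 (P i v) a) (b i)) x = (\<Sum>i\<in>J. f (\<tau> (P i v) (b i)) (\<tau> a x))"
          by (simp add: linear_map_sum[OF l2(2)] linear_map_scale[OF l2(2)] f_t)
        also have "\<dots> = f (\<Sum>i\<in>J. \<tau> (P i v) (b i)) (\<tau> a x)" by (rule linear_map_sum[OF lf(2), symmetric])
        finally show ?thesis by (simp add: P(3) z)
      qed
      hence "(\<Sum>i\<in>J. s2 (f1 (P i v) a) (b i)) = 0" by (rule f2_nondeg)
      hence "c j (\<Sum>i\<in>J. s2 (f1 (P i v) a) (b i)) = 0"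
        using linear_map_0[OF coord_system_dest(3)[OF C j]] by simp
      moreover have "c j (\<Sum>i\<in>J. s2 (f1 (P i v) a) (b i)) = (\<Sum>i\<in>J. if j = i then f1 (P i v) a else 0)"
        by (simp only: linear_map_sum[OF coord_system_dest(3)[OF C j]] linear_map_scale[OF coord_system_dest(3)[OF C j]])
          (intro sum.cong refl, auto simp: coord_system_dest(5)[OF C] j)
      ultimately show "f1 (P j v) a = 0" using j coord_system_dest(2)[OF C] by (simp add: sum.delta')
    qed
    hence "(\<Sum>i\<in>J. \<tau> (P i v) (b i)) = 0"
      by (intro sum.neutral) (simp add: linear_map_0[OF tensor_linear_left])
    thus ?thesis using P(3) by simp
  qed
  moreover have "w = 0" if "\<And>v. f v w = 0" for w
    using that anti[of w] by (intro nd) simp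
  ultimately show ?thesis using f_bil
    unfolding f_def symplectic_form_def alternating_form_def nondegenerate_form_def by blast
qed

locale residue_embedding =
  fixes v :: "'k::field \<Rightarrow> int" and \<phi> :: "'k set \<Rightarrow> 'l::field"
  assumes dv: "discrete_valuation v" and emb: "residue_field_embedding v \<phi>"
begin

text \<open>The composite of valuation ring, residue field and L, as a function on all of K; it is a
  ring homomorphism on the valuation ring only.\<close>

definition red where "red x = \<phi> (residue_class v x)"

lemma red_1: "red 1 = 1"
  and red_add: "x \<in> valuation_ring v \<Longrightarrow> y \<in> valuation_ring v \<Longrightarrow> red (x + y) = red x + red y"
  and red_mult: "x \<in> valuation_ring v \<Longrightarrow> y \<in> valuation_ring v \<Longrightarrow> red (x * y) = red x * red y"
  using emb by (auto simp: residue_field_embedding_def red_def)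

lemma red_0: "red 0 = 0"
  using red_add[OF val_ring_0[OF dv] val_ring_0[OF dv]] by (metis add_0 add_cancel_right_right)

lemma red_of_nat: "red (of_nat n) = of_nat n"
  by (induction n) (auto simp: red_0 red_1 red_add val_ring_1[OF dv] val_ring_of_nat[OF dv])

lemma red_minus: "x \<in> valuation_ring v \<Longrightarrow> red (- x) = - red x"
  using red_add[of x "- x"] val_ring_minus[OF dv, of x] red_0 by (simp add: add_eq_0_iff)

lemma red_sum:
  "(\<And>i. i \<in> A \<Longrightarrow> g i \<in> valuation_ring v) \<Longrightarrow> red (\<Sum>i\<in>A. g i) = (\<Sum>i\<in>A. red (g i))"
  by (induction A rule: infinite_finite_induct) (auto simp: red_0 red_add val_ring_sum[OF dv])

lemma maximal_ideal_add:
  assumes "x \<in> maximal_ideal v" "y \<in> maximal_ideal v" shows "x + y \<in> maximal_ideal v"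
  using assms val_add[OF dv, of x y]
  by (cases "x = 0"; cases "y = 0"; cases "x + y = 0") (auto simp: maximal_ideal_def)

lemma maximal_ideal_minus: "x \<in> maximal_ideal v \<Longrightarrow> - x \<in> maximal_ideal v"
  using val_minus[OF dv, of x] by (cases "x = 0") (auto simp: maximal_ideal_def)

lemma red_maximal_ideal:
  assumes x: "x \<in> maximal_ideal v" shows "red x = 0"
proof -
  have "y - x \<in> maximal_ideal v \<longleftrightarrow> y \<in> maximal_ideal v" for y
    using maximal_ideal_add[of "y - x" x] maximal_ideal_add[of y "- x"] x maximal_ideal_minus[OF x]
    by auto
  hence "residue_class v x = residue_class v 0" by (auto simp: residue_class_def)
  thus ?thesis using red_0 by (simp add: red_def)
qed

lemma CHAR_residue_field:
  assumes "Factorial_Ring.prime l" "of_nat l \<in> maximal_ideal v"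
  shows "CHAR('l) = l"
proof -
  have "of_nat l = (0::'l)" using red_maximal_ideal[OF assms(2)] red_of_nat by simp
  hence "CHAR('l) dvd l" by (simp add: of_nat_eq_0_iff_char_dvd)
  moreover have "CHAR('l) \<noteq> 1" by simp
  ultimately show ?thesis using assms(1) by (auto simp: prime_nat_iff)
qed

end

text \<open>The scalar \<open>\<gamma>\<close> is a sum of products of integral entries, hence
  integral, and \<gamma> m = k with k nonzero in L forces its reduction to be nonzero. In use k =
  |N| and m = dim W, so dim W is seen to be invertible in L as well.\<close>

lemma orthogonal_rep_red:
  fixes D :: "'a \<Rightarrow> 'i \<Rightarrow> 'i \<Rightarrow> 'k::field"
  assumes "residue_embedding v (\<phi> :: 'k set \<Rightarrow> 'l::field)" and "orthogonal_rep N I D \<gamma>"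
    and D: "\<And>g i j. g \<in> carrier N \<Longrightarrow> i \<in> I \<Longrightarrow> j \<in> I \<Longrightarrow> D g i j \<in> valuation_ring v"
    and I: "I \<noteq> {}" and \<gamma>: "\<gamma> * of_nat m = of_nat k" and k: "of_nat k \<noteq> (0::'l)"
  shows "orthogonal_rep N I (\<lambda>g i j. residue_embedding.red v \<phi> (D g i j)) (residue_embedding.red v \<phi> \<gamma>)"
proof -
  interpret residue_embedding v \<phi> by fact
  interpret orthogonal_rep N I D \<gamma> by fact
  obtain i where i: "i \<in> I" using I by auto
  have "(\<Sum>g\<in>carrier N. D g i i * D (inv\<^bsub>N\<^esub> g) i i) \<in> valuation_ring v"
    by (intro val_ring_sum[OF dv] val_ring_mult[OF dv] D i) auto
  hence \<gamma>O: "\<gamma> \<in> valuation_ring v" using orth[OF i i i i] by simp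
  have "red \<gamma> * of_nat m = of_nat k"
    using red_mult[OF \<gamma>O val_ring_of_nat[OF dv, of m]] \<gamma> by (simp add: red_of_nat)
  hence "red \<gamma> \<noteq> 0" using k by auto
  moreover have "(\<Sum>g\<in>carrier N. red (D g a i) * red (D (inv\<^bsub>N\<^esub> g) j b))
      = (if i = j \<and> a = b then red \<gamma> else 0)" if "a \<in> I" "i \<in> I" "j \<in> I" "b \<in> I" for a i j b
  proof -
    have "(\<Sum>g\<in>carrier N. red (D g a i) * red (D (inv\<^bsub>N\<^esub> g) j b))
        = red (\<Sum>g\<in>carrier N. D g a i * D (inv\<^bsub>N\<^esub> g) j b)"
      using that by (simp add: red_sum red_mult D val_ring_mult[OF dv])
    thus ?thesis using orth[OF that] red_0 by simp
  qed
  moreover have "matrix_rep N I (\<lambda>g i j. red (D g i j))"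
  proof unfold_locales
    fix g h i j assume g: "g \<in> carrier N" "h \<in> carrier N" "i \<in> I" "j \<in> I"
    show "red (D (g \<otimes>\<^bsub>N\<^esub> h) i j) = (\<Sum>k\<in>I. red (D g i k) * red (D h k j))"
      using g by (simp add: D_mult red_sum red_mult D val_ring_mult[OF dv])
  next
    fix i j assume "i \<in> I" "j \<in> I"
    thus "red (D \<one>\<^bsub>N\<^esub> i j) = of_bool (i = j)" by (simp add: D_one red_0 red_1)
  qed (use finN finI in auto)
  ultimately show ?thesis unfolding orthogonal_rep_def orthogonal_rep_axioms_def by blast
qed

lemma coord_system_vec:
  "coord_system ((*s) :: 'l::field \<Rightarrow> 'l ^ 'd \<Rightarrow> _) UNIV (\<lambda>i. axis i 1) (\<lambda>i v. v $ i)"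
  unfolding coord_system_def
proof (intro conjI ballI allI)
  show vs: "vector_space ((*s) :: 'l \<Rightarrow> 'l ^ 'd \<Rightarrow> _)"
    by unfold_locales (auto simp: vec_eq_iff algebra_simps)
  fix i :: 'd show "Vector_Spaces.linear (*s) (*) (\<lambda>v :: 'l ^ 'd. v $ i)"
    by (rule linear_mapI[OF vs vector_space_field]) auto
  fix j :: 'd show "(axis j (1::'l)) $ i = of_bool (i = j)" by (auto simp: axis_def)
next
  fix v :: "'l ^ 'd"
  show "(\<Sum>i\<in>UNIV. (v $ i) *s axis i 1) = v"
    by (rule basis_expansion)
qed simp

text \<open>If l does not divide m, then m is invertible modulo l and z is a power of z^m, so z
  would lie in the subfield.\<close>

lemma root_power_in_subfield:
  assumes h: "field_embedding h" and l: "Factorial_Ring.prime l" and z: "z ^ l = (1 :: 'e::field)"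
    and notin: "z \<notin> range h" and d: "z ^ m \<in> range h"
  shows "z ^ m = 1"
proof (cases "l dvd m")
  case True
  thus ?thesis using z by (auto simp: power_mult elim!: dvdE)
next
  case False
  hence "coprime m l" using l by (metis coprime_commute prime_imp_coprime)
  then obtain j where j: "[m * j = 1] (mod l)" using cong_solve_coprime_nat by auto
  have zm: "z ^ (i mod l) = z ^ i" for i
  proof -
    have "z ^ i = (z ^ l) ^ (i div l) * z ^ (i mod l)" by (simp flip: power_mult power_add)
    thus ?thesis using z by simp
  qed
  obtain a where a: "z ^ m = h a" using d by auto
  have "h (a ^ j) = z ^ (m * j)" by (simp add: emb_simps[OF h] a power_mult)
  also have "\<dots> = z ^ 1" using zm[of "m * j"] zm[of 1] j by (simp add: cong_def)
  finally show ?thesis using notin by (metis power_one_right rangeI)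
qed

lemma form_aut_groupD:
  assumes "T \<in> carrier (form_aut_group s f)"
  shows "Vector_Spaces.linear s s T" "bij T" "f (T x) (T y) = f x y"
  using assms by (auto simp: form_aut_group_def)

lemma form_aut_hom_mult:
  assumes "\<rho> \<in> hom N (form_aut_group s f)" "a \<in> carrier N" "b \<in> carrier N"
  shows "\<rho> (a \<otimes>\<^bsub>N\<^esub> b) v = \<rho> a (\<rho> b v)"
  using hom_mult[OF assms] by (simp add: form_aut_group_def)

text \<open>The image of the neutral element is an injective idempotent map, hence the identity;
  group laws for the isometries are bypassed.\<close>

lemma form_aut_hom_one:
  assumes "group N" and "\<rho> \<in> hom N (form_aut_group s f)"
  shows "\<rho> \<one>\<^bsub>N\<^esub> = id"
proof -
  interpret group N by fact
  have "\<rho> \<one>\<^bsub>N\<^esub> \<in> carrier (form_aut_group s f)" using assms(2) by (auto simp: hom_def)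
  hence "inj (\<rho> \<one>\<^bsub>N\<^esub>)" by (auto simp: form_aut_group_def bij_def)
  moreover have "\<rho> \<one>\<^bsub>N\<^esub> (\<rho> \<one>\<^bsub>N\<^esub> x) = \<rho> \<one>\<^bsub>N\<^esub> x" for x
    using form_aut_hom_mult[OF assms(2) one_closed one_closed, of x] by simp
  ultimately show ?thesis by (auto simp: inj_eq fun_eq_iff)
qed

section \<open>The main theorem\<close>

theorem theorem6p5:
  fixes l t :: nat
    and vF :: "'f::field_char_0 \<Rightarrow> int" and vK :: "'k::field \<Rightarrow> int"
    and iK :: "'f \<Rightarrow> 'k" and iE :: "'k \<Rightarrow> 'e::field" and \<zeta> :: 'e
    and N :: "('g, 'm) monoid_scheme" and G :: "('g \<times> 'e) monoid"
    and sW :: "'k \<Rightarrow> 'w::ab_group_add \<Rightarrow> 'w" and sV :: "'k \<Rightarrow> 'v::ab_group_add \<Rightarrow> 'v"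
    and \<tau> :: "'w \<Rightarrow> 'e \<Rightarrow> 'v"
    and f1 :: "'w \<Rightarrow> 'w \<Rightarrow> 'k" and f2 :: "'e \<Rightarrow> 'e \<Rightarrow> 'k" and f :: "'v \<Rightarrow> 'v \<Rightarrow> 'k"
    and \<rho>1 :: "'g \<Rightarrow> 'w \<Rightarrow> 'w" and \<rho>2 :: "'e \<Rightarrow> 'e \<Rightarrow> 'e" and \<rho> :: "'g \<times> 'e \<Rightarrow> 'v \<Rightarrow> 'v"
  assumes l: "Factorial_Ring.prime l" "odd l"
    and F: "discrete_valuation vF" "valuation_complete vF"
    and residue_characteristic: "of_nat l \<in> maximal_ideal vF"
    and unramified: "vF (of_nat l) = 1"
    and embeddings: "field_embedding iK" "field_embedding iE"
    and zeta: "primitive_root_of_unity l \<zeta>"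
    and K_eq: "range iE = adjoin (range (iE \<circ> iK)) {\<zeta> + inverse \<zeta>}"
    and E_eq: "UNIV = adjoin (range iE) {\<zeta>}"
    and vK: "discrete_valuation vK" "valuation_extends iK vF vK"
    and N: "group N" "finite (carrier N)" "\<not> l dvd order N"
    and W: "vector_space sW" "finite_dimensional sW" "\<exists>w::'w. w \<noteq> 0"
    and dim_W: "vector_space.dim sW (UNIV :: 'w set) = 2 * t"
    and f1: "symplectic_form sW f1"
    and \<rho>1: "\<rho>1 \<in> mon N (form_aut_group sW f1)"
    and abs_simple: "absolutely_simple TYPE('u::ab_group_add) sW N \<rho>1"
    and V: "is_tensor_product sW (ext_scale iE) sV \<tau>"
    and G_eq: "G = N \<times>\<times> root_of_unity_group \<zeta>"
    and f2_eq: "f2 = (\<lambda>x y. field_trace iE (x * nontrivial_automorphism iE y))"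
    and \<rho>2_eq: "\<rho>2 = (\<lambda>b x. b * x)"
    and f_eq: "f = tensor_form sV \<tau> f1 f2"
    and \<rho>_eq: "\<rho> = (\<lambda>(a, b). tensor_map sV \<tau> (\<rho>1 a) (\<rho>2 b))"
  shows "(symplectic_form sV f \<and> \<rho> \<in> mon G (form_aut_group sV f) \<and> simple_rep sV G \<rho>) \<and>
    (\<forall>(\<phi> :: 'k set \<Rightarrow> 'l::field) (f0 :: 'l ^ 'd \<Rightarrow> 'l ^ 'd \<Rightarrow> 'l).
       CARD('d) = 4 * t \<and> residue_field_embedding vK \<phi> \<and> symplectic_form (*s) f0 \<longrightarrow>
       \<not> (\<exists>\<rho>bar \<in> mon G (form_aut_group (*s) f0).
             \<forall>g\<in>carrier G.
               lin_trace (*s) (\<rho>bar g) = \<phi> (residue_class vK (lin_trace sV (\<rho> g)))))"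
proof -

  \<comment> \<open>Roots of unity and the residue characteristic of K\<close>
  interpret N: group N by (rule N(1))
  interpret W: vector_space sW by (rule W(1))
  note l_pos = prime_gt_0_nat[OF l(1)]
  have l3: "l \<ge> 3" using prime_ge_2_nat[OF l(1)] l(2) by (cases "l = 2") auto
  have zl: "\<zeta> ^ l = 1" and z1: "\<zeta> \<noteq> 1"
    using zeta l3 by (auto simp: primitive_root_of_unity_def dest: spec[of _ 1])
  have z0: "\<zeta> \<noteq> 0" using zl l3 by (auto simp: power_0_left)
  have charK: "of_nat n \<noteq> (0 :: 'k)" if "n > 0" for n
    using emb_of_nat[OF embeddings(1), of n] emb_eq_0_iff[OF embeddings(1), of "of_nat n"] that by simp
  have twoK: "(2 :: 'k) \<noteq> 0" using charK[of 2] by simp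
  have lK: "of_nat l \<in> maximal_ideal vK"
  proof -
    obtain e where e: "e > 0" "\<And>x. x \<noteq> 0 \<Longrightarrow> vK (iK x) = e * vF x"
      using vK(2) by (auto simp: valuation_extends_def)
    have "vK (of_nat l) = e"
      using e(2)[of "of_nat l"] unramified l3 by (simp add: emb_of_nat[OF embeddings(1)])
    thus ?thesis using e by (simp add: maximal_ideal_def)
  qed

  \<comment> \<open>The quadratic extension K(\<zeta>) and the tensor product V\<close>
  have notin: "\<zeta> \<notin> range iE"
    by (rule zeta_not_in_range[OF l F(1) unramified embeddings zeta K_eq vK])
  obtain \<eta> where \<eta>: "iE \<eta> = \<zeta> + inverse \<zeta>"
  proof -
    have "\<zeta> + inverse \<zeta> \<in> adjoin (range (iE \<circ> iK)) {\<zeta> + inverse \<zeta>}" by (auto simp: adjoin_def)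
    thus ?thesis using that K_eq by (metis imageE)
  qed
  interpret Q: inverse_pair_extension iE \<zeta> \<eta>
    by unfold_locales (use embeddings z0 \<eta> notin E_eq in auto)
  interpret V: tensor_product sW "ext_scale iE" sV \<tau>
    by (intro tensor_product.intro V W(1) Q.vector_space_ext)
  interpret VV: vector_space sV by (rule V.vsV)
  have f2: "f2 = Q.tr_form" by (simp add: f2_eq Q.tr_form_def fun_eq_iff)

  \<comment> \<open>The symplectic representation on W\<close>
  have \<rho>1_hom: "\<rho>1 \<in> hom N (form_aut_group sW f1)" and \<rho>1_inj: "inj_on \<rho>1 (carrier N)"
    using \<rho>1 by (auto simp: mon_def)
  have \<rho>1_carrier: "\<rho>1 g \<in> carrier (form_aut_group sW f1)" if "g \<in> carrier N" for g
    using \<rho>1_hom that by (rule hom_in_carrier)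
  note \<rho>1_lin = form_aut_groupD(1)[OF \<rho>1_carrier] and \<rho>1_f1 = form_aut_groupD(3)[OF \<rho>1_carrier]
  note \<rho>1_mult = form_aut_hom_mult[OF \<rho>1_hom]
  have \<rho>1_one: "\<rho>1 \<one>\<^bsub>N\<^esub> v = v" for v using form_aut_hom_one[OF N(1) \<rho>1_hom] by simp
  have f1_bil: "bilinear_form sW f1" and f1_alt: "\<And>x. f1 x x = 0"
    and f1_nondeg: "\<And>x. (\<And>y. f1 x y = 0) \<Longrightarrow> x = 0"
    using f1 by (auto simp: symplectic_form_def alternating_form_def nondegenerate_form_def)
  have f1_lin: "Vector_Spaces.linear sW (*) (f1 x)" "Vector_Spaces.linear sW (*) (\<lambda>x. f1 x y)" for x y
    using f1_bil unfolding bilinear_form_def by auto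
  have f1_anti: "f1 x y = - f1 y x" for x y
    using f1_alt[of "x + y"] f1_alt[of x] f1_alt[of y]
    by (simp add: linear_map_add[OF f1_lin(1)] linear_map_add[OF f1_lin(2)] add_eq_0_iff)

  \<comment> \<open>A stable lattice and integral matrix entries\<close>
  obtain B0 where B0: "finite B0" "W.span B0 = UNIV"
  proof -
    obtain B0 where "finite_dimensional_vector_space sW B0" using W(2) by (auto simp: finite_dimensional_def)
    then interpret finite_dimensional_vector_space sW B0 .
    show ?thesis using that[OF finite_Basis span_Basis] .
  qed
  \<comment> \<open>N maps this orbit to itself. A basis chosen inside \<open>S\<close>, over which
    all of \<open>S\<close> has integral coordinates, therefore gives integral matrices.\<close>
  define S where "S = (\<lambda>(g, b). \<rho>1 g b) ` (carrier N \<times> B0)"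
  have finS: "finite S" using B0 N(2) by (simp add: S_def)
  obtain B where B: "B \<subseteq> S" "W.independent B"
    and int: "\<And>x. x \<in> S \<Longrightarrow> \<exists>u. (\<forall>b\<in>B. u b \<in> valuation_ring vK) \<and> x = (\<Sum>b\<in>B. sW (u b) b)"
    using exists_integral_basis[OF W(1) vK(1) finS] by blast
  have finB: "finite B" using B(1) finS finite_subset by blast
  have "B0 \<subseteq> S"
  proof
    fix b assume "b \<in> B0"
    hence "\<rho>1 \<one>\<^bsub>N\<^esub> b \<in> S" unfolding S_def by force
    thus "b \<in> S" by (simp add: \<rho>1_one)
  qed
  moreover have "S \<subseteq> W.span B"
  proof
    fix x assume "x \<in> S"
    then obtain u where "x = (\<Sum>b\<in>B. sW (u b) b)" using int by blast
    thus "x \<in> W.span B" by (auto intro: W.span_sum W.span_scale W.span_base)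
  qed
  ultimately have "W.span B0 \<subseteq> W.span B" by (intro W.span_minimal) auto
  hence spanB: "W.span B = UNIV" using B0(2) by auto
  define c where "c b v = W.representation B v b" for b v
  have C: "coord_system sW B (\<lambda>b. b) c"
    unfolding c_def[abs_def] by (rule basis_coord_system[OF W(1) finB B(2) spanB])
  have cardB: "card B = 2 * t"
    using W.basis_card_eq_dim[of B UNIV] B(2) spanB dim_W by simp
  have B_ne: "B \<noteq> {}"
  proof
    assume "B = {}"
    hence "(UNIV :: 'w set) = {0}" using spanB by simp
    thus False using W(3) by auto
  qed
  define D where "D g i j = c i (\<rho>1 g j)" for g i j
  have D_int: "D g i j \<in> valuation_ring vK" if g: "g \<in> carrier N" "i \<in> B" "j \<in> B" for g i j
  proof -
    obtain h b where hb: "h \<in> carrier N" "b \<in> B0" "j = \<rho>1 h b" using B(1) g(3) by (auto simp: S_def)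
    have "\<rho>1 g j = \<rho>1 (g \<otimes>\<^bsub>N\<^esub> h) b" using hb g by (simp add: \<rho>1_mult)
    hence "\<rho>1 g j \<in> S" using hb g unfolding S_def by force
    then obtain u where u: "\<forall>b\<in>B. u b \<in> valuation_ring vK" "\<rho>1 g j = (\<Sum>b\<in>B. sW (u b) b)"
      using int by blast
    have "D g i j = (\<Sum>b\<in>B. if i = b then u b else 0)"
      unfolding D_def u(2) linear_map_sum[OF coord_system_dest(3)[OF C g(2)]]
        linear_map_scale[OF coord_system_dest(3)[OF C g(2)]]
      by (intro sum.cong refl) (simp add: coord_system_dest(5)[OF C g(2)])
    also have "\<dots> = u i" using g(2) finB by simp
    finally show ?thesis using u(1) g(2) by simp
  qed

  \<comment> \<open>Orthogonality and antisymmetric averages over K\<close>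
  define \<gamma> :: 'k where "\<gamma> = of_nat (card (carrier N)) / of_nat (card B)"
  have orthK: "orthogonal_rep N B D \<gamma>"
    unfolding D_def[abs_def] \<gamma>_def
    by (rule schur_orthogonality[OF abs_simple C B_ne N(1,2) \<rho>1_lin \<rho>1_mult \<rho>1_one charK])
  interpret D: orthogonal_rep N B D \<gamma> by (rule orthK)
  have \<rho>1_expand: "\<rho>1 g j = (\<Sum>k\<in>B. sW (D g k j) k)" for g j
    unfolding D_def by (rule coord_system_dest(4)[OF C, symmetric])
  \<comment> \<open>The indices are the basis vectors themselves, so \<open>f1\<close> serves as its
    own Gram matrix.\<close>
  have J: "D.invariant_matrix f1"
    unfolding D.invariant_matrix_def
  proof (intro ballI)
    fix g i j assume g: "g \<in> carrier N" and ij: "i \<in> B" "j \<in> B"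
    have "(\<Sum>k\<in>B. D g k i * f1 k j) = f1 (\<rho>1 g i) j"
      by (subst \<rho>1_expand) (simp add: linear_map_sum[OF f1_lin(2)] linear_map_scale[OF f1_lin(2)])
    also have "\<dots> = f1 (\<rho>1 g i) (\<rho>1 g (\<rho>1 (inv\<^bsub>N\<^esub> g) j))"
      using g by (simp add: \<rho>1_one flip: \<rho>1_mult)
    also have "\<dots> = f1 i (\<rho>1 (inv\<^bsub>N\<^esub> g) j)" by (rule \<rho>1_f1[OF g])
    also have "\<dots> = (\<Sum>k\<in>B. f1 i k * D (inv\<^bsub>N\<^esub> g) k j)"
      by (subst \<rho>1_expand) (simp add: linear_map_sum[OF f1_lin(1)] linear_map_scale[OF f1_lin(1)] mult.commute)
    finally show "(\<Sum>k\<in>B. D g k i * f1 k j) = (\<Sum>k\<in>B. f1 i k * D (inv\<^bsub>N\<^esub> g) k j)" .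
  qed
  have "\<exists>b1\<in>B. \<exists>b2\<in>B. f1 b1 b2 \<noteq> 0"
  proof (rule ccontr)
    assume "\<not> ?thesis"
    hence "f1 b x = 0" if "b \<in> B" for b x
      using coord_system_comp[OF C f1_lin(1)[of b], of x] that by simp
    hence "b = 0" if "b \<in> B" for b using f1_nondeg that by blast
    hence "B = {0}" using B_ne by auto
    thus False using B(2) by (simp add: W.dependent_single)
  qed
  then obtain b1 b2 where b12: "b1 \<in> B" "b2 \<in> B" "f1 b1 b2 \<noteq> 0" by blast
  have antiK: "(\<Sum>h\<in>carrier N. D h a i * D h b j) = - (\<Sum>h\<in>carrier N. D h a j * D h b i)"
    if "a \<in> B" "b \<in> B" "i \<in> B" "j \<in> B" for a b i j
    by (rule D.average_antisymmetric[OF J f1_anti b12 that])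

  \<comment> \<open>The action of G on V\<close>
  have G_carrier: "carrier G = carrier N \<times> range (\<lambda>i. \<zeta> ^ i)"
    by (simp add: G_eq root_of_unity_group_def DirProd_def)
  have G_mult: "(a, x) \<otimes>\<^bsub>G\<^esub> (b, y) = (a \<otimes>\<^bsub>N\<^esub> b, x * y)" for a b x y
    by (simp add: G_eq root_of_unity_group_def DirProd_def)
  have G_one: "(a, 1) \<in> carrier G" and G_zeta: "(a, \<zeta> ^ i) \<in> carrier G" if "a \<in> carrier N" for a i
    unfolding G_carrier using that by (auto intro: range_eqI[of _ _ 0])
  have mul_lin: "Vector_Spaces.linear (ext_scale iE) (ext_scale iE) ((*) x)" for x
    by (rule linear_mapI[OF Q.vector_space_ext Q.vector_space_ext]) (auto simp: ext_scale_def algebra_simps)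
  have \<rho>: "\<rho> (a, x) = tensor_map sV \<tau> (\<rho>1 a) ((*) x)" for a x by (simp add: \<rho>_eq \<rho>2_eq)
  have \<rho>_lin: "Vector_Spaces.linear sV sV (\<rho> (a, x))"
    and \<rho>_tensor: "\<rho> (a, x) (\<tau> w y) = \<tau> (\<rho>1 a w) (x * y)" if "a \<in> carrier N" for a x w y
    unfolding \<rho> using V.tensor_map_linear[OF \<rho>1_lin[OF that] mul_lin]
      V.tensor_map_tensor[OF \<rho>1_lin[OF that] mul_lin] by auto
  have \<rho>_mult: "\<rho> (a, x) (\<rho> (b, y) v) = \<rho> (a \<otimes>\<^bsub>N\<^esub> b, x * y) v"
    if "a \<in> carrier N" "b \<in> carrier N" for a b x y v
    by (rule V.linear_eq_on_tensors[OF linear_map_compose[OF \<rho>_lin[OF that(2)] \<rho>_lin[OF that(1)]] \<rho>_lin[OF N.m_closed[OF that]]])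
      (simp add: \<rho>_tensor that \<rho>1_mult mult.assoc)
  have \<rho>_one: "\<rho> (\<one>\<^bsub>N\<^esub>, 1) v = v" for v
    by (rule V.linear_eq_on_tensors[OF \<rho>_lin, of _ "\<lambda>v. v"])
      (auto intro: linear_mapI V.vsV simp: \<rho>_tensor \<rho>1_one)

  \<comment> \<open>The alternating form on V and its isometries\<close>
  have f2_bil: "bilinear_form (ext_scale iE) f2"
    unfolding f2 bilinear_form_def using Q.tr_form_linear Q.tr_form_sym by (metis (no_types, lifting) ext)
  have f_sympl: "symplectic_form sV f"
    unfolding f_eq
    by (rule V.symplectic_tensor_form[OF f1 f2_bil _ _ Q.coord_system_ext twoK])
      (use Q.tr_form_sym Q.tr_form_nondegenerate[OF _ twoK] in \<open>auto simp: f2\<close>)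
  have f_bil: "bilinear_form sV f" using f_sympl by (simp add: symplectic_form_def)
  have f_tensor: "f (\<tau> a x) (\<tau> a' x') = f1 a a' * f2 x x'" for a a' x x'
    unfolding f_eq by (rule V.tensor_form_tensor[OF f1_bil f2_bil])
  have f_lin: "Vector_Spaces.linear sV (*) (f v)" "Vector_Spaces.linear sV (*) (\<lambda>v. f v w)" for v w
    using f_bil unfolding bilinear_form_def by auto
  have unit: "\<zeta> ^ i * Q.cj (\<zeta> ^ i) = 1" for i
    by (simp add: emb_power[OF Q.cj_embedding] Q.cj_z z0 flip: power_mult_distrib)
  have \<rho>_f: "f (\<rho> (a, \<zeta> ^ i) v) (\<rho> (a, \<zeta> ^ i) w) = f v w" if a: "a \<in> carrier N" for a i v w
  proof (rule V.bilinear_form_eq_on_tensors[OF _ f_bil])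
    show "bilinear_form sV (\<lambda>v w. f (\<rho> (a, \<zeta> ^ i) v) (\<rho> (a, \<zeta> ^ i) w))"
      unfolding bilinear_form_def
      using linear_map_compose[OF \<rho>_lin[OF a] f_lin(1)] linear_map_compose[OF \<rho>_lin[OF a] f_lin(2)] by blast
    fix x y x' y'
    show "f (\<rho> (a, \<zeta> ^ i) (\<tau> x y)) (\<rho> (a, \<zeta> ^ i) (\<tau> x' y')) = f (\<tau> x y) (\<tau> x' y')"
      by (simp add: \<rho>_tensor a f_tensor \<rho>1_f1 f2 Q.tr_form_isometry unit)
  qed
  have \<rho>_bij: "bij (\<rho> (a, \<zeta> ^ i))" if a: "a \<in> carrier N" for a i
  proof (rule o_bij[of "\<rho> (inv\<^bsub>N\<^esub> a, inverse (\<zeta> ^ i))"])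
    show "\<rho> (inv\<^bsub>N\<^esub> a, inverse (\<zeta> ^ i)) \<circ> \<rho> (a, \<zeta> ^ i) = id"
      using a z0 by (auto simp: fun_eq_iff \<rho>_mult \<rho>_one)
    show "\<rho> (a, \<zeta> ^ i) \<circ> \<rho> (inv\<^bsub>N\<^esub> a, inverse (\<zeta> ^ i)) = id"
      using a z0 by (auto simp: fun_eq_iff \<rho>_mult \<rho>_one)
  qed

  \<comment> \<open>Faithfulness over K\<close>
  obtain PE where PE: "\<And>i. Vector_Spaces.linear sV sW (PE i)"
    "\<And>i a x. PE i (\<tau> a x) = sW (Q.ecoord i x) a"
    using V.right_coordinates[OF Q.coord_system_ext] by (metis UNIV_I)
  have \<rho>_inj: "(a, \<zeta> ^ i) = (a', \<zeta> ^ j)"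
    if a: "a \<in> carrier N" "a' \<in> carrier N" and eq: "\<rho> (a, \<zeta> ^ i) = \<rho> (a', \<zeta> ^ j)" for a a' i j
  proof -
    \<comment> \<open>Evaluation at \<open>\<tau> w (inverse (\<zeta> ^ i))\<close> leaves a single
      root of unity, d = \<zeta>^(j-i). Comparing coordinates along 1 and \<zeta> puts d into K,
      where 1 is the only power of \<zeta>.\<close>
    define d where "d = \<zeta> ^ j * inverse (\<zeta> ^ i)"
    have tau: "\<tau> (\<rho>1 a w) 1 = \<tau> (\<rho>1 a' w) d" for w
      using fun_cong[OF eq, of "\<tau> w (inverse (\<zeta> ^ i))"] a z0 by (simp add: \<rho>_tensor d_def)
    have re: "\<rho>1 a w = sW (Q.re d) (\<rho>1 a' w)" for w
      using arg_cong[OF tau[of w], of "PE False"] by (simp add: PE(2) Q.ecoord_def Q.re_im_values)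
    have im: "sW (Q.im d) (\<rho>1 a' w) = 0" for w
      using arg_cong[OF tau[of w], of "PE True"] by (simp add: PE(2) Q.ecoord_def Q.re_im_values)
    obtain w0 :: 'w where w0: "w0 \<noteq> 0" using W(3) by blast
    have "surj (\<rho>1 a')" using form_aut_groupD(2)[OF \<rho>1_carrier[OF a(2)]] by (rule bij_is_surj)
    then obtain w where "\<rho>1 a' w = w0" by (metis surjD)
    hence "Q.im d = 0" using im[of w] w0 by simp
    hence dE: "d = iE (Q.re d)" using Q.re_im[of d] by (simp add: Q.h_simps(4))
    \<comment> \<open>A natural exponent is required, so \<zeta>^-i is written as \<zeta>^(i (l -
      1)).\<close>
    have dpow: "d = \<zeta> ^ (j + i * (l - 1))"
    proof -
      have "\<zeta> ^ (i * (l - 1)) * \<zeta> ^ i = \<zeta> ^ (i * (l - 1) + i)" by (simp add: power_add)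
      also have "i * (l - 1) + i = l * i" using l_pos by (cases l) auto
      finally have "\<zeta> ^ (i * (l - 1)) * \<zeta> ^ i = 1" using zl by (simp add: power_mult)
      hence "inverse (\<zeta> ^ i) = \<zeta> ^ (i * (l - 1))" using inverse_unique[of "\<zeta> ^ i"] by (simp add: mult.commute)
      thus ?thesis by (simp add: d_def power_add)
    qed
    have d1: "d = 1"
      unfolding dpow using dE dpow
      by (intro root_power_in_subfield[OF embeddings(2) l(1) zl notin]) (metis rangeI)
    hence "\<zeta> ^ i = \<zeta> ^ j" using z0 by (simp add: d_def field_simps)
    moreover have "\<rho>1 a w = \<rho>1 a' w" for w using re[of w] d1 by (simp add: Q.re_im_values)
    hence "\<rho>1 a = \<rho>1 a'" by (rule ext)
    hence "a = a'" using \<rho>1_inj a by (auto dest: inj_onD)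
    ultimately show ?thesis by simp
  qed
  have \<rho>_mon: "\<rho> \<in> mon G (form_aut_group sV f)"
  proof -
    have "\<rho> q \<in> carrier (form_aut_group sV f)" if "q \<in> carrier G" for q
      using that unfolding G_carrier by (auto simp: form_aut_group_def \<rho>_lin \<rho>_bij \<rho>_f)
    moreover have "\<rho> (q \<otimes>\<^bsub>G\<^esub> q') = \<rho> q \<otimes>\<^bsub>form_aut_group sV f\<^esub> \<rho> q'"
      if "q \<in> carrier G" "q' \<in> carrier G" for q q'
      using that unfolding G_carrier by (auto simp: form_aut_group_def G_mult \<rho>_mult fun_eq_iff)
    moreover have "inj_on \<rho> (carrier G)"
      unfolding G_carrier by (rule inj_onI) (auto dest: \<rho>_inj)
    ultimately show ?thesis by (auto simp: mon_def hom_def)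
  qed

  \<comment> \<open>Irreducibility over K\<close>
  have simple: "simple_rep sV G \<rho>"
    unfolding simple_rep_def
  proof (intro conjI allI impI)
    obtain w0 :: 'w where w0: "w0 \<noteq> 0" using W(3) by blast
    have "PE False (\<tau> w0 1) = w0" by (simp add: PE(2) Q.ecoord_def Q.re_im_values)
    hence "\<tau> w0 1 \<noteq> 0" using w0 linear_map_0[OF PE(1)] by metis
    thus "\<exists>v::'v. v \<noteq> 0" by blast
    fix U assume U: "VV.subspace U \<and> (\<forall>g\<in>carrier G. \<rho> g ` U \<subseteq> U)"
    hence sub: "VV.subspace U" and stable: "\<And>q u. q \<in> carrier G \<Longrightarrow> u \<in> U \<Longrightarrow> \<rho> q u \<in> U" by auto
    obtain P where P: "\<And>i v. i \<in> B \<Longrightarrow> Vector_Spaces.linear sV (ext_scale iE) (P i)"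
      "\<And>v. (\<Sum>i\<in>B. \<tau> i (P i v)) = v"
      using V.left_coordinates[OF C] by metis
    show "U = {0} \<or> U = UNIV"
    proof (cases "U \<subseteq> {0}")
      case True
      thus ?thesis using VV.subspace_0[OF sub] by auto
    next
      case False
      then obtain u where u: "u \<in> U" "u \<noteq> 0" by auto
      have "\<exists>j\<in>B. P j u \<noteq> 0"
      proof (rule ccontr)
        assume "\<not> (\<exists>j\<in>B. P j u \<noteq> 0)"
        hence "(\<Sum>i\<in>B. \<tau> i (P i u)) = 0"
          by (intro sum.neutral) (simp add: linear_map_0[OF V.tensor_linear_right])
        thus False using P(2)[of u] u(2) by simp
      qed
      then obtain j where j: "j \<in> B" "P j u \<noteq> 0" by blast
      \<comment> \<open>A matrix unit of the group algebra, acting on the first factor, isolates one component of \<open>u\<close>.\<close>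
      have comp: "\<tau> i (P j u) \<in> U" if i: "i \<in> B" for i
      proof -
        have exp_u: "\<rho> (g, 1) u = (\<Sum>k\<in>B. \<Sum>a\<in>B. sV (D g a k) (\<tau> a (P k u)))" if g: "g \<in> carrier N" for g
        proof -
          have "\<rho> (g, 1) u = \<rho> (g, 1) (\<Sum>k\<in>B. \<tau> k (P k u))" by (simp add: P(2))
          also have "\<dots> = (\<Sum>k\<in>B. \<tau> (\<rho>1 g k) (P k u))"
            by (simp add: linear_map_sum[OF \<rho>_lin[OF g]] \<rho>_tensor g)
          also have "\<dots> = (\<Sum>k\<in>B. \<Sum>a\<in>B. sV (D g a k) (\<tau> a (P k u)))"
          proof (rule sum.cong[OF refl])
            fix k assume "k \<in> B"
            have "\<tau> (\<rho>1 g k) (P k u) = \<tau> (\<Sum>a\<in>B. sW (D g a k) a) (P k u)" by (simp only: \<rho>1_expand)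
            also have "\<dots> = (\<Sum>a\<in>B. sV (D g a k) (\<tau> a (P k u)))"
              by (simp only: linear_map_sum[OF V.tensor_linear_left] V.tensor_scale_left)
            finally show "\<tau> (\<rho>1 g k) (P k u) = (\<Sum>a\<in>B. sV (D g a k) (\<tau> a (P k u)))" .
          qed
          finally show ?thesis .
        qed
        have "(\<Sum>g\<in>carrier N. sV (D (inv\<^bsub>N\<^esub> g) j i / \<gamma>) (\<rho> (g, 1) u))
            = (\<Sum>g\<in>carrier N. \<Sum>k\<in>B. \<Sum>a\<in>B. sV (D g a k * D (inv\<^bsub>N\<^esub> g) j i / \<gamma>) (\<tau> a (P k u)))"
          by (intro sum.cong refl) (simp add: exp_u VV.scale_sum_right mult.commute)
        also have "\<dots> = (\<Sum>k\<in>B. \<Sum>a\<in>B. \<Sum>g\<in>carrier N. sV (D g a k * D (inv\<^bsub>N\<^esub> g) j i / \<gamma>) (\<tau> a (P k u)))"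
          by (subst sum.swap, intro sum.cong refl sum.swap)
        also have "\<dots> = (\<Sum>k\<in>B. \<Sum>a\<in>B. sV ((\<Sum>g\<in>carrier N. D g a k * D (inv\<^bsub>N\<^esub> g) j i) / \<gamma>) (\<tau> a (P k u)))"
          by (simp add: sum_divide_distrib VV.scale_sum_left)
        also have "\<dots> = (\<Sum>k\<in>B. \<Sum>a\<in>B. if a = i then (if k = j then \<tau> a (P k u) else 0) else 0)"
          by (intro sum.cong refl) (use i j D.\<gamma>0 in \<open>auto simp: D.orth\<close>)
        also have "\<dots> = \<tau> i (P j u)" using i j finB by (simp add: sum.delta)
        finally have eq: "\<tau> i (P j u) = (\<Sum>g\<in>carrier N. sV (D (inv\<^bsub>N\<^esub> g) j i / \<gamma>) (\<rho> (g, 1) u))" ..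
        show ?thesis unfolding eq
          by (intro VV.subspace_sum[OF sub] VV.subspace_scale[OF sub] stable u(1) G_one)
      qed
      have all: "\<tau> i x \<in> U" if i: "i \<in> B" for i x
      proof -
        \<comment> \<open>Because \<open>P j u\<close> is nonzero, every x is (a + b \<zeta>) times
          it with a and b in K, and multiplication by \<zeta> is available from the second factor of
          G.\<close>
        define y where "y = x / P j u"
        have x: "x = ext_scale iE (Q.re y) (P j u) + ext_scale iE (Q.im y) (\<zeta> * P j u)"
        proof -
          have "x = (iE (Q.re y) + iE (Q.im y) * \<zeta>) * P j u" using j(2) by (simp add: Q.re_im y_def)
          thus ?thesis by (simp add: ext_scale_def algebra_simps)
        qed
        have "\<rho> (\<one>\<^bsub>N\<^esub>, \<zeta> ^ 1) (\<tau> i (P j u)) \<in> U" by (intro stable comp i G_zeta) simp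
        hence "\<tau> i (\<zeta> * P j u) \<in> U" by (simp add: \<rho>_tensor \<rho>1_one)
        thus ?thesis unfolding x V.tensor_add_right V.tensor_scale_right
          by (intro VV.subspace_add[OF sub] VV.subspace_scale[OF sub] comp[OF i])
      qed
      have "v \<in> U" for v
        using VV.subspace_sum[OF sub, of B "\<lambda>i. \<tau> i (P i v)"] all P(2)[of v] by auto
      thus ?thesis by auto
    qed
  qed

  \<comment> \<open>Contradiction from a representation over L\<close>
  have no_reduction: False
    if dim: "CARD('d) = 4 * t" and emb: "residue_field_embedding vK (\<phi> :: 'k set \<Rightarrow> 'l)"
      and f0: "symplectic_form (*s) (f0 :: 'l ^ 'd \<Rightarrow> 'l ^ 'd \<Rightarrow> 'l)"
      and \<rho>bar: "\<rho>bar \<in> mon G (form_aut_group (*s) f0)"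
      and tr: "\<And>g. g \<in> carrier G \<Longrightarrow> lin_trace (*s) (\<rho>bar g) = \<phi> (residue_class vK (lin_trace sV (\<rho> g)))"
    for \<phi> f0 \<rho>bar
  proof -
    interpret R: residue_embedding vK \<phi> by unfold_locales (use vK emb in auto)
    have char: "CHAR('l) = l" by (rule R.CHAR_residue_field[OF l(1) lK])
    have ordN: "\<not> CHAR('l) dvd card (carrier N)" using N(3) char by (simp add: order_def)
    have "of_nat (card (carrier N)) \<noteq> (0::'l)" using ordN by (simp add: of_nat_eq_0_iff_char_dvd)
    moreover have "\<gamma> * of_nat (card B) = of_nat (card (carrier N))"
      using charK[of "card B"] B_ne finB by (simp add: \<gamma>_def card_gt_0_iff)
    ultimately have orthL: "orthogonal_rep N B (\<lambda>g i j. R.red (D g i j)) (R.red \<gamma>)"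
      by (intro orthogonal_rep_red[OF R.residue_embedding_axioms orthK D_int B_ne])
    have antiL: "(\<Sum>h\<in>carrier N. R.red (D h a i) * R.red (D h b j))
        = - (\<Sum>h\<in>carrier N. R.red (D h a j) * R.red (D h b i))"
      if "a \<in> B" "b \<in> B" "i \<in> B" "j \<in> B" for a b i j
    proof -
      have O: "(\<Sum>h\<in>carrier N. D h a j * D h b i) \<in> valuation_ring vK"
        by (intro val_ring_sum[OF vK(1)] val_ring_mult[OF vK(1)] D_int that)
      have "R.red (\<Sum>h\<in>carrier N. D h a i * D h b j) = - R.red (\<Sum>h\<in>carrier N. D h a j * D h b i)"
        unfolding antiK[OF that] by (rule R.red_minus[OF O])
      thus ?thesis using that by (simp add: R.red_sum R.red_mult D_int val_ring_mult[OF vK(1)])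
    qed
    have hom: "\<rho>bar \<in> hom G (form_aut_group (*s) f0)" and inj: "inj_on \<rho>bar (carrier G)"
      using \<rho>bar by (auto simp: mon_def)
    have bar: "Vector_Spaces.linear (*s) (*s) (\<rho>bar q)" "bij (\<rho>bar q)" "f0 (\<rho>bar q x) (\<rho>bar q y) = f0 x y"
      if "q \<in> carrier G" for q x y
      using form_aut_groupD[OF hom_in_carrier[OF hom that]] by auto
    note bar_mult = form_aut_hom_mult[OF hom]
    define \<sigma> where "\<sigma> = \<rho>bar (\<one>\<^bsub>N\<^esub>, \<zeta> ^ 1)"
    have zG: "(\<one>\<^bsub>N\<^esub>, \<zeta> ^ i) \<in> carrier G" for i by (rule G_zeta) simp
    have one: "\<rho>bar (\<one>\<^bsub>N\<^esub>, 1) v = v" for v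
    proof -
      have "\<rho>bar (\<one>\<^bsub>N\<^esub>, 1) (\<rho>bar (\<one>\<^bsub>N\<^esub>, 1) v) = \<rho>bar (\<one>\<^bsub>N\<^esub>, 1) v"
        using bar_mult[OF zG[of 0] zG[of 0]] by (simp add: G_mult)
      moreover have "inj (\<rho>bar (\<one>\<^bsub>N\<^esub>, 1))" using bar(2)[OF zG[of 0]] by (simp add: bij_def)
      ultimately show ?thesis by (simp add: inj_eq)
    qed
    have pow: "(\<sigma> ^^ i) v = \<rho>bar (\<one>\<^bsub>N\<^esub>, \<zeta> ^ i) v" for i v
    proof (induction i)
      case (Suc i)
      have "\<rho>bar (\<one>\<^bsub>N\<^esub>, \<zeta> ^ Suc i) v = \<sigma> (\<rho>bar (\<one>\<^bsub>N\<^esub>, \<zeta> ^ i) v)"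
        unfolding \<sigma>_def using bar_mult[OF zG[of 1] zG[of i], of v] by (simp add: G_mult)
      thus ?case using Suc by simp
    qed (simp add: one)
    interpret L: orthogonal_rep N B "\<lambda>g i j. R.red (D g i j)" "R.red \<gamma>" by (rule orthL)
    have "\<sigma> v = v" for v
    proof (rule L.commuting_unipotent_isometry[OF coord_system_vec _ B_ne, where R = "\<lambda>g. \<rho>bar (g, 1)"])
      show "card (UNIV :: 'd set) = 2 * card B" using dim cardB by simp
      show "symplectic_form (*s) f0" by (rule f0)
      show "Factorial_Ring.prime CHAR('l)" "odd CHAR('l)" "\<not> CHAR('l) dvd card (carrier N)"
        using l char ordN by auto
      show "Vector_Spaces.linear (*s) (*s) \<sigma>" unfolding \<sigma>_def by (rule bar(1)[OF zG])
      show "(\<sigma> ^^ CHAR('l)) v = v" for v unfolding pow char zl by (rule one)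
      show "f0 (\<sigma> x) (\<sigma> y) = f0 x y" for x y unfolding \<sigma>_def by (rule bar(3)[OF zG])
    next
      fix g assume g: "g \<in> carrier N"
      show "Vector_Spaces.linear (*s) (*s) (\<rho>bar (g, 1))" by (rule bar(1)[OF G_one[OF g]])
      show "f0 (\<rho>bar (g, 1) x) (\<rho>bar (g, 1) y) = f0 x y" for x y by (rule bar(3)[OF G_one[OF g]])
      show "\<sigma> (\<rho>bar (g, 1) v) = \<rho>bar (g, 1) (\<sigma> v)" for v
        unfolding \<sigma>_def using bar_mult[OF zG[of 1] G_one[OF g], of v] bar_mult[OF G_one[OF g] zG[of 1], of v] g
        by (simp add: G_mult)
      show "\<rho>bar (g \<otimes>\<^bsub>N\<^esub> h, 1) v = \<rho>bar (g, 1) (\<rho>bar (h, 1) v)" if "h \<in> carrier N" for h v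
        using bar_mult[OF G_one[OF g] G_one[OF that], of v] by (simp add: G_mult)
      have "lin_trace sV (\<rho> (g, 1)) = of_nat (card (UNIV :: bool set)) * lin_trace sW (\<rho>1 g)"
      proof -
        have "((*) 1 :: 'e \<Rightarrow> 'e) = (\<lambda>x. x)" by auto
        thus ?thesis unfolding \<rho>
          using V.lin_trace_tensor_id[OF C Q.coord_system_ext \<rho>1_lin[OF g]] by simp
      qed
      \<comment> \<open>The 2 is the degree of K(\<zeta>) over K, kept as \<open>of_nat 2\<close> so
        that \<open>red_of_nat\<close> applies.\<close>
      also have "\<dots> = of_nat 2 * (\<Sum>i\<in>B. D g i i)"
        by (simp add: lin_trace_eq[OF C \<rho>1_lin[OF g]] D_def)
      finally have "lin_trace (*s) (\<rho>bar (g, 1)) = R.red (of_nat 2 * (\<Sum>i\<in>B. D g i i))"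
        using tr[OF G_one[OF g]] by (simp only: R.red_def)
      also have "\<dots> = of_nat 2 * (\<Sum>i\<in>B. R.red (D g i i))"
        using g by (simp only: R.red_mult R.red_sum R.red_of_nat D_int val_ring_of_nat[OF vK(1)]
            val_ring_sum[OF vK(1)])
      finally show "lin_trace (*s) (\<rho>bar (g, 1)) = 2 * (\<Sum>i\<in>B. R.red (D g i i))" by simp
    qed (rule antiL)
    \<comment> \<open>The image of \<zeta> is trivial, against faithfulness, since \<zeta> is not
      1.\<close>
    hence "\<rho>bar (\<one>\<^bsub>N\<^esub>, \<zeta> ^ 1) = \<rho>bar (\<one>\<^bsub>N\<^esub>, \<zeta> ^ 0)"
      using one by (auto simp: \<sigma>_def fun_eq_iff)
    hence "\<zeta> ^ 1 = \<zeta> ^ 0" using inj_onD[OF inj _ zG[of 1] zG[of 0]] by simp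
    thus False using z1 by simp
  qed
  show ?thesis using f_sympl \<rho>_mon simple no_reduction by blast
qed

end
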